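(* Let $(p,q)$ and $(\hat p,\hat q)$ be two pairs of potentials with $p,\hat p\in L_2(0,1)$ real-valued and $q,\hat q\in W_2^{-1}(0,1)$ real-valued distributions, such that the Sturm--Liouville operators $A$ with potential $q$ and $\hat A$ with potential $\hat q$ (with Dirichlet boundary conditions) are both positive. If the spectral data of the quadratic operator pencils $T_{p,q}$ and $T_{\hat p,\hat q}$ coincide, i.e. $\mathbf{sd}(T_{p,q})=\mathbf{sd}(T_{\hat p,\hat q})$, then $T_{p,q}=T_{\hat p,\hat q}$, i.e. $p=\hat p$ a.e. and $q=\hat q$ as distributions.
   Context: A real-valued distribution $q\in W_2^{-1}(0,1)$ is written as $q=r'$ with a real-valued $r\in L_2(0,1)$. For absolutely continuous $y$, put $y^{[1]}:=y'-ry$ (the quasi-derivative) and $\ell(y):=-\bigl(y^{[1]}\bigr)'-r y^{[1]}-r^2y$ on $\operatorname{dom}\ell=\{y\in AC[0,1]\mid y^{[1]}\in AC[0,1],\ \ell(y)\in L_2(0,1)\}$ (so $\ell(y)=-y''+qy$ in the sense of distributions). The operator $A$ in $L_2(0,1)$ is $Ay=\ell(y)$ on $\operatorname{dom}A=\{y\in\operatorname{dom}\ell\mid y(0)=y(1)=0\}$; it is self-adjoint, bounded below, with simple discrete spectrum. $A$ positive means $(Ay,y)>0$ for all nonzero $y\in\operatorname{dom}A$. $B$ is the operator of multiplication by $p$ in $L_2(0,1)$, and the quadratic operator pencil is $T_{p,q}(\lambda):=\lambda^2I-2\lambda B-A$, $\lambda\in\mathbb{C}$, on the $\lambda$-independent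 domain $\operatorname{dom}A$. Its spectrum is $\sigma(T_{p,q})=\{\lambda\in\mathbb{C}\mid 0\in\sigma(T_{p,q}(\lambda))\}$. A number $\lambda$ is an eigenvalue if $T_{p,q}(\lambda)y=0$ for some nonzero $y\in\operatorname{dom}A$ (an eigenfunction). It is known that the spectrum consists of eigenvalues only, and that when $A$ is positive all eigenvalues are real, simple and nonzero. For an eigenvalue $\lambda$ of $T_{p,q}$ let $y_\lambda$ be the eigenfunction normalized by $y_\lambda(0)=0$, $y_\lambda^{[1]}(0)=\lambda$. The norming constant corresponding to $\lambda$ is $\alpha:=2\int_0^1y_\lambda^2(t)\,dt-\frac{2}{\lambda}\int_0^1p(t)y_\lambda^2(t)\,dt$. The spectral data $\mathbf{sd}(T_{p,q})$ is the set of all pairs $(\lambda,\alpha)$ with $\lambda\in\sigma(T_{p,q})$ and $\alpha$ the corresponding norming constant. *)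

theory Defs
  imports "HOL-Analysis.Analysis"
begin

text \<open>
  Elements of $L_2(0,1)$ are represented by functions on the real line, of which only the
  restriction to the unit interval matters; equality in $L_2(0,1)$ is equality almost
  everywhere with respect to \<open>M01\<close>.
\<close>

abbreviation M01 :: "real measure" where
  "M01 \<equiv> lebesgue_on {0<..<1}"

definition L2 :: "(real \<Rightarrow> 'a::{real_normed_vector, second_countable_topology}) set" where
  "L2 = {f. f \<in> borel_measurable M01 \<and> integrable M01 (\<lambda>x. (norm (f x))\<^sup>2)}"

definition L2_norm :: "(real \<Rightarrow> complex) \<Rightarrow> real" where
  "L2_norm f = sqrt (LINT x|M01. (norm (f x))\<^sup>2)"

definition L2_inner :: "(real \<Rightarrow> complex) \<Rightarrow> (real \<Rightarrow> complex) \<Rightarrow> complex" where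
  "L2_inner f g = (LINT x|M01. f x * cnj (g x))"

definition absolutely_continuous_on :: "real set \<Rightarrow> (real \<Rightarrow> 'a::real_normed_vector) \<Rightarrow> bool" where
  "absolutely_continuous_on S f \<longleftrightarrow>
     (\<forall>\<epsilon>>0. \<exists>\<delta>>0. \<forall>d. d division_of \<Union>d \<and> \<Union>d \<subseteq> S \<and> (\<Sum>k\<in>d. measure lborel k) < \<delta> \<longrightarrow>
        (\<Sum>k\<in>d. norm (f (Sup k) - f (Inf k))) < \<epsilon>)"

definition test_functions :: "(real \<Rightarrow> real) set" where
  "test_functions =
     {\<phi>. (\<forall>n x. (deriv ^^ n) \<phi> field_differentiable at x) \<and>
          (\<exists>K. compact K \<and> K \<subseteq> {0<..<1} \<and> (\<forall>x. x \<notin> K \<longrightarrow> \<phi> x = 0))}"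

text \<open>
  A real distribution on $(0,1)$ is a functional \<open>q\<close> on \<open>test_functions\<close> (its values at other
  functions are irrelevant). The predicate \<open>primitive_of r q\<close> says that $q = r'$ in the sense
  of distributions with real $r \in L_2(0,1)$, so that $q \in W_2^{-1}(0,1)$; linearity and
  continuity of \<open>q\<close> on \<open>test_functions\<close> follow.
\<close>

definition primitive_of :: "(real \<Rightarrow> real) \<Rightarrow> ((real \<Rightarrow> real) \<Rightarrow> real) \<Rightarrow> bool" where
  "primitive_of r q \<longleftrightarrow>
     r \<in> L2 \<and> (\<forall>\<phi>\<in>test_functions. q \<phi> = - (LINT x|M01. r x * deriv \<phi> x))"

text \<open>
  The quasi-derivative $y^{[1]} = y' - ry$ is defined only almost everywhere;
  \<open>is_quasi_deriv r y u\<close> says that \<open>u\<close> is its absolutely continuous representative on $[0,1]$.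
  Such a \<open>u\<close> is unique on $[0,1]$, so there the choice in \<open>quasi_deriv\<close> is immaterial,
  including at the endpoint 0.
\<close>

definition is_quasi_deriv :: "(real \<Rightarrow> real) \<Rightarrow> (real \<Rightarrow> complex) \<Rightarrow> (real \<Rightarrow> complex) \<Rightarrow> bool" where
  "is_quasi_deriv r y u \<longleftrightarrow> absolutely_continuous_on {0..1} u \<and>
     (AE x in M01. u x = vector_derivative y (at x) - of_real (r x) * y x)"

definition quasi_deriv :: "(real \<Rightarrow> real) \<Rightarrow> (real \<Rightarrow> complex) \<Rightarrow> real \<Rightarrow> complex" where
  "quasi_deriv r y = (SOME u. is_quasi_deriv r y u)"

definition ell :: "(real \<Rightarrow> real) \<Rightarrow> (real \<Rightarrow> complex) \<Rightarrow> real \<Rightarrow> complex" where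
  "ell r y x = - vector_derivative (quasi_deriv r y) (at x)
     - of_real (r x) * quasi_deriv r y x - (of_real (r x))\<^sup>2 * y x"

definition dom_ell :: "(real \<Rightarrow> real) \<Rightarrow> (real \<Rightarrow> complex) set" where
  "dom_ell r = {y. absolutely_continuous_on {0..1} y \<and> (\<exists>u. is_quasi_deriv r y u) \<and> ell r y \<in> L2}"

definition dom_A :: "(real \<Rightarrow> real) \<Rightarrow> (real \<Rightarrow> complex) set" where
  "dom_A r = {y \<in> dom_ell r. y 0 = 0 \<and> y 1 = 0}"

text \<open>The order on \<open>complex\<close> below is such that \<open>0 < z\<close> means that \<open>z\<close> is real and positive.\<close>

definition A_positive :: "(real \<Rightarrow> real) \<Rightarrow> bool" where
  "A_positive r \<longleftrightarrow>
     (\<forall>y\<in>dom_A r. \<not> (AE x in M01. y x = 0) \<longrightarrow> 0 < L2_inner (ell r y) y)"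

definition pencil ::
  "(real \<Rightarrow> real) \<Rightarrow> (real \<Rightarrow> real) \<Rightarrow> complex \<Rightarrow> (real \<Rightarrow> complex) \<Rightarrow> real \<Rightarrow> complex" where
  "pencil p r z y x = z\<^sup>2 * y x - 2 * z * (of_real (p x) * y x) - ell r y x"

definition boundedly_invertible ::
  "(real \<Rightarrow> complex) set \<Rightarrow> ((real \<Rightarrow> complex) \<Rightarrow> real \<Rightarrow> complex) \<Rightarrow> bool" where
  "boundedly_invertible D S \<longleftrightarrow>
     (\<forall>y\<in>D. (AE x in M01. S y x = 0) \<longrightarrow> (AE x in M01. y x = 0)) \<and>
     (\<forall>f\<in>L2. \<exists>y\<in>D. AE x in M01. S y x = f x) \<and>
     (\<exists>C. \<forall>y\<in>D. L2_norm y \<le> C * L2_norm (S y))"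

definition op_spectrum ::
  "(real \<Rightarrow> complex) set \<Rightarrow> ((real \<Rightarrow> complex) \<Rightarrow> real \<Rightarrow> complex) \<Rightarrow> complex set" where
  "op_spectrum D S = {\<mu>. \<not> boundedly_invertible D (\<lambda>y x. S y x - \<mu> * y x)}"

definition pencil_spectrum :: "(real \<Rightarrow> real) \<Rightarrow> (real \<Rightarrow> real) \<Rightarrow> complex set" where
  "pencil_spectrum p r = {z. 0 \<in> op_spectrum (dom_A r) (pencil p r z)}"

definition eigenfunction ::
  "(real \<Rightarrow> real) \<Rightarrow> (real \<Rightarrow> real) \<Rightarrow> complex \<Rightarrow> (real \<Rightarrow> complex) \<Rightarrow> bool" where
  "eigenfunction p r z y \<longleftrightarrow>
     y \<in> dom_A r \<and> \<not> (AE x in M01. y x = 0) \<and> (AE x in M01. pencil p r z y x = 0)"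

definition norming_constant :: "(real \<Rightarrow> real) \<Rightarrow> complex \<Rightarrow> (real \<Rightarrow> complex) \<Rightarrow> complex" where
  "norming_constant p z y =
     2 * (LINT x|M01. (y x)\<^sup>2) - (2 / z) * (LINT x|M01. of_real (p x) * (y x)\<^sup>2)"

text \<open>
  For each nonzero eigenvalue the normalized eigenfunction exists and is unique on $[0,1]$, so it
  contributes exactly one pair; zero is not an eigenvalue when \<open>A\<close> is positive.
\<close>

definition spectral_data :: "(real \<Rightarrow> real) \<Rightarrow> (real \<Rightarrow> real) \<Rightarrow> (complex \<times> complex) set" where
  "spectral_data p r = {(z, \<alpha>). z \<in> pencil_spectrum p r \<and>
     (\<exists>y. eigenfunction p r z y \<and> quasi_deriv r y 0 = z \<and> \<alpha> = norming_constant p z y)}"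

end

theory Submission
  imports Defs "HOL-Complex_Analysis.Complex_Analysis"
begin

text \<open>
  Positivity of $A$ yields a positive solution of $\ell\varphi = 0$, hence a factorization
  $\ell = -(\partial + v)(\partial - v)$ with $v = \varphi'/\varphi$, and for $\lambda \ne 0$ the pencil equation turns
  into the Dirac-type system $u_1' = -v u_1 + (2p - \lambda)u_2$, $u_2' = \lambda u_1 + v u_2$ with $u_2 = y$. Its
  Dirichlet spectrum has the extra point $0$, where the norming constant can be prescribed by the
  choice of $\varphi$, and all norming constants are $\int (u_1^2 + u_2^2)$.

  The Weyl function has simple poles at the eigenvalues with residues the inverse norming constants.
  Hence for equal spectral data the matrix $\Phi\hat\Phi^{-1}$, where $\Phi$ consists of $u$ and the Weyl
  solution, is entire in $\lambda$. Gronwall's inequality and the energy identity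
  $\mathrm{Im}(\bar u_1 u_2) = \mathrm{Im}\lambda \int |u|^2$ bound it by $C(1 + 1/|\mathrm{Im}\lambda|)$, without any
  asymptotic analysis, so it is independent of $\lambda$. Comparing with $\lambda = 0$ and with the differential
  equation shows that the solutions, and then the potentials, coincide.
\<close>

text \<open>The obstacle is the extra eigenvalue 0: the pencil data say nothing about it, so they
  fix the Dirac data only up to one number. The factorization has exactly one free parameter, the
  quasi-derivative of \<phi> at 0 when \<phi>(0) = 1, and its large values realize all sufficiently
  small norming constants; hence both operators can be given the same one. The choice leaves no
  trace at the end, because v' + v^2 = q for every admissible \<phi>, so that v alone determines q.
  What makes a bound without asymptotics possible is that Re \<lambda> does not enter the growth
  rate of |u|^2. The solution u grows at most like exp(|Im \<lambda>| x) and the Weyl solution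
  decays like exp(-|Im \<lambda>| x), with constants that depend only on the integral of |v| + |p|.
  Only the lower bound for the characteristic function degenerates at the real axis, and this
  produces the term 1/|Im \<lambda>|. Absolute continuity enters by its \<epsilon>-\<delta>
  definition and derivatives as pointwise limits, so the fundamental theorem of calculus for such
  functions is established at the outset.\<close>

section \<open>Lebesgue differentiation\<close>

text \<open>A pair $(x, y)$ stands for the segment between $x$ and $y$, tagged at $x$.\<close>

lemma negligible_of_Vitali_cover:
  fixes E :: "real set"
  assumes cover: "\<And>\<eta>. 0 < \<eta> \<Longrightarrow> \<exists>V. (\<forall>x\<in>E. \<forall>d>0. \<exists>y. (x, y) \<in> V \<and> y \<noteq> x \<and> \<bar>y - x\<bar> < d) \<and>
      (\<forall>C. finite C \<and> C \<subseteq> V \<and> (\<forall>(x, y)\<in>C. x \<in> E \<and> y \<noteq> x) \<and>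
        pairwise (\<lambda>i j. disjnt (closed_segment (fst i) (snd i)) (closed_segment (fst j) (snd j))) C
        \<longrightarrow> (\<Sum>(x, y)\<in>C. \<bar>y - x\<bar>) \<le> \<eta>)"
  shows "negligible E"
  unfolding negligible_outer_le
proof (intro allI impI)
  fix \<eta> :: real assume "0 < \<eta>"
  from cover[OF this] obtain V where V0: "\<forall>x\<in>E. \<forall>d>0. \<exists>y. (x, y) \<in> V \<and> y \<noteq> x \<and> \<bar>y - x\<bar> < d"
    and le: "\<forall>C. finite C \<and> C \<subseteq> V \<and> (\<forall>(x, y)\<in>C. x \<in> E \<and> y \<noteq> x) \<and>
        pairwise (\<lambda>i j. disjnt (closed_segment (fst i) (snd i)) (closed_segment (fst j) (snd j))) C
        \<longrightarrow> (\<Sum>(x, y)\<in>C. \<bar>y - x\<bar>) \<le> \<eta>"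
    by (elim exE conjE)
  have V: "\<exists>y. (x, y) \<in> V \<and> y \<noteq> x \<and> \<bar>y - x\<bar> < d" if "x \<in> E" "0 < d" for x d
    using V0 that by blast
  define K where "K = {(x, y) \<in> V. x \<in> E \<and> y \<noteq> x}"
  define a where "a = (\<lambda>i::real \<times> real. (fst i + snd i) / 2)"
  define \<rho> where "\<rho> = (\<lambda>i::real \<times> real. \<bar>snd i - fst i\<bar> / 2)"
  \<comment> \<open>The covering theorem is about closed balls, so each segment is viewed as the
    ball about its midpoint whose radius is half its length.\<close>
  have seg: "cball (a i) (\<rho> i) = closed_segment (fst i) (snd i)" for i
  proof (cases "fst i \<le> snd i")
    case True
    then have "a i - \<rho> i = fst i" "a i + \<rho> i = snd i" by (auto simp: a_def \<rho>_def field_simps)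
    then show ?thesis using True by (simp add: cball_eq_atLeastAtMost closed_segment_eq_real_ivl)
  next
    case False
    then have "a i - \<rho> i = snd i" "a i + \<rho> i = fst i" by (auto simp: a_def \<rho>_def field_simps)
    then show ?thesis using False by (simp add: cball_eq_atLeastAtMost closed_segment_eq_real_ivl)
  qed
  obtain C where C: "countable C" "C \<subseteq> K"
    "pairwise (\<lambda>i j. disjnt (cball (a i) (\<rho> i)) (cball (a j) (\<rho> j))) C"
    "negligible (E - (\<Union>i\<in>C. cball (a i) (\<rho> i)))"
  proof (rule Vitali_covering_theorem_cballs[of K \<rho> E a])
    show "0 < \<rho> i" if "i \<in> K" for i using that by (auto simp: K_def \<rho>_def)
    show "\<exists>i. i \<in> K \<and> x \<in> cball (a i) (\<rho> i) \<and> \<rho> i < d" if x: "x \<in> E" and d: "0 < d" for x d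
    proof -
      obtain y where y: "(x, y) \<in> V" "y \<noteq> x" "\<bar>y - x\<bar> < d" using V[OF x d] by blast
      have "x \<in> cball (a (x, y)) (\<rho> (x, y))" unfolding seg by simp
      moreover have "\<rho> (x, y) < d" using y by (simp add: \<rho>_def)
      ultimately show ?thesis using x y by (intro exI[of _ "(x, y)"]) (simp add: K_def)
    qed
  qed
  have fin: "measure lebesgue (\<Union>i\<in>I'. cball (a i) (\<rho> i)) \<le> \<eta>" if I': "I' \<subseteq> C" "finite I'" for I'
  proof -
    have "measure lebesgue (\<Union>i\<in>I'. cball (a i) (\<rho> i)) \<le> (\<Sum>i\<in>I'. measure lebesgue (cball (a i) (\<rho> i)))"
      by (rule measure_UNION_le) (use I' in auto)
    also have "\<dots> = (\<Sum>(x, y)\<in>I'. \<bar>y - x\<bar>)"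
      by (rule sum.cong) (auto simp: seg closed_segment_eq_real_ivl)
    also have "\<dots> \<le> \<eta>"
      by (rule le[THEN spec, THEN mp]) (use I' C in \<open>auto simp: K_def seg intro: pairwise_subset\<close>)
    finally show ?thesis .
  qed
  \<comment> \<open>The hypothesis controls finite subfamilies only; a bound that is uniform over
    them passes to the countable union.\<close>
  have U: "(\<Union>i\<in>C. cball (a i) (\<rho> i)) \<in> lmeasurable" "measure lebesgue (\<Union>i\<in>C. cball (a i) (\<rho> i)) \<le> \<eta>"
    by (rule fmeasurable_UN_bound measure_UN_bound, use C fin in auto)+
  show "\<exists>T. E \<subseteq> T \<and> T \<in> lmeasurable \<and> measure lebesgue T \<le> \<eta>"
  proof (intro exI conjI)
    let ?U = "\<Union>i\<in>C. cball (a i) (\<rho> i)"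
    show "E \<subseteq> ?U \<union> (E - ?U)" by blast
    have N: "E - ?U \<in> lmeasurable" "measure lebesgue (E - ?U) = 0"
      using C(4) negligible_imp_measurable negligible_imp_measure0 by auto
    show "?U \<union> (E - ?U) \<in> lmeasurable" using U N by blast
    show "measure lebesgue (?U \<union> (E - ?U)) \<le> \<eta>"
      using measure_Un_le[of ?U lebesgue "E - ?U"] U N by (auto simp: fmeasurableD)
  qed
qed

text \<open>Henstock's lemma does the work. The segments from points of \<open>E e\<close> to nearby
  points where the difference quotient is off by more than \<open>e\<close> form a Vitali cover; a
  disjoint fine family of them, tagged at those points, has total error below
  \<open>e * \<eta>\<close>, hence total length below \<eta>.\<close>

lemma negligible_not_differentiable_integral:
  fixes g :: "real \<Rightarrow> 'a::euclidean_space"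
  assumes g: "g integrable_on {a..b}"
  shows "negligible {x \<in> {a<..<b}. \<not> ((\<lambda>x. integral {a..x} g) has_vector_derivative g x) (at x)}"
proof -
  define F where "F = (\<lambda>x. integral {a..x} g)"
  define R where "R = (\<lambda>x y. norm (F y - F x - (y - x) *\<^sub>R g x))"
  define E where "E = (\<lambda>e. {x \<in> {a<..<b}. \<forall>d>0. \<exists>y. y \<noteq> x \<and> \<bar>y - x\<bar> < d \<and> e * \<bar>y - x\<bar> < R x y})"
  \<comment> \<open>Henstock's lemma measures errors on intervals, whereas \<open>y\<close> may lie
    on either side of \<open>x\<close>; the closed segment covers both orientations.\<close>
  have R_seg: "R x y = norm (measure lborel (closed_segment x y) *\<^sub>R g x - integral (closed_segment x y) g)"
    if "x \<in> {a..b}" "y \<in> {a..b}" for x y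
  proof (cases "x \<le> y")
    case True
    have "integral {a..x} g + integral {x..y} g = integral {a..y} g"
      by (rule Henstock_Kurzweil_Integration.integral_combine)
        (use that True g in \<open>auto intro: integrable_on_subinterval\<close>)
    then have "F y - F x = integral {x..y} g"
      by (simp add: F_def algebra_simps)
    then have "R x y = norm (integral {x..y} g - (y - x) *\<^sub>R g x)"
      by (simp add: R_def)
    then show ?thesis using True
      by (simp add: closed_segment_eq_real_ivl norm_minus_commute)
  next
    case False
    have "integral {a..y} g + integral {y..x} g = integral {a..x} g"
      by (rule Henstock_Kurzweil_Integration.integral_combine)
        (use that False g in \<open>auto intro: integrable_on_subinterval\<close>)
    then have "F y - F x - (y - x) *\<^sub>R g x = (x - y) *\<^sub>R g x - integral {y..x} g"
      by (simp add: F_def algebra_simps)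
    then show ?thesis using False
      by (simp add: closed_segment_eq_real_ivl R_def)
  qed
  have neg: "negligible (E e)" if e: "0 < e" for e
  proof (rule negligible_of_Vitali_cover)
    fix \<eta> :: real assume \<eta>: "0 < \<eta>"
    obtain \<gamma> where \<gamma>: "gauge \<gamma>" "\<And>p. p tagged_partial_division_of cbox a b \<Longrightarrow> \<gamma> fine p \<Longrightarrow>
             (\<Sum>(x,k)\<in>p. norm (measure lborel k *\<^sub>R g x - integral k g)) < e * \<eta>"
      using Henstock_lemma[of g a b "e * \<eta>"] g e \<eta> by auto
    define V where "V = {(x, y). y \<noteq> x \<and> y \<in> {a<..<b} \<and> closed_segment x y \<subseteq> \<gamma> x \<and> e * \<bar>y - x\<bar> < R x y}"
    have "\<exists>y. (x, y) \<in> V \<and> y \<noteq> x \<and> \<bar>y - x\<bar> < d" if x: "x \<in> E e" and d: "0 < d" for x d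
    proof -
      obtain d1 where d1: "d1 > 0" "ball x d1 \<subseteq> \<gamma> x"
        using gaugeD[OF \<gamma>(1)] by (meson openE)
      have ab: "a < x" "x < b" using x by (auto simp: E_def)
      let ?d = "min (min d d1) (min (x - a) (b - x))"
      obtain y where y: "y \<noteq> x" "\<bar>y - x\<bar> < ?d" "e * \<bar>y - x\<bar> < R x y"
        using x ab d d1 unfolding E_def by (force dest: spec[of _ ?d])
      have "closed_segment x y \<subseteq> ball x d1"
        using y(2) d1 by (intro closed_segment_subset) (auto simp: dist_real_def)
      then show ?thesis using y d1 by (intro exI[of _ y]) (auto simp: V_def)
    qed
    moreover have "(\<Sum>(x, y)\<in>C. \<bar>y - x\<bar>) \<le> \<eta>"
      if C: "finite C" "C \<subseteq> V" "\<forall>(x, y)\<in>C. x \<in> E e \<and> y \<noteq> x"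
        "pairwise (\<lambda>i j. disjnt (closed_segment (fst i) (snd i)) (closed_segment (fst j) (snd j))) C" for C
    proof -
      have ab: "a < x \<and> x < b" "a < y \<and> y < b" "x \<noteq> y" if "(x, y) \<in> C" for x y
        using that C by (auto simp: E_def V_def)
      define p where "p = (\<lambda>(x, y). (x, closed_segment x y)) ` C"
      have inj: "inj_on (\<lambda>(x, y). (x, closed_segment x y)) C"
        by (auto simp: inj_on_def closed_segment_eq_real_ivl split: if_splits)
      have "p tagged_partial_division_of cbox a b"
        unfolding tagged_partial_division_of_def
      proof (intro conjI allI impI)
        show "finite p" using C by (simp add: p_def)
        show "x \<in> K" "K \<subseteq> cbox a b" "\<exists>a b. K = cbox a b" if xK: "(x, K) \<in> p" for x K
        proof -
          obtain y where y: "(x, y) \<in> C" "K = closed_segment x y"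
            using xK unfolding p_def by auto
          show "x \<in> K" "K \<subseteq> cbox a b" using y ab[OF y(1)] by (auto simp: closed_segment_eq_real_ivl)
          show "\<exists>a b. K = cbox a b" using y(2) by (auto simp: closed_segment_eq_real_ivl split: if_splits)
        qed
        show "interior K1 \<inter> interior K2 = {}"
          if K: "(x1, K1) \<in> p \<and> (x2, K2) \<in> p \<and> (x1, K1) \<noteq> (x2, K2)" for x1 K1 x2 K2
        proof -
          obtain y1 y2 where y: "(x1, y1) \<in> C" "K1 = closed_segment x1 y1" "(x2, y2) \<in> C" "K2 = closed_segment x2 y2"
            using K unfolding p_def by auto
          then have "disjnt K1 K2" using K C(4) unfolding pairwise_def by fastforce
          then show ?thesis using interior_subset by (fastforce simp: disjnt_def)
        qed
      qed
      moreover have "\<gamma> fine p" using C by (auto simp: fine_def p_def V_def)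
      ultimately have "(\<Sum>(x,k)\<in>p. norm (measure lborel k *\<^sub>R g x - integral k g)) < e * \<eta>" by (rule \<gamma>(2))
      also have "(\<Sum>(x,k)\<in>p. norm (measure lborel k *\<^sub>R g x - integral k g)) =
          (\<Sum>(x,y)\<in>C. norm (measure lborel (closed_segment x y) *\<^sub>R g x - integral (closed_segment x y) g))"
        unfolding p_def by (subst sum.reindex[OF inj]) (simp add: o_def case_prod_unfold)
      also have "\<dots> = (\<Sum>(x,y)\<in>C. R x y)"
        using ab by (intro sum.cong) (auto simp: less_imp_le R_seg)
      finally have "(\<Sum>(x,y)\<in>C. R x y) < e * \<eta>" .
      moreover have "(\<Sum>(x,y)\<in>C. e * \<bar>y - x\<bar>) \<le> (\<Sum>(x,y)\<in>C. R x y)"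
        using C(2) by (intro sum_mono) (force simp: V_def)
      ultimately have "e * (\<Sum>(x,y)\<in>C. \<bar>y - x\<bar>) < e * \<eta>"
        by (simp add: sum_distrib_left case_prod_unfold)
      then show ?thesis using e by simp
    qed
    ultimately show "\<exists>V. (\<forall>x\<in>E e. \<forall>d>0. \<exists>y. (x, y) \<in> V \<and> y \<noteq> x \<and> \<bar>y - x\<bar> < d) \<and>
      (\<forall>C. finite C \<and> C \<subseteq> V \<and> (\<forall>(x, y)\<in>C. x \<in> E e \<and> y \<noteq> x) \<and>
        pairwise (\<lambda>i j. disjnt (closed_segment (fst i) (snd i)) (closed_segment (fst j) (snd j))) C
        \<longrightarrow> (\<Sum>(x, y)\<in>C. \<bar>y - x\<bar>) \<le> \<eta>)"
      by (intro exI[of _ V]) blast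
  qed
  \<comment> \<open>Failure of differentiability is failure for some tolerance, and the tolerances
    \<open>1 / Suc n\<close> suffice.\<close>
  have "negligible (\<Union>n. E (1 / real (Suc n)))"
    by (rule negligible_Union_nat) (simp add: neg)
  moreover have "(F has_vector_derivative g x) (at x)" if x: "x \<in> {a<..<b}" "x \<notin> (\<Union>n. E (1 / real (Suc n)))" for x
    unfolding has_vector_derivative_def has_derivative_at_alt
  proof (intro conjI allI impI bounded_linear_scaleR_left)
    fix e :: real assume "0 < e"
    then obtain n where n: "1 / real (Suc n) < e" using nat_approx_posE by blast
    have "x \<notin> E (1 / real (Suc n))" using x by blast
    then obtain d where d: "d > 0" "\<And>y. y \<noteq> x \<Longrightarrow> \<bar>y - x\<bar> < d \<Longrightarrow> R x y \<le> 1 / real (Suc n) * \<bar>y - x\<bar>"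
      using x(1) unfolding E_def by (fastforce simp: not_less)
    show "\<exists>d>0. \<forall>y. norm (y - x) < d \<longrightarrow> norm (F y - F x - (y - x) *\<^sub>R g x) \<le> e * norm (y - x)"
    proof (intro exI[of _ d] conjI allI impI d(1))
      fix y assume y: "norm (y - x) < d"
      show "norm (F y - F x - (y - x) *\<^sub>R g x) \<le> e * norm (y - x)"
      proof (cases "y = x")
        case False
        then have "R x y \<le> 1 / real (Suc n) * \<bar>y - x\<bar>" using d(2) y by simp
        also have "\<dots> \<le> e * \<bar>y - x\<bar>" using n by (intro mult_right_mono) auto
        finally show ?thesis by (simp add: R_def)
      qed simp
    qed
  qed
  ultimately show ?thesis
    unfolding F_def by (elim negligible_subset) blast
qed

section \<open>Absolutely continuous functions\<close>

lemma absolutely_continuous_onD: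
  assumes "absolutely_continuous_on S f" "0 < e"
  obtains \<delta> where "\<delta> > 0" "\<And>d. d division_of \<Union>d \<Longrightarrow> \<Union>d \<subseteq> S \<Longrightarrow> (\<Sum>k\<in>d. measure lborel k) < \<delta> \<Longrightarrow>
    (\<Sum>k\<in>d. norm (f (Sup k) - f (Inf k))) < e"
  using assms unfolding absolutely_continuous_on_def by meson

lemma division_of_realE:
  fixes d :: "real set set"
  assumes "d division_of \<Union>d" "k \<in> d"
  obtains s t where "k = {s..t}" "s \<le> t"
proof -
  obtain s t where st: "k = cbox s t" using division_ofD(4)[OF assms] by blast
  moreover have "s \<le> t" using division_ofD(3)[OF assms] st by (metis box_real(2) atLeastatMost_empty_iff)
  ultimately show ?thesis using that by simp
qed

text \<open>Truncation at height \<open>n\<close> splits \<open>norm (g x)\<close> into a part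
  bounded by \<open>n\<close> and a remainder \<open>r\<close> of integral below
  \<open>e / 2\<close>; the first part contributes at most \<open>n\<close> times the total length.
  The summand 1 in the choice of \<delta> covers \<open>n = 0\<close>.\<close>

lemma absolutely_continuous_on_integral:
  fixes g :: "real \<Rightarrow> 'a::euclidean_space"
  assumes g: "g absolutely_integrable_on {a..b}"
  shows "absolutely_continuous_on {a..b} (\<lambda>x. integral {a..x} g)"
  unfolding absolutely_continuous_on_def
proof (intro allI impI)
  fix e :: real assume e: "0 < e"
  define h where "h = (\<lambda>x. norm (g x))"
  define hn where "hn = (\<lambda>(n::nat) x. min (h x) (real n))"
  have h: "h absolutely_integrable_on {a..b}" unfolding h_def by (rule absolutely_integrable_norm[OF g, unfolded o_def])
  have gi: "g integrable_on {a..b}" using g by (simp add: absolutely_integrable_on_def)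
  have hn: "hn n integrable_on {a..b}" for n
    using absolutely_integrable_min[OF h, of "\<lambda>x. real n"] absolutely_integrable_on_const[of "{a..b}" "real n"]
    unfolding hn_def by (auto simp: absolutely_integrable_on_def)
  have hi: "h integrable_on {a..b}" using h by (simp add: absolutely_integrable_on_def)
  have "(\<lambda>n. integral {a..b} (hn n)) \<longlonglongrightarrow> integral {a..b} h"
  proof (rule dominated_convergence(2))
    show "norm (hn n x) \<le> h x" for n x by (auto simp: hn_def h_def)
    show "(\<lambda>n. hn n x) \<longlonglongrightarrow> h x" for x
    proof (rule tendsto_eventually)
      obtain N where "h x \<le> real N" using real_arch_simple by blast
      then show "\<forall>\<^sub>F n in sequentially. hn n x = h x"
        unfolding eventually_sequentially hn_def by (intro exI[of _ N]) (auto simp: min_def)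
    qed
  qed (use hn hi in auto)
  then have "\<forall>\<^sub>F n in sequentially. integral {a..b} h - e/2 < integral {a..b} (hn n)"
    by (rule order_tendstoD) (use e in auto)
  then obtain n where n: "integral {a..b} h - e/2 < integral {a..b} (hn n)"
    by (auto simp: eventually_sequentially)
  define r where "r = (\<lambda>x. h x - hn n x)"
  have r: "r integrable_on {a..b}" "integral {a..b} r < e/2" "\<And>x. 0 \<le> r x"
    using n hi hn by (auto simp: r_def integrable_diff Henstock_Kurzweil_Integration.integral_diff hn_def)
  show "\<exists>\<delta>>0. \<forall>d. d division_of \<Union>d \<and> \<Union>d \<subseteq> {a..b} \<and> (\<Sum>k\<in>d. measure lborel k) < \<delta> \<longrightarrow>
        (\<Sum>k\<in>d. norm (integral {a..Sup k} g - integral {a..Inf k} g)) < e"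
  proof (intro exI[of _ "e / (2 * (real n + 1))"] conjI allI impI)
    show "0 < e / (2 * (real n + 1))" using e by simp
    fix d assume d: "d division_of \<Union>d \<and> \<Union>d \<subseteq> {a..b} \<and> (\<Sum>k\<in>d. measure lborel k) < e / (2 * (real n + 1))"
    have bd: "norm (integral {a..Sup k} g - integral {a..Inf k} g) \<le> integral k r + real n * measure lborel k"
      if k: "k \<in> d" for k
    proof -
      obtain s t where st: "k = {s..t}" "s \<le> t" using division_of_realE d k by metis
      have "{s..t} \<subseteq> {a..b}" using d k st by blast
    then have sub: "a \<le> s" "t \<le> b" using st by auto
      have "integral {a..s} g + integral {s..t} g = integral {a..t} g"
        by (rule Henstock_Kurzweil_Integration.integral_combine)
          (use st sub gi in \<open>auto intro: integrable_on_subinterval\<close>)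
      then have "integral {a..t} g - integral {a..s} g = integral {s..t} g" by (simp add: algebra_simps)
      moreover have "norm (integral {s..t} g) \<le> integral {s..t} (\<lambda>x. r x + real n)"
      proof (rule integral_norm_bound_integral)
        show "g integrable_on {s..t}" using gi sub by (auto intro: integrable_on_subinterval)
        show "(\<lambda>x. r x + real n) integrable_on {s..t}"
          using r(1) sub by (intro integrable_add) (auto intro: integrable_on_subinterval)
        show "norm (g x) \<le> r x + real n" for x by (auto simp: r_def hn_def h_def)
      qed
      moreover have "integral {s..t} (\<lambda>x. r x + real n) = integral {s..t} r + real n * (t - s)"
        using r(1) sub st by (subst Henstock_Kurzweil_Integration.integral_add) (auto intro: integrable_on_subinterval)
      ultimately show ?thesis using st by simp
    qed
    have ru: "r integrable_on \<Union>d"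
      using integrable_on_subdivision[OF conjunct1[OF d] r(1)] d by blast
    have "(\<Sum>k\<in>d. norm (integral {a..Sup k} g - integral {a..Inf k} g)) \<le>
        (\<Sum>k\<in>d. integral k r) + real n * (\<Sum>k\<in>d. measure lborel k)"
      using sum_mono[OF bd, of d] by (simp add: sum.distrib sum_distrib_left)
    also have "(\<Sum>k\<in>d. integral k r) = integral (\<Union>d) r"
      using integral_combine_division_topdown[OF ru conjunct1[OF d]] by simp
    also have "\<dots> \<le> integral {a..b} r"
      using d ru r by (intro integral_subset_le) auto
    finally have "(\<Sum>k\<in>d. norm (integral {a..Sup k} g - integral {a..Inf k} g)) < e/2 + real n * (\<Sum>k\<in>d. measure lborel k)"
      using r by simp
    also have "real n * (\<Sum>k\<in>d. measure lborel k) \<le> (real n + 1) * (e / (2 * (real n + 1)))"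
      using d e by (intro mult_mono) (auto intro: sum_nonneg)
    also have "\<dots> = e/2" by (simp add: field_simps)
    finally show "(\<Sum>k\<in>d. norm (integral {a..Sup k} g - integral {a..Inf k} g)) < e" by simp
  qed
qed

lemma absolutely_continuous_on_imp_continuous_on:
  assumes "absolutely_continuous_on {a..b} f"
  shows "continuous_on {a..b} f"
proof -
  have "\<exists>\<delta>>0. \<forall>x'\<in>{a..b}. dist x' x < \<delta> \<longrightarrow> dist (f x') (f x) < e" if x: "x \<in> {a..b}" and e: "0 < e" for x e
  proof -
    obtain \<delta> where \<delta>: "\<delta> > 0" "\<And>d. d division_of \<Union>d \<Longrightarrow> \<Union>d \<subseteq> {a..b} \<Longrightarrow> (\<Sum>k\<in>d. measure lborel k) < \<delta> \<Longrightarrow>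
      (\<Sum>k\<in>d. norm (f (Sup k) - f (Inf k))) < e"
      using absolutely_continuous_onD[OF assms e] by blast
    have *: "norm (f t - f s) < e" if "s \<in> {a..b}" "t \<in> {a..b}" "s \<le> t" "t - s < \<delta>" for s t
      using \<delta>(2)[of "{{s..t}}"] that division_of_self[of s t] by simp
    show ?thesis
    proof (intro exI[of _ \<delta>] conjI ballI impI \<delta>(1))
      fix x' assume "x' \<in> {a..b}" "dist x' x < \<delta>"
      then show "dist (f x') (f x) < e"
        using *[of x x'] *[of x' x] x by (cases "x \<le> x'") (auto simp: dist_norm norm_minus_commute)
    qed
  qed
  then show ?thesis unfolding continuous_on_iff by blast
qed

section \<open>Variation sums and the variation function\<close>

lemma exists_division_Int:
  fixes \<phi> :: "real set \<Rightarrow> real"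
  assumes d: "d division_of \<Union>d"
  defines "\<psi> \<equiv> \<lambda>K. if interior K = {} then 0 else \<phi> K"
  obtains d' where "d' division_of \<Union>d'" "\<Union>d' \<subseteq> \<Union>d \<inter> {c..e}" "\<And>K. K \<in> d' \<Longrightarrow> interior K \<noteq> {}"
    "(\<Sum>K\<in>d'. \<phi> K) = (\<Sum>k\<in>d. \<psi> (k \<inter> {c..e}))"
proof
  \<comment> \<open>Different members can have the same intersection with \<open>{c..e}\<close>, but
    only one with empty interior. Such degenerate pieces are dropped, and \<psi> gives them weight
    0, so the sum can be reindexed although the map is not injective.\<close>
  define d' where "d' = {K \<in> (\<lambda>k. k \<inter> {c..e}) ` d. interior K \<noteq> {}}"
  have fin: "finite d" using d by auto
  show "d' division_of \<Union>d'"
  proof (rule division_ofI)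
    show "finite d'" using fin by (simp add: d'_def)
    show "K \<noteq> {}" "\<exists>a b. K = cbox a b" if K: "K \<in> d'" for K
    proof -
      obtain k where k: "k \<in> d" "K = k \<inter> {c..e}" using K by (auto simp: d'_def)
      obtain s t where "k = {s..t}" using division_of_realE[OF d k(1)] by metis
      then have "K = cbox (max s c) (min t e)" using k by auto
      then show "\<exists>a b. K = cbox a b" by blast
      show "K \<noteq> {}" using K by (auto simp: d'_def)
    qed
    show "interior K1 \<inter> interior K2 = {}" if "K1 \<in> d'" "K2 \<in> d'" "K1 \<noteq> K2" for K1 K2
      using that division_ofD(5)[OF d] by (fastforce simp: d'_def)
  qed auto
  show "\<Union>d' \<subseteq> \<Union>d \<inter> {c..e}" by (auto simp: d'_def)
  show "\<And>K. K \<in> d' \<Longrightarrow> interior K \<noteq> {}" by (auto simp: d'_def)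
  have "(\<Sum>K\<in>d'. \<phi> K) = (\<Sum>K\<in>d'. \<psi> K)" by (rule sum.cong) (auto simp: d'_def \<psi>_def)
  also have "\<dots> = (\<Sum>K\<in>(\<lambda>k. k \<inter> {c..e}) ` d. \<psi> K)"
    by (rule sum.mono_neutral_left) (use fin in \<open>auto simp: d'_def \<psi>_def\<close>)
  also have "\<dots> = (\<Sum>k\<in>d. \<psi> (k \<inter> {c..e}))"
  proof (rule sum.reindex_nontrivial[OF fin, unfolded o_def])
    fix k k' assume k: "k \<in> d" "k' \<in> d" "k \<noteq> k'" "k \<inter> {c..e} = k' \<inter> {c..e}"
    have "interior (k \<inter> {c..e}) \<subseteq> interior k \<inter> interior k'"
      using k(4) by (metis Int_lower1 inf.boundedI interior_mono)
    then show "\<psi> (k \<inter> {c..e}) = 0" using division_ofD(5)[OF d k(1-3)] by (auto simp: \<psi>_def)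
  qed
  finally show "(\<Sum>K\<in>d'. \<phi> K) = (\<Sum>k\<in>d. \<psi> (k \<inter> {c..e}))" .
qed

abbreviation vsum :: "(real \<Rightarrow> 'a::real_normed_vector) \<Rightarrow> real set set \<Rightarrow> real" where
  "vsum f d \<equiv> \<Sum>k\<in>d. norm (f (Sup k) - f (Inf k))"

text \<open>A member that reaches across \<open>x\<close> is cut there, and the triangle inequality
  applies. The nondegeneracy of \<open>d2\<close> is recorded because it later makes subdivisions of
  different intervals disjoint as families.\<close>

lemma vsum_split:
  assumes d: "d division_of \<Union>d" "\<Union>d \<subseteq> {a..y}" and x: "a \<le> x" "x \<le> y"
  obtains d1 d2 where "d1 division_of \<Union>d1" "\<Union>d1 \<subseteq> {a..x}" "d2 division_of \<Union>d2" "\<Union>d2 \<subseteq> {x..y}"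
    "\<And>K. K \<in> d2 \<Longrightarrow> interior K \<noteq> {}" "vsum f d \<le> vsum f d1 + vsum f d2"
proof -
  define \<psi> where "\<psi> = (\<lambda>K. if interior K = {} then 0 else norm (f (Sup K) - f (Inf K)))"
  obtain d1 where d1: "d1 division_of \<Union>d1" "\<Union>d1 \<subseteq> \<Union>d \<inter> {a..x}" "vsum f d1 = (\<Sum>k\<in>d. \<psi> (k \<inter> {a..x}))"
    unfolding \<psi>_def by (rule exists_division_Int[OF d(1), of a x "\<lambda>K. norm (f (Sup K) - f (Inf K))"], blast)
  obtain d2 where d2: "d2 division_of \<Union>d2" "\<Union>d2 \<subseteq> \<Union>d \<inter> {x..y}" "\<And>K. K \<in> d2 \<Longrightarrow> interior K \<noteq> {}"
      "vsum f d2 = (\<Sum>k\<in>d. \<psi> (k \<inter> {x..y}))"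
    unfolding \<psi>_def by (rule exists_division_Int[OF d(1), of x y "\<lambda>K. norm (f (Sup K) - f (Inf K))"], blast)
  have "norm (f (Sup k) - f (Inf k)) \<le> \<psi> (k \<inter> {a..x}) + \<psi> (k \<inter> {x..y})" if k: "k \<in> d" for k
  proof -
    obtain s t where st: "k = {s..t}" "s \<le> t" using division_of_realE[OF d(1) k] by metis
    have "{s..t} \<subseteq> {a..y}" using d(2) k st by blast
    then have sub: "a \<le> s" "t \<le> y" using st by auto
    have \<psi>: "\<psi> {u..v} = norm (f v - f u)" if "u \<le> v" for u v
      using that by (cases "u = v") (auto simp: \<psi>_def)
    have \<psi>0: "0 \<le> \<psi> K" for K by (simp add: \<psi>_def)
    consider "t \<le> x" | "x \<le> s" | "s \<le> x" "x \<le> t" by linarith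
    then show ?thesis
    proof cases
      case 1
      then have "k \<inter> {a..x} = {s..t}" using st sub by auto
      then show ?thesis using \<psi>[OF st(2)] \<psi>0[of "k \<inter> {x..y}"] st by simp
    next
      case 2
      then have "k \<inter> {x..y} = {s..t}" using st sub by auto
      then show ?thesis using \<psi>[OF st(2)] \<psi>0[of "k \<inter> {a..x}"] st by simp
    next
      case 3
      have "k \<inter> {a..x} = {s..x}" "k \<inter> {x..y} = {x..t}" using 3 st sub x by auto
      then have "\<psi> (k \<inter> {a..x}) = norm (f x - f s)" "\<psi> (k \<inter> {x..y}) = norm (f t - f x)"
        using \<psi>[OF 3(1)] \<psi>[OF 3(2)] by simp_all
      then show ?thesis using st norm_triangle_ineq[of "f x - f s" "f t - f x"] by simp
    qed
  qed
  then have "vsum f d \<le> (\<Sum>k\<in>d. \<psi> (k \<inter> {a..x}) + \<psi> (k \<inter> {x..y}))" by (rule sum_mono)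
  then show ?thesis using that[of d1 d2] d1 d2 by (simp add: sum.distrib)
qed

text \<open>On the way from \<open>a\<close> to \<open>b\<close> in steps of length \<delta>/2, with
  \<delta> belonging to \<epsilon> = 1, each step adds less than 1 to the variation sum. Half of
  \<delta> makes the condition on the lengths strict.\<close>

lemma absolutely_continuous_on_bounded_variation:
  assumes f: "absolutely_continuous_on {a..b} f"
  obtains B where "\<And>d. d division_of \<Union>d \<Longrightarrow> \<Union>d \<subseteq> {a..b} \<Longrightarrow> vsum f d \<le> B"
proof -
  obtain \<delta> where \<delta>: "\<delta> > 0" "\<And>d. d division_of \<Union>d \<Longrightarrow> \<Union>d \<subseteq> {a..b} \<Longrightarrow> (\<Sum>k\<in>d. measure lborel k) < \<delta> \<Longrightarrow> vsum f d < 1"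
    using absolutely_continuous_onD[OF f zero_less_one] by blast
  have *: "vsum f d \<le> real n" if "d division_of \<Union>d" "\<Union>d \<subseteq> {a..min b (a + real n * (\<delta>/2))}" for n d
    using that
  proof (induction n arbitrary: d)
    case 0
    have "vsum f d \<le> 0"
    proof (rule sum_nonpos)
      fix k assume k: "k \<in> d"
      obtain s t where st: "k = {s..t}" "s \<le> t" using division_of_realE[OF 0(1) k] by metis
      then have "s \<in> {a..min b (a + real 0 * (\<delta>/2))}" "t \<in> {a..min b (a + real 0 * (\<delta>/2))}"
        using 0(2) k by (fastforce simp del: of_nat_0)+
      then have "s = t" by auto
      then show "norm (f (Sup k) - f (Inf k)) \<le> 0" using st by simp
    qed
    then show ?case by simp
  next
    case (Suc n)
    let ?x = "min b (a + real n * (\<delta>/2))" and ?y = "min b (a + real (Suc n) * (\<delta>/2))"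
    show ?case
    proof (cases "a \<le> b")
      case True
      have "real n * (\<delta>/2) \<le> real (Suc n) * (\<delta>/2)" using \<delta>(1) by (intro mult_right_mono) auto
      then have "?x \<le> ?y" by (intro min.mono) auto
      have "a \<le> ?x" using True \<delta>(1) by simp
      obtain d1 d2 where d12: "d1 division_of \<Union>d1" "\<Union>d1 \<subseteq> {a..?x}" "d2 division_of \<Union>d2" "\<Union>d2 \<subseteq> {?x..?y}"
        "vsum f d \<le> vsum f d1 + vsum f d2"
        by (rule vsum_split[OF Suc.prems(1,2) \<open>a \<le> ?x\<close> \<open>?x \<le> ?y\<close>, of f], blast)
      have "(\<Sum>k\<in>d2. measure lborel k) \<le> measure lborel (cbox ?x ?y)"
        using subadditive_content_division[OF d12(3), of ?x ?y] d12(4) unfolding box_real by blast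
      also have "\<dots> < \<delta>" using \<delta>(1) \<open>?x \<le> ?y\<close> by (auto simp: field_simps min_def)
      finally have "(\<Sum>k\<in>d2. measure lborel k) < \<delta>" .
      moreover have "{?x..?y} \<subseteq> {a..b}" using \<open>a \<le> ?x\<close> by auto
      ultimately have "vsum f d2 < 1" using d12(3,4) by (intro \<delta>(2)) blast+
      then show ?thesis using Suc.IH[OF d12(1,2)] d12(5) by simp
    next
      case False
      then have "\<Union>d = {}" using Suc.prems(2) by auto
      then have "d = {}" using division_ofD(3)[OF Suc.prems(1)] by blast
      then show ?thesis by simp
    qed
  qed
  obtain n where n: "(b - a) / (\<delta>/2) \<le> real n" using real_arch_simple by blast
  then have "min b (a + real n * (\<delta>/2)) = b" using \<delta>(1) by (auto simp: field_simps min_def)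
  then show ?thesis using that[of "real n"] *[of _ n] by simp
qed

text \<open>The witness is the total variation on \<open>{a..x}\<close>. It inherits absolute
  continuity because its increments over the members of a division are approximated by variation
  sums of \<open>f\<close> over subdivisions, and the union of these has no larger total
  length.\<close>

lemma exists_variation_function:
  fixes f :: "real \<Rightarrow> real"
  assumes f: "absolutely_continuous_on {a..b} f"
  obtains V where "\<And>x y. a \<le> x \<Longrightarrow> x \<le> y \<Longrightarrow> y \<le> b \<Longrightarrow> \<bar>f y - f x\<bar> \<le> V y - V x"
    "absolutely_continuous_on {a..b} V"
proof -
  obtain B where B: "\<And>d. d division_of \<Union>d \<Longrightarrow> \<Union>d \<subseteq> {a..b} \<Longrightarrow> vsum f d \<le> B"
    using absolutely_continuous_on_bounded_variation[OF f] by blast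
  define D where "D = (\<lambda>x. {d. d division_of \<Union>d \<and> \<Union>d \<subseteq> {a..x}})"
  define V where "V = (\<lambda>x. SUP d\<in>D x. vsum f d)"
  have D0: "{} \<in> D x" for x by (simp add: D_def)
  have bdd: "bdd_above (vsum f ` D x)" if "x \<le> b" for x
  proof (rule bdd_aboveI2)
    fix d assume "d \<in> D x"
    then have "d division_of \<Union>d" "\<Union>d \<subseteq> {a..b}" using that unfolding D_def by auto
    then show "vsum f d \<le> B" by (rule B)
  qed
  have V1: "\<bar>f y - f x\<bar> \<le> V y - V x" if xy: "a \<le> x" "x \<le> y" "y \<le> b" for x y
  proof (cases "x = y")
    case False
    then have xy': "x < y" using xy by simp
    have "vsum f d \<le> V y - \<bar>f y - f x\<bar>" if d: "d \<in> D x" for d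
    proof -
      have dd: "d division_of \<Union>d" "\<Union>d \<subseteq> {a..x}" using d by (auto simp: D_def)
      have nin: "{x..y} \<notin> d"
      proof
        assume "{x..y} \<in> d"
        then have "y \<in> {a..x}" using dd(2) xy by fastforce
        then show False using xy' by simp
      qed
      have fin: "finite d" using dd by auto
      have "interior k \<inter> {x<..<y} = {}" if "k \<in> d" for k
      proof -
        have "k \<subseteq> {a..x}" using dd(2) that by auto
        then show ?thesis using interior_subset[of k] by force
      qed
      then have "insert {x..y} d division_of \<Union>(insert {x..y} d)"
      proof (intro division_ofI)
        fix K1 K2 assume int: "\<And>k. k \<in> d \<Longrightarrow> interior k \<inter> {x<..<y} = {}"
          and K: "K1 \<in> insert {x..y} d" "K2 \<in> insert {x..y} d" "K1 \<noteq> K2"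
        have eq: "interior {x..y} = {x<..<y}" by simp
        consider "K1 = {x..y}" "K2 \<in> d" | "K2 = {x..y}" "K1 \<in> d" | "K1 \<in> d" "K2 \<in> d" using K by blast
        then show "interior K1 \<inter> interior K2 = {}"
          by cases (use int eq K division_ofD(5)[OF dd(1)] in \<open>auto simp: Int_commute\<close>)
      next
        fix K assume K: "K \<in> insert {x..y} d"
        show "\<exists>a b. K = cbox a b"
          using K division_ofD(4)[OF dd(1)] by (metis box_real(2) insert_iff)
        show "K \<noteq> {}" using K division_ofD(3)[OF dd(1)] xy' by auto
      qed (use fin in auto)
      moreover have "\<Union>(insert {x..y} d) \<subseteq> {a..y}" using dd(2) xy by fastforce
      ultimately have "insert {x..y} d \<in> D y" unfolding D_def by blast
      then have "vsum f (insert {x..y} d) \<le> V y"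
        unfolding V_def by (intro cSUP_upper bdd xy(3))
      then show ?thesis using nin fin xy by (simp)
    qed
    then have "(SUP d\<in>D x. vsum f d) \<le> V y - \<bar>f y - f x\<bar>"
      using D0 by (intro cSUP_least) auto
    then have "V x \<le> V y - \<bar>f y - f x\<bar>" by (simp add: V_def)
    then show ?thesis by simp
  qed simp
  have V2: "\<exists>d2. d2 division_of \<Union>d2 \<and> \<Union>d2 \<subseteq> {x..y} \<and> (\<forall>K\<in>d2. interior K \<noteq> {}) \<and> V y - V x < vsum f d2 + e"
    if xy: "a \<le> x" "x \<le> y" "y \<le> b" and e: "0 < e" for x y e
  proof -
    obtain d where d: "d \<in> D y" "V y - e < vsum f d"
      using less_cSUP_iff[OF _ bdd[OF xy(3)], of "V y - e"] D0 e unfolding V_def by force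
    obtain d1 d2 where d12: "d1 division_of \<Union>d1" "\<Union>d1 \<subseteq> {a..x}" "d2 division_of \<Union>d2" "\<Union>d2 \<subseteq> {x..y}"
      "\<And>K. K \<in> d2 \<Longrightarrow> interior K \<noteq> {}" "vsum f d \<le> vsum f d1 + vsum f d2"
      using vsum_split[of d a y x f] d(1) xy by (auto simp: D_def)
    have "d1 \<in> D x" using d12 by (simp add: D_def)
    then have "vsum f d1 \<le> V x" unfolding V_def using xy by (intro cSUP_upper bdd) auto
    then show ?thesis using d12 d by (intro exI[of _ d2]) auto
  qed
  have "absolutely_continuous_on {a..b} V"
    unfolding absolutely_continuous_on_def
  proof (intro allI impI)
    fix e :: real assume e: "0 < e"
    obtain \<delta> where \<delta>: "\<delta> > 0" "\<And>d. d division_of \<Union>d \<Longrightarrow> \<Union>d \<subseteq> {a..b} \<Longrightarrow> (\<Sum>k\<in>d. measure lborel k) < \<delta> \<Longrightarrow> vsum f d < e/2"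
      using absolutely_continuous_onD[OF f half_gt_zero[OF e]] by blast
    show "\<exists>\<delta>>0. \<forall>d. d division_of \<Union>d \<and> \<Union>d \<subseteq> {a..b} \<and> (\<Sum>k\<in>d. measure lborel k) < \<delta> \<longrightarrow> vsum V d < e"
    proof (intro exI[of _ \<delta>] conjI allI impI \<delta>(1))
      fix d assume "d division_of \<Union>d \<and> \<Union>d \<subseteq> {a..b} \<and> (\<Sum>k\<in>d. measure lborel k) < \<delta>"
      then have d: "d division_of \<Union>d" "\<Union>d \<subseteq> {a..b}" "(\<Sum>k\<in>d. measure lborel k) < \<delta>" by auto
      have fin: "finite d" using d by auto
      define \<epsilon> where "\<epsilon> = e / (2 * (real (card d) + 1))"
      have \<epsilon>: "\<epsilon> > 0" using e by (simp add: \<epsilon>_def)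
      have kd: "\<exists>d2. d2 division_of \<Union>d2 \<and> \<Union>d2 \<subseteq> k \<and> (\<forall>K\<in>d2. interior K \<noteq> {}) \<and>
          norm (V (Sup k) - V (Inf k)) < vsum f d2 + \<epsilon>" if k: "k \<in> d" for k
      proof -
        obtain s t where st: "k = {s..t}" "s \<le> t" using division_of_realE[OF d(1) k] by metis
        have "{s..t} \<subseteq> {a..b}" using d(2) k st by blast
        then have sub: "a \<le> s" "t \<le> b" using st by auto
        have "norm (V (Sup k) - V (Inf k)) = V t - V s" using V1[OF sub(1) st(2) sub(2)] st by simp
        moreover obtain d2 where "d2 division_of \<Union>d2" "\<Union>d2 \<subseteq> {s..t}" "\<forall>K\<in>d2. interior K \<noteq> {}" "V t - V s < vsum f d2 + \<epsilon>"
          using V2[OF sub(1) st(2) sub(2) \<epsilon>] by blast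
        ultimately show ?thesis using st(1) by (intro exI[of _ d2] conjI) simp_all
      qed
      have "\<forall>k\<in>d. \<exists>d2. d2 division_of \<Union>d2 \<and> \<Union>d2 \<subseteq> k \<and> (\<forall>K\<in>d2. interior K \<noteq> {}) \<and>
          norm (V (Sup k) - V (Inf k)) < vsum f d2 + \<epsilon>" using kd by (intro ballI)
      from bchoice[OF this] obtain dd where dd0: "\<forall>k\<in>d. dd k division_of \<Union>(dd k) \<and> \<Union>(dd k) \<subseteq> k \<and>
          (\<forall>K\<in>dd k. interior K \<noteq> {}) \<and> norm (V (Sup k) - V (Inf k)) < vsum f (dd k) + \<epsilon>" ..
      have dd: "dd k division_of \<Union>(dd k)" "\<Union>(dd k) \<subseteq> k" "\<And>K. K \<in> dd k \<Longrightarrow> interior K \<noteq> {}"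
          "norm (V (Sup k) - V (Inf k)) < vsum f (dd k) + \<epsilon>" if "k \<in> d" for k
        using bspec[OF dd0 that] by blast+
      have int: "interior K1 \<inter> interior K2 = {}" if "k1 \<in> d" "k2 \<in> d" "K1 \<in> dd k1" "K2 \<in> dd k2" "k1 \<noteq> k2" for k1 k2 K1 K2
      proof -
        have "interior K1 \<subseteq> interior k1" "interior K2 \<subseteq> interior k2"
          using that dd(2) by (auto intro!: interior_mono)
        then show ?thesis using division_ofD(5)[OF d(1) that(1,2,5)] by blast
      qed
      have fink: "finite (dd k)" if "k \<in> d" for k using dd(1)[OF that] by auto
      have disj: "\<forall>i\<in>d. \<forall>j\<in>d. i \<noteq> j \<longrightarrow> dd i \<inter> dd j = {}"
        using int dd(3) by fastforce
      let ?U = "\<Union>(dd ` d)"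
      have U: "?U division_of \<Union>?U"
      proof (rule division_of_Union)
        show "finite (dd ` d)" using fin by simp
        show "p division_of \<Union>p" if "p \<in> dd ` d" for p using that dd(1) by auto
        show "interior K1 \<inter> interior K2 = {}" if "K1 \<in> \<Union>(dd ` d)" "K2 \<in> \<Union>(dd ` d)" "K1 \<noteq> K2" for K1 K2
        proof -
          obtain k1 k2 where "k1 \<in> d" "k2 \<in> d" "K1 \<in> dd k1" "K2 \<in> dd k2" using \<open>K1 \<in> \<Union>(dd ` d)\<close> \<open>K2 \<in> \<Union>(dd ` d)\<close> by blast
          then show ?thesis using int[of k1 k2 K1 K2] division_ofD(5)[OF dd(1)[of k1], of K1 K2] \<open>K1 \<noteq> K2\<close>
            by (cases "k1 = k2") auto
        qed
      qed
      have sumU: "(\<Sum>K\<in>?U. h K) = (\<Sum>k\<in>d. \<Sum>K\<in>dd k. h K)" for h :: "real set \<Rightarrow> real"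
        by (rule sum.UNION_disjoint) (use fin fink disj in auto)
      have "(\<Sum>K\<in>?U. measure lborel K) \<le> (\<Sum>k\<in>d. measure lborel k)"
        unfolding sumU
      proof (rule sum_mono)
        fix k assume k: "k \<in> d"
        obtain s t where st: "k = {s..t}" using division_of_realE[OF d(1) k] by metis
        show "(\<Sum>K\<in>dd k. measure lborel K) \<le> measure lborel k"
          using subadditive_content_division[OF dd(1)[OF k], of s t] dd(2)[OF k] st by simp
      qed
      then have "vsum f ?U < e/2" using d dd(2) by (intro \<delta>(2) U) fastforce+
      have "vsum V d \<le> (\<Sum>k\<in>d. vsum f (dd k) + \<epsilon>)" using dd(4) by (intro sum_mono) (simp add: less_imp_le)
      also have "\<dots> = vsum f ?U + real (card d) * \<epsilon>" by (simp add: sum.distrib sumU)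
      also have "real (card d) * \<epsilon> \<le> e/2" using e by (simp add: \<epsilon>_def field_simps)
      finally show "vsum V d < e" using \<open>vsum f ?U < e/2\<close> by simp
    qed
  qed
  with V1 show ?thesis by (rule that)
qed

text \<open>The Stieltjes measure of \<open>F\<close> is absolutely continuous with respect to
  Lebesgue measure, and its Radon-Nikodym density is the required \<open>g\<close>. The
  \<epsilon>-\<delta> condition speaks of finitely many intervals, so a null set is reached through
  an open superset that is exhausted by finite unions of intervals.\<close>

lemma absolutely_continuous_mono_integral:
  fixes F :: "real \<Rightarrow> real"
  assumes F: "absolutely_continuous_on {a..b} F" and mono: "\<And>x y. a \<le> x \<Longrightarrow> x \<le> y \<Longrightarrow> y \<le> b \<Longrightarrow> F x \<le> F y"
    and ab: "a \<le> b"
  obtains g where "g absolutely_integrable_on {a..b}" "\<And>x. x \<in> {a..b} \<Longrightarrow> (g has_integral (F x - F a)) {a..x}"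
proof -
  \<comment> \<open>Freezing \<open>F\<close> outside \<open>{a..b}\<close> gives a continuous
    monotone function on the whole line whose measure sits on the open interval, so only the part of
    a null set inside it matters.\<close>
  define G where "G = (\<lambda>x. F (max a (min x b)))"
  have G_mono: "G x \<le> G y" if "x \<le> y" for x y
    unfolding G_def by (rule mono) (use that ab in auto)
  have "continuous_on UNIV G"
    unfolding G_def
    by (rule continuous_on_compose2[OF absolutely_continuous_on_imp_continuous_on[OF F]])
      (use ab in \<open>auto intro!: continuous_intros\<close>)
  then have G_cont: "continuous (at_right x) G" for x
    by (meson UNIV_I continuous_at_imp_continuous_at_within continuous_on_eq_continuous_at open_UNIV)
  have G_F: "G x = F x" if "x \<in> {a..b}" for x using that by (simp add: G_def)
  define \<nu> where "\<nu> = interval_measure G"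
  have sets_\<nu>: "sets \<nu> = sets borel" by (simp add: \<nu>_def)
  have Ioc: "emeasure \<nu> {x<..y} = G y - G x" if "x \<le> y" for x y
    unfolding \<nu>_def by (rule emeasure_interval_measure_Ioc[OF that G_mono G_cont])
  have Icc: "emeasure \<nu> {x..y} = G y - G x" if "x \<le> y" for x y
    unfolding \<nu>_def by (rule emeasure_interval_measure_Icc[OF that G_mono \<open>continuous_on UNIV G\<close>])
  have outside: "emeasure \<nu> (- {a<..<b}) = 0"
  proof -
    have "emeasure \<nu> {a - real n..a} = 0" "emeasure \<nu> {b..b + real n} = 0" for n
      using Icc[of "a - real n" a] Icc[of b "b + real n"] ab by (auto simp: G_def)
    then have "(\<Union>n. {a - real n..a} \<union> {b..b + real n}) \<in> null_sets \<nu>"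
      by (intro null_sets_UN null_sets.Un) (auto simp: null_sets_def sets_\<nu>)
    moreover have "- {a<..<b} \<subseteq> (\<Union>n. {a - real n..a} \<union> {b..b + real n})"
    proof
      fix x assume x: "x \<in> - {a<..<b}"
      obtain n where "\<bar>x\<bar> + \<bar>a\<bar> + \<bar>b\<bar> \<le> real n" using real_arch_simple by blast
      then have "x \<in> {a - real n..a} \<union> {b..b + real n}" using x by auto
      then show "x \<in> (\<Union>n. {a - real n..a} \<union> {b..b + real n})" by blast
    qed
    ultimately have "- {a<..<b} \<in> null_sets \<nu>"
      by (intro null_sets_subset[where A = "- {a<..<b}"]) (simp_all add: sets_\<nu>)
    then show ?thesis by auto
  qed
  have "absolutely_continuous lborel \<nu>"
    unfolding absolutely_continuous_def
  proof
    fix N :: "real set" assume N: "N \<in> null_sets lborel"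
    have Nb: "N \<in> sets borel" using N by auto
    have le: "emeasure \<nu> N \<le> ennreal e" if e: "0 < e" for e
    proof -
      obtain \<delta> where \<delta>: "\<delta> > 0" "\<And>d. d division_of \<Union>d \<Longrightarrow> \<Union>d \<subseteq> {a..b} \<Longrightarrow> (\<Sum>k\<in>d. measure lborel k) < \<delta> \<Longrightarrow> vsum F d < e"
        using absolutely_continuous_onD[OF F e] by blast
      obtain U where U: "open U" "N \<subseteq> U" "emeasure lborel (U - N) < \<delta>"
        using outer_regular_lborel[OF Nb \<delta>(1)] by blast
      have Ub: "U \<in> sets borel" using U(1) by simp
      have "emeasure lborel U = emeasure lborel (U - N)"
        using emeasure_Diff_null_set[OF N, of U] Ub by simp
      then have mU: "emeasure lborel U < \<delta>" using U(3) by simp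
      define O' where "O' = U \<inter> {a<..<b}"
      \<comment> \<open>The closures of these boxes stay in \<open>O'\<close>, so a finite union of
        closures is an elementary set inside \<open>O'\<close> and has a division to which the
        choice of \<delta> applies.\<close>
      define \<B> where "\<B> = {box c d | c d :: real. cbox c d \<subseteq> O'}"
      have "open O'" using U by (auto simp: O'_def)
      have O': "O' = \<Union>\<B>"
      proof
        show "\<Union>\<B> \<subseteq> O'" unfolding \<B>_def using box_subset_cbox by blast
        show "O' \<subseteq> \<Union>\<B>"
        proof
          fix x assume "x \<in> O'"
          then obtain e where "e > 0" "cball x e \<subseteq> O'" using \<open>open O'\<close> open_contains_cball by blast
          then have "box (x - e) (x + e) \<in> \<B>" "x \<in> box (x - e) (x + e)"
            by (auto simp: \<B>_def cball_eq_atLeastAtMost)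
          then show "x \<in> \<Union>\<B>" by blast
        qed
      qed
      obtain \<B>' where \<B>': "\<B>' \<subseteq> \<B>" "countable \<B>'" "\<Union>\<B>' = \<Union>\<B>"
        by (rule Lindelof[of \<B>]) (auto simp: \<B>_def)
      have bd: "emeasure \<nu> (\<Union>\<F>) \<le> ennreal e" if \<F>: "\<F> \<subseteq> \<B>'" "finite \<F>" for \<F>
      proof -
        have "\<forall>B\<in>\<F>. \<exists>c d. B = box c d \<and> cbox c d \<subseteq> O'" using \<F> \<B>' by (auto simp: \<B>_def)
        then obtain c d where cd: "\<And>B. B \<in> \<F> \<Longrightarrow> B = box (c B) (d B) \<and> cbox (c B) (d B) \<subseteq> O'" by metis
        let ?\<F> = "(\<lambda>B. cbox (c B) (d B)) ` \<F>"
        obtain p where p: "p division_of \<Union>?\<F>"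
          by (rule elementary_unions_intervals[of ?\<F>]) (use \<F> in auto)
        have pU: "\<Union>p = \<Union>?\<F>" by (rule division_ofD(6)[OF p])
        have p': "p division_of \<Union>p" unfolding pU by (rule p)
        have sub: "\<Union>p \<subseteq> O'" using cd pU by auto
        have pb: "k \<in> sets borel" if "k \<in> p" for k
          using division_ofD(4)[OF p' that] by auto
        have Up: "\<Union>p \<in> sets borel" using division_ofD(1)[OF p'] pb by (intro sets.finite_Union) auto
        have pleU: "emeasure lborel (\<Union>p) \<le> emeasure lborel U"
          by (rule emeasure_mono) (use sub Ub in \<open>auto simp: O'_def\<close>)
        have "(\<Sum>k\<in>p. measure lborel k) = (\<Sum>k\<in>p. measure lebesgue k)"
          by (rule sum.cong) (use pb in \<open>auto simp: measure_completion\<close>)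
        also have "\<dots> = measure lborel (\<Union>p)"
          using content_division[OF p'] Up by (simp add: measure_completion)
        finally have "ennreal (\<Sum>k\<in>p. measure lborel k) = ennreal (measure lborel (\<Union>p))" by simp
        also have "\<dots> = emeasure lborel (\<Union>p)"
          using pleU mU by (intro emeasure_eq_ennreal_measure[symmetric]) (auto simp: top_unique)
        also have "\<dots> \<le> emeasure lborel U" by (rule pleU)
        finally have "ennreal (\<Sum>k\<in>p. measure lborel k) < \<delta>" using mU by simp
        then have "(\<Sum>k\<in>p. measure lborel k) < \<delta>" using \<delta>(1) by (simp add: ennreal_less_iff sum_nonneg)
        then have vs: "vsum F p < e" using sub by (intro \<delta>(2) p') (auto simp: O'_def)
        have "emeasure \<nu> (\<Union>\<F>) \<le> emeasure \<nu> (\<Union>p)"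
        proof (rule emeasure_mono)
          show "\<Union>\<F> \<subseteq> \<Union>p"
          proof
            fix x assume "x \<in> \<Union>\<F>"
            then obtain B where B: "B \<in> \<F>" "x \<in> B" by blast
            then have "x \<in> cbox (c B) (d B)" using cd[OF B(1)] box_subset_cbox by blast
            then show "x \<in> \<Union>p" unfolding pU using B(1) by blast
          qed
          show "\<Union>p \<in> sets \<nu>" unfolding sets_\<nu> by (rule Up)
        qed
        also have "\<Union>p = (\<Union>k\<in>p. k)" by simp
        also have "emeasure \<nu> (\<Union>k\<in>p. k) \<le> (\<Sum>k\<in>p. emeasure \<nu> k)"
          using division_ofD(1)[OF p'] pb by (intro emeasure_subadditive_finite) (auto simp: sets_\<nu>)
        also have "\<dots> \<le> (\<Sum>k\<in>p. ennreal (norm (F (Sup k) - F (Inf k))))"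
        proof (rule sum_mono)
          fix k assume k: "k \<in> p"
          obtain s t where st: "k = {s..t}" "s \<le> t" using division_of_realE[OF p' k] by metis
          have "{s..t} \<subseteq> {a<..<b}" using st k sub unfolding O'_def by blast
          then have "G s = F s" "G t = F t" using st by (auto simp: G_F)
          then show "emeasure \<nu> k \<le> ennreal (norm (F (Sup k) - F (Inf k)))"
            using st Icc[OF st(2)] by (simp add: ennreal_leI)
        qed
        also have "\<dots> = ennreal (vsum F p)" by (simp add: sum_ennreal)
        also have "\<dots> \<le> ennreal e" using vs by (intro ennreal_leI) simp
        finally show ?thesis .
      qed
      have "emeasure \<nu> O' \<le> ennreal e"
      proof (cases "\<B>' = {}")
        case True
        then have "O' = {}" using O' \<B>' by auto
        then show ?thesis by simp
      next
        case False
        define W where "W = (\<lambda>n. \<Union>i\<le>n. from_nat_into \<B>' i)"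
        have "(\<Union>n. W n) = \<Union>(range (from_nat_into \<B>'))" unfolding W_def by blast
        then have W: "(\<Union>n. W n) = O'"
          using range_from_nat_into[OF False \<B>'(2)] O' \<B>'(3) by simp
        have "from_nat_into \<B>' i \<in> sets borel" for i
          using from_nat_into[OF False, of i] \<B>'(1) by (auto simp: \<B>_def)
        then have "range W \<subseteq> sets \<nu>" unfolding W_def sets_\<nu> by (auto intro: sets.finite_UN)
        moreover have "incseq W" unfolding W_def incseq_def by (auto intro: order_trans)
        ultimately have "(SUP n. emeasure \<nu> (W n)) = emeasure \<nu> O'"
          using SUP_emeasure_incseq[of W \<nu>] W by simp
        moreover have "emeasure \<nu> (W n) \<le> ennreal e" for n
          using bd[of "from_nat_into \<B>' ` {..n}"] from_nat_into[OF False] by (auto simp: W_def)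
        ultimately show ?thesis by (metis SUP_least)
      qed
      have "emeasure \<nu> N \<le> emeasure \<nu> (O' \<union> (- {a<..<b}))"
        using U(2) by (intro emeasure_mono) (use Ub in \<open>auto simp: O'_def sets_\<nu>\<close>)
      also have "\<dots> \<le> emeasure \<nu> O' + emeasure \<nu> (- {a<..<b})"
        by (rule emeasure_subadditive) (use \<open>open O'\<close> in \<open>auto simp: sets_\<nu>\<close>)
      finally show ?thesis using outside \<open>emeasure \<nu> O' \<le> ennreal e\<close> by simp
    qed
    have "emeasure \<nu> N \<le> 0"
      by (rule ennreal_le_epsilon) (use le in auto)
    then show "N \<in> null_sets \<nu>" using Nb by (auto simp: null_sets_def sets_\<nu>)
  qed
  then obtain D where D: "D \<in> borel_measurable lborel" "density lborel D = \<nu>"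
    using sigma_finite_measure.Radon_Nikodym[OF lborel.sigma_finite_measure_axioms, of \<nu>] sets_\<nu> by auto
  \<comment> \<open>The density may be infinite, in which case \<open>enn2real\<close> gives 0;
    finiteness of \<open>F b - F a\<close> confines this to a null set of
    \<open>{a<..b}\<close>.\<close>
  define g where "g = (\<lambda>x. enn2real (D x))"
  have nD: "(\<integral>\<^sup>+ t. D t * indicator {a<..x} t \<partial>lborel) = ennreal (F x - F a)" if x: "x \<in> {a..b}" for x
  proof -
    have "(\<integral>\<^sup>+ t. D t * indicator {a<..x} t \<partial>lborel) = emeasure \<nu> {a<..x}"
      unfolding D(2)[symmetric] by (rule emeasure_density[symmetric]) (use D in auto)
    then show ?thesis using Ioc[of a x] x G_F ab by auto
  qed
  have "(\<integral>\<^sup>+ t. D t * indicator {a<..b} t \<partial>lborel) \<noteq> \<infinity>" using nD[of b] ab by simp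
  then have "AE t in lborel. D t * indicator {a<..b} t \<noteq> \<infinity>"
    by (intro nn_integral_PInf_AE) (use D in auto)
  then have fin: "AE t in lborel. t \<in> {a<..b} \<longrightarrow> ennreal (g t) = D t"
    by eventually_elim (auto simp: g_def top.not_eq_extremum)
  have hi: "(g has_integral (F x - F a)) {a..x}" if x: "x \<in> {a..b}" for x
  proof -
    have "(\<integral>\<^sup>+ t. ennreal (g t * indicator {a<..x} t) \<partial>lborel) = (\<integral>\<^sup>+ t. D t * indicator {a<..x} t \<partial>lborel)"
    proof (rule nn_integral_cong_AE)
      show "AE t in lborel. ennreal (g t * indicator {a<..x} t) = D t * indicator {a<..x} t"
        using fin by eventually_elim (use x in \<open>auto simp: indicator_def\<close>)
    qed
    then have "((\<lambda>t. g t * indicator {a<..x} t) has_integral (F x - F a)) UNIV"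
      using D nD[OF x] x mono[of a x] by (intro nn_integral_has_integral) (auto simp: g_def)
    moreover have "(\<lambda>t. g t * indicator {a<..x} t) = (\<lambda>t. if t \<in> {a<..x} then g t else 0)" by auto
    ultimately have "(g has_integral (F x - F a)) {a<..x}"
      using has_integral_restrict_UNIV[of "{a<..x}" g] by simp
    then show ?thesis
      by (subst has_integral_spike_set_eq[where T = "{a<..x}"]) (auto intro: negligible_subset[of "{a}"])
  qed
  show ?thesis
  proof (rule that)
    show "g absolutely_integrable_on {a..b}"
      by (rule nonnegative_absolutely_integrable_1) (use hi[of b] ab in \<open>auto simp: g_def integrable_on_def\<close>)
  qed (rule hi)
qed

lemma absolutely_continuous_onI_le:
  assumes f: "absolutely_continuous_on S f"
    and le: "\<And>x y. x \<in> S \<Longrightarrow> y \<in> S \<Longrightarrow> norm (g y - g x) \<le> C * norm (f y - f x)"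
  shows "absolutely_continuous_on S g"
  unfolding absolutely_continuous_on_def
proof (intro allI impI)
  fix e :: real assume e: "0 < e"
  have e': "0 < e / (\<bar>C\<bar> + 1)" using e by simp
  obtain \<delta> where \<delta>: "\<delta> > 0" "\<And>d. d division_of \<Union>d \<Longrightarrow> \<Union>d \<subseteq> S \<Longrightarrow> (\<Sum>k\<in>d. measure lborel k) < \<delta> \<Longrightarrow> vsum f d < e / (\<bar>C\<bar> + 1)"
    using absolutely_continuous_onD[OF f e'] by blast
  show "\<exists>\<delta>>0. \<forall>d. d division_of \<Union>d \<and> \<Union>d \<subseteq> S \<and> (\<Sum>k\<in>d. measure lborel k) < \<delta> \<longrightarrow> vsum g d < e"
  proof (intro exI[of _ \<delta>] conjI allI impI \<delta>(1))
    fix d assume d: "d division_of \<Union>d \<and> \<Union>d \<subseteq> S \<and> (\<Sum>k\<in>d. measure lborel k) < \<delta>"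
    have "norm (g (Sup k) - g (Inf k)) \<le> (\<bar>C\<bar> + 1) * norm (f (Sup k) - f (Inf k))" if k: "k \<in> d" for k
    proof -
      obtain s t where st: "k = {s..t}" "s \<le> t" using division_of_realE d k by metis
      have "k \<subseteq> S" using d k by blast
      then have "s \<in> S" "t \<in> S" using st by auto
      then have "norm (g t - g s) \<le> C * norm (f t - f s)" by (rule le)
      also have "\<dots> \<le> (\<bar>C\<bar> + 1) * norm (f t - f s)" by (intro mult_right_mono) auto
      finally show ?thesis using st by simp
    qed
    then have "vsum g d \<le> (\<Sum>k\<in>d. (\<bar>C\<bar> + 1) * norm (f (Sup k) - f (Inf k)))" by (rule sum_mono)
    also have "\<dots> = (\<bar>C\<bar> + 1) * vsum f d" by (simp add: sum_distrib_left)
    also have "\<dots> < (\<bar>C\<bar> + 1) * (e / (\<bar>C\<bar> + 1))"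
      using \<delta>(2) d by (intro mult_strict_left_mono) auto
    finally show "vsum g d < e" by simp
  qed
qed

lemma absolutely_continuous_on_add:
  assumes f: "absolutely_continuous_on S f" and g: "absolutely_continuous_on S g"
  shows "absolutely_continuous_on S (\<lambda>x. f x + g x)"
  unfolding absolutely_continuous_on_def
proof (intro allI impI)
  fix e :: real assume e: "0 < e"
  obtain \<delta>1 where \<delta>1: "\<delta>1 > 0" "\<And>d. d division_of \<Union>d \<Longrightarrow> \<Union>d \<subseteq> S \<Longrightarrow> (\<Sum>k\<in>d. measure lborel k) < \<delta>1 \<Longrightarrow> vsum f d < e / 2"
    using absolutely_continuous_onD[OF f half_gt_zero[OF e]] by blast
  obtain \<delta>2 where \<delta>2: "\<delta>2 > 0" "\<And>d. d division_of \<Union>d \<Longrightarrow> \<Union>d \<subseteq> S \<Longrightarrow> (\<Sum>k\<in>d. measure lborel k) < \<delta>2 \<Longrightarrow> vsum g d < e / 2"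
    using absolutely_continuous_onD[OF g half_gt_zero[OF e]] by blast
  show "\<exists>\<delta>>0. \<forall>d. d division_of \<Union>d \<and> \<Union>d \<subseteq> S \<and> (\<Sum>k\<in>d. measure lborel k) < \<delta> \<longrightarrow> vsum (\<lambda>x. f x + g x) d < e"
  proof (intro exI[of _ "min \<delta>1 \<delta>2"] conjI allI impI)
    fix d assume d: "d division_of \<Union>d \<and> \<Union>d \<subseteq> S \<and> (\<Sum>k\<in>d. measure lborel k) < min \<delta>1 \<delta>2"
    have "vsum (\<lambda>x. f x + g x) d \<le> vsum f d + vsum g d"
      unfolding sum.distrib[symmetric] by (intro sum_mono) (metis add_diff_add norm_triangle_ineq)
    moreover have "vsum f d < e/2" "vsum g d < e/2" using \<delta>1(2)[of d] \<delta>2(2)[of d] d by auto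
    ultimately show "vsum (\<lambda>x. f x + g x) d < e" by simp
  qed (use \<delta>1 \<delta>2 in auto)
qed

text \<open>Jordan decomposition: \<open>h = (V + h) - V\<close> with both terms increasing when
  \<open>V\<close> is the variation function. Vector values are treated by coordinates.\<close>

lemma absolutely_continuous_on_imp_integral:
  fixes f :: "real \<Rightarrow> 'a::euclidean_space"
  assumes f: "absolutely_continuous_on {a..b} f" and ab: "a \<le> b"
  obtains g where "g absolutely_integrable_on {a..b}" "\<And>x. x \<in> {a..b} \<Longrightarrow> (g has_integral (f x - f a)) {a..x}"
proof -
  have real: "\<exists>g. g absolutely_integrable_on {a..b} \<and> (\<forall>x\<in>{a..b}. (g has_integral (h x - h a)) {a..x})"
    if h: "absolutely_continuous_on {a..b} h" for h :: "real \<Rightarrow> real"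
  proof -
    obtain V where V: "\<And>x y. a \<le> x \<Longrightarrow> x \<le> y \<Longrightarrow> y \<le> b \<Longrightarrow> \<bar>h y - h x\<bar> \<le> V y - V x"
      "absolutely_continuous_on {a..b} V"
      using exists_variation_function[OF h] by blast
    obtain g1 where g1: "g1 absolutely_integrable_on {a..b}" "\<And>x. x \<in> {a..b} \<Longrightarrow> (g1 has_integral (V x - V a)) {a..x}"
      by (rule absolutely_continuous_mono_integral[OF V(2) _ ab]) (use V(1) in \<open>fastforce\<close>)+
    obtain g2 where g2: "g2 absolutely_integrable_on {a..b}" "\<And>x. x \<in> {a..b} \<Longrightarrow> (g2 has_integral (V x + h x - (V a + h a))) {a..x}"
      by (rule absolutely_continuous_mono_integral[OF absolutely_continuous_on_add[OF V(2) h] _ ab]) (use V(1) in \<open>fastforce\<close>)+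
    show ?thesis
    proof (intro exI conjI ballI)
      show "(\<lambda>x. g2 x - g1 x) absolutely_integrable_on {a..b}" by (rule set_integral_diff(1)[OF g2(1) g1(1)])
      show "((\<lambda>x. g2 x - g1 x) has_integral (h x - h a)) {a..x}" if "x \<in> {a..b}" for x
        using has_integral_diff[OF g2(2)[OF that] g1(2)[OF that]] by (simp add: algebra_simps)
    qed
  qed
  have "\<forall>i\<in>Basis. \<exists>g. g absolutely_integrable_on {a..b} \<and> (\<forall>x\<in>{a..b}. (g has_integral (f x \<bullet> i - f a \<bullet> i)) {a..x})"
  proof
    fix i :: 'a assume i: "i \<in> Basis"
    have "absolutely_continuous_on {a..b} (\<lambda>x. f x \<bullet> i)"
      by (rule absolutely_continuous_onI_le[OF f, of _ 1])
        (use i in \<open>auto simp: inner_diff_left[symmetric] Basis_le_norm\<close>)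
    from real[OF this] show "\<exists>g. g absolutely_integrable_on {a..b} \<and> (\<forall>x\<in>{a..b}. (g has_integral (f x \<bullet> i - f a \<bullet> i)) {a..x})" .
  qed
  then obtain g where g: "\<And>i. i \<in> Basis \<Longrightarrow> g i absolutely_integrable_on {a..b}"
    "\<And>i x. i \<in> Basis \<Longrightarrow> x \<in> {a..b} \<Longrightarrow> (g i has_integral (f x \<bullet> i - f a \<bullet> i)) {a..x}"
    by (metis (no_types))
  show ?thesis
  proof (rule that)
    show "(\<lambda>x. \<Sum>i\<in>Basis. g i x *\<^sub>R i) absolutely_integrable_on {a..b}"
      by (intro absolutely_integrable_sum absolutely_integrable_scaleR_right g) auto
    fix x assume x: "x \<in> {a..b}"
    have "((\<lambda>x. \<Sum>i\<in>Basis. g i x *\<^sub>R i) has_integral (\<Sum>i\<in>Basis. (f x \<bullet> i - f a \<bullet> i) *\<^sub>R i)) {a..x}"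
      by (intro has_integral_sum has_integral_scaleR_left g x) auto
    then show "((\<lambda>x. \<Sum>i\<in>Basis. g i x *\<^sub>R i) has_integral (f x - f a)) {a..x}"
      by (simp add: inner_diff_left[symmetric] euclidean_representation)
  qed
qed

section \<open>Integrability on the unit interval\<close>

abbreviation L1 :: "(real \<Rightarrow> 'a::euclidean_space) \<Rightarrow> bool" where
  "L1 f \<equiv> f absolutely_integrable_on {0..1}"

lemma AE_M01_iff: "(AE x in M01. P x) \<longleftrightarrow> negligible {x \<in> {0<..<1}. \<not> P x}"
proof -
  have "(AE x in M01. P x) \<longleftrightarrow> (AE x in lebesgue. x \<in> {0<..<1} \<longrightarrow> P x)"
    by (subst AE_restrict_space_iff) auto
  also have "\<dots> \<longleftrightarrow> {x. \<not> (x \<in> {0<..<1} \<longrightarrow> P x)} \<in> null_sets lebesgue"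
    using completion.AE_iff_null_sets[of "\<lambda>x. x \<in> {0<..<1} \<longrightarrow> P x" lborel] by simp
  also have "{x. \<not> (x \<in> {0<..<1} \<longrightarrow> P x)} = {x \<in> {0<..<1}. \<not> P x}" by auto
  finally show ?thesis by (simp add: negligible_iff_null_sets)
qed

lemma AE_M01_I: "(\<And>x. 0 < x \<Longrightarrow> x < 1 \<Longrightarrow> P x) \<Longrightarrow> AE x in M01. P x"
  unfolding AE_M01_iff by (auto intro: negligible_subset[of "{}"])

lemma AE_M01_mem: "AE x in M01. x \<in> {0<..<1}"
  by (rule AE_M01_I) auto

lemma integrable_M01_iff:
  fixes f :: "real \<Rightarrow> 'a::euclidean_space"
  shows "integrable M01 f \<longleftrightarrow> L1 f"
proof -
  have "integrable M01 f \<longleftrightarrow> f absolutely_integrable_on {0<..<1}"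
    unfolding set_integrable_def by (rule integrable_restrict_space) auto
  also have "\<dots> \<longleftrightarrow> L1 f"
    by (rule absolutely_integrable_spike_set_eq) (auto intro: negligible_subset[of "{0,1}"])
  finally show ?thesis .
qed

lemma LINT_M01:
  fixes f :: "real \<Rightarrow> 'a::euclidean_space"
  assumes "L1 f"
  shows "(LINT x|M01. f x) = integral {0..1} f"
proof -
  have "f absolutely_integrable_on {0<..<1}"
    using assms by (subst absolutely_integrable_spike_set_eq[where T = "{0..1}"])
      (auto intro: negligible_subset[of "{0,1}"])
  then have "(LINT x:{0<..<1}|lebesgue. f x) = integral {0<..<1} f"
    by (rule set_lebesgue_integral_eq_integral(2))
  moreover have "(LINT x|M01. f x) = (LINT x:{0<..<1}|lebesgue. f x)"
    unfolding set_lebesgue_integral_def by (rule integral_restrict_space) auto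
  moreover have "integral {0<..<1} f = integral {0..1} f"
    by (rule integral_spike_set) (auto intro: negligible_subset[of "{0,1}"])
  ultimately show ?thesis by simp
qed

lemma absolutely_integrable_AE_cong:
  fixes f g :: "real \<Rightarrow> 'a::euclidean_space"
  assumes "L1 f" "AE x in M01. f x = g x"
  shows "L1 g"
proof (rule absolutely_integrable_spike[OF assms(1)])
  show "negligible ({x \<in> {0<..<1}. \<not> f x = g x} \<union> {0, 1})"
    using assms(2)[unfolded AE_M01_iff] by (intro negligible_Un) auto
qed auto

lemma has_integral_AE_cong:
  fixes f g :: "real \<Rightarrow> 'a::euclidean_space"
  assumes "(f has_integral I) {0..x}" "AE x in M01. f x = g x" "x \<le> 1"
  shows "(g has_integral I) {0..x}"
proof (rule has_integral_spike[OF _ _ assms(1)])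
  show "negligible ({x \<in> {0<..<1}. \<not> f x = g x} \<union> {0, 1})"
    using assms(2)[unfolded AE_M01_iff] by (intro negligible_Un) auto
qed (use assms in auto)

lemma absolutely_integrable_continuous_mult:
  fixes f g :: "real \<Rightarrow> 'a::{euclidean_space, real_normed_algebra}"
  assumes "continuous_on {0..1} f" "L1 g"
  shows "L1 (\<lambda>x. f x * g x)"
proof (rule absolutely_integrable_bounded_measurable_product[OF bilinear_times])
  show "f \<in> borel_measurable (lebesgue_on {0..1})"
    using assms(1) by (intro continuous_imp_measurable_on_sets_lebesgue) auto
  show "bounded (f ` {0..1})"
    using assms(1) by (intro compact_imp_bounded compact_continuous_image) auto
qed (use assms in auto)

text \<open>A relation rather than an operator: the derivative is determined only up to null sets,
  and with \<open>acd_cong\<close> the sum, product and chain rules can be combined without choosing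
  representatives.\<close>

definition acd :: "(real \<Rightarrow> 'a::euclidean_space) \<Rightarrow> (real \<Rightarrow> 'a) \<Rightarrow> bool" where
  "acd f g \<longleftrightarrow> absolutely_continuous_on {0..1} f \<and> (AE x in M01. (f has_vector_derivative g x) (at x))"

lemma acdD: "acd f g \<Longrightarrow> absolutely_continuous_on {0..1} f"
  "acd f g \<Longrightarrow> AE x in M01. (f has_vector_derivative g x) (at x)"
  by (auto simp: acd_def)

lemma acd_continuous: "acd f g \<Longrightarrow> continuous_on {0..1} f"
  by (rule absolutely_continuous_on_imp_continuous_on[OF acdD(1)])

lemma acd_cong:
  assumes f: "acd f g" and eq: "\<And>x. x \<in> {0..1} \<Longrightarrow> f x = f' x" "AE x in M01. g x = g' x"
  shows "acd f' g'"
  unfolding acd_def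
proof
  show "absolutely_continuous_on {0..1} f'"
    by (rule absolutely_continuous_onI_le[OF acdD(1)[OF f], of _ 1]) (use eq in auto)
  show "AE x in M01. (f' has_vector_derivative g' x) (at x)"
    using acdD(2)[OF f] eq(2) AE_M01_mem
  proof eventually_elim
    case (elim x)
    show ?case
      by (rule has_vector_derivative_transform_within_open[of f _ x "{0<..<1}"]) (use elim eq in auto)
  qed
qed

lemma acd_integralI:
  assumes g: "L1 g" and f: "\<And>x. x \<in> {0..1} \<Longrightarrow> f x = c + integral {0..x} g"
  shows "acd f g"
proof -
  have "acd (\<lambda>x. c + integral {0..x} g) g"
    unfolding acd_def
  proof
    show "absolutely_continuous_on {0..1} (\<lambda>x. c + integral {0..x} g)"
      by (rule absolutely_continuous_onI_le[OF absolutely_continuous_on_integral[OF g], of _ 1]) auto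
    have "AE x in M01. ((\<lambda>x. integral {0..x} g) has_vector_derivative g x) (at x)"
      unfolding AE_M01_iff
      using negligible_not_differentiable_integral[of g 0 1] g by (simp add: absolutely_integrable_on_def)
    then show "AE x in M01. ((\<lambda>x. c + integral {0..x} g) has_vector_derivative g x) (at x)"
      by eventually_elim (auto intro!: derivative_eq_intros)
  qed
  then show ?thesis by (rule acd_cong) (use f in auto)
qed

lemma absolutely_continuous_imp_acd:
  fixes f :: "real \<Rightarrow> 'a::euclidean_space"
  assumes "absolutely_continuous_on {0..1} f"
  obtains g where "L1 g" "acd f g" "\<And>x. x \<in> {0..1} \<Longrightarrow> (g has_integral (f x - f 0)) {0..x}"
proof -
  obtain g where g: "L1 g" "\<And>x. x \<in> {0..1} \<Longrightarrow> (g has_integral (f x - f 0)) {0..x}"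
    using absolutely_continuous_on_imp_integral[OF assms zero_le_one] by blast
  have "f x = f 0 + integral {0..x} g" if "x \<in> {0..1}" for x
    using integral_unique[OF g(2)[OF that]] by simp
  then have "acd f g" by (rule acd_integralI[OF g(1)])
  with g show ?thesis using that by blast
qed

lemma acd_unique:
  assumes "acd f g" "acd f g'"
  shows "AE x in M01. g x = g' x"
  using acdD(2)[OF assms(1)] acdD(2)[OF assms(2)]
  by eventually_elim (rule vector_derivative_unique_at)

text \<open>The density that integrates back to \<open>f\<close> is itself an a.e. derivative of
  \<open>f\<close>, so it agrees a.e. with the given \<open>g\<close>. This is the form of the
  fundamental theorem used from here on.\<close>

lemma acd_has_integral:
  assumes f: "acd f g"
  shows "L1 g" "x \<in> {0..1} \<Longrightarrow> (g has_integral (f x - f 0)) {0..x}"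
proof -
  obtain g' where g': "L1 g'" "acd f g'" "\<And>x. x \<in> {0..1} \<Longrightarrow> (g' has_integral (f x - f 0)) {0..x}"
    using absolutely_continuous_imp_acd[OF acdD(1)[OF f]] by blast
  have eq: "AE x in M01. g' x = g x" by (rule acd_unique[OF g'(2) f])
  show "L1 g" by (rule absolutely_integrable_AE_cong[OF g'(1) eq])
  show "(g has_integral (f x - f 0)) {0..x}" if "x \<in> {0..1}"
    by (rule has_integral_AE_cong[OF g'(3)[OF that] eq]) (use that in auto)
qed

lemma acd_diff_eq:
  assumes f: "acd f g" and xy: "0 \<le> x" "x \<le> y" "y \<le> 1"
  shows "(g has_integral (f y - f x)) {x..y}"
proof -
  have gi: "g integrable_on {0..y}" "g integrable_on {x..y}"
    using acd_has_integral(1)[OF f] xy by (auto simp: absolutely_integrable_on_def intro: integrable_on_subinterval)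
  have "integral {0..x} g + integral {x..y} g = integral {0..y} g"
    by (rule Henstock_Kurzweil_Integration.integral_combine) (use xy gi in auto)
  then have "integral {x..y} g = f y - f x"
    using integral_unique[OF acd_has_integral(2)[OF f, of x]] integral_unique[OF acd_has_integral(2)[OF f, of y]] xy
    by (simp add: algebra_simps)
  then show ?thesis using gi(2) by (metis integrable_integral)
qed

lemma acd_mono:
  fixes f :: "real \<Rightarrow> real"
  assumes f: "acd f g" and g: "AE t in M01. 0 \<le> g t" and xy: "0 \<le> x" "x \<le> y" "y \<le> 1"
  shows "f x \<le> f y"
proof -
  have "AE t in M01. g t = max (g t) 0" using g by eventually_elim auto
  then have f': "acd f (\<lambda>t. max (g t) 0)" by (intro acd_cong[OF f]) auto
  have "0 \<le> f y - f x" by (rule has_integral_nonneg[OF acd_diff_eq[OF f' xy]]) auto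
  then show ?thesis by simp
qed

lemma acd_const_eq:
  assumes f: "acd f g" and g: "AE t in M01. g t = 0" and x: "x \<in> {0..1}"
  shows "f x = f 0"
proof -
  have "acd f (\<lambda>t. 0)" by (rule acd_cong[OF f _ g]) auto
  from acd_has_integral(2)[OF this x] show ?thesis by simp
qed

section \<open>Calculus of absolutely continuous functions\<close>

lemma acd_const [simp]: "acd (\<lambda>x. c) (\<lambda>x. 0)"
  using acd_integralI[of "\<lambda>x. 0" "\<lambda>x. c" c] by simp

lemma acd_id: "acd (\<lambda>x::real. x) (\<lambda>x. 1)"
proof (rule acd_integralI[of _ _ 0])
  show "L1 (\<lambda>x::real. 1::real)"
    by (rule absolutely_integrable_on_const) (metis box_real(2) lmeasurable_cbox)
qed auto

lemma acd_add: "acd f f' \<Longrightarrow> acd g g' \<Longrightarrow> acd (\<lambda>x. f x + g x) (\<lambda>x. f' x + g' x)"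
  unfolding acd_def
  by (auto intro: absolutely_continuous_on_add has_vector_derivative_add elim: eventually_elim2)

lemma acd_linear:
  fixes f :: "real \<Rightarrow> 'a::euclidean_space" and L :: "'a \<Rightarrow> 'b::euclidean_space"
  assumes "bounded_linear L" "acd f f'"
  shows "acd (\<lambda>x. L (f x)) (\<lambda>x. L (f' x))"
  unfolding acd_def
proof
  interpret L: bounded_linear L by fact
  obtain K where K: "\<And>x. norm (L x) \<le> norm x * K" using L.bounded by blast
  show "absolutely_continuous_on {0..1} (\<lambda>x. L (f x))"
    by (rule absolutely_continuous_onI_le[OF acdD(1)[OF assms(2)], of _ K])
      (use K in \<open>auto simp: L.diff[symmetric] mult.commute\<close>)
  show "AE x in M01. ((\<lambda>x. L (f x)) has_vector_derivative L (f' x)) (at x)"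
    using acdD(2)[OF assms(2)] by eventually_elim (rule L.has_vector_derivative)
qed

lemmas acd_minus = acd_linear[OF bounded_linear_minus[OF bounded_linear_ident]]
lemmas acd_Re = acd_linear[OF bounded_linear_Re]
lemmas acd_Im = acd_linear[OF bounded_linear_Im]
lemmas acd_cnj = acd_linear[OF bounded_linear_cnj]
lemmas acd_cmult = acd_linear[OF bounded_linear_mult_right]

lemma acd_diff: "acd f f' \<Longrightarrow> acd g g' \<Longrightarrow> acd (\<lambda>x. f x - g x) (\<lambda>x. f' x - g' x)"
  using acd_add[OF _ acd_minus, of f f' g g'] by simp

lemma acd_mult:
  fixes f g :: "real \<Rightarrow> 'a::{euclidean_space, real_normed_algebra}"
  assumes f: "acd f f'" and g: "acd g g'"
  shows "acd (\<lambda>x. f x * g x) (\<lambda>x. f x * g' x + f' x * g x)"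
  unfolding acd_def
proof
  have "bounded (f ` {0..1})" "bounded (g ` {0..1})"
    using acd_continuous[OF f] acd_continuous[OF g]
    by (auto intro!: compact_imp_bounded compact_continuous_image)
  then obtain B C where B: "\<And>x. x \<in> {0..1} \<Longrightarrow> norm (f x) \<le> B" and C: "\<And>x. x \<in> {0..1} \<Longrightarrow> norm (g x) \<le> C"
    unfolding bounded_iff by (metis imageI)
  have B0: "0 \<le> B" "0 \<le> C" using order_trans[OF norm_ge_zero B[of 0]] order_trans[OF norm_ge_zero C[of 0]] by auto
  \<comment> \<open>The comparison criterion takes a single dominating function. The pair serves as
    one, since the product is Lipschitz in the pair on bounded sets.\<close>
  have "acd (\<lambda>x. (f x, g x)) (\<lambda>x. (f' x, 0) + (0, g' x))"
    using acd_add[OF acd_linear[of "\<lambda>x. (x, 0)", OF _ f] acd_linear[of "\<lambda>x. (0, x)", OF _ g]]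
    by (simp add: bounded_linear_Pair bounded_linear_ident bounded_linear_zero)
  then have "absolutely_continuous_on {0..1} (\<lambda>x. (f x, g x))" by (rule acdD(1))
  then show "absolutely_continuous_on {0..1} (\<lambda>x. f x * g x)"
  proof (rule absolutely_continuous_onI_le)
    fix x y :: real assume xy: "x \<in> {0..1}" "y \<in> {0..1}"
    have "f y * g y - f x * g x = f y * (g y - g x) + (f y - f x) * g x" by (simp add: algebra_simps)
    then have "norm (f y * g y - f x * g x) \<le> norm (f y) * norm (g y - g x) + norm (f y - f x) * norm (g x)"
      by (metis (no_types, lifting) add_mono norm_mult_ineq norm_triangle_le)
    also have "\<dots> \<le> B * norm ((f y, g y) - (f x, g x)) + norm ((f y, g y) - (f x, g x)) * C"
      using xy B C B0 norm_fst_le[of "f y - f x" "g y - g x"] norm_snd_le[of "g y - g x" "f y - f x"]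
      by (intro add_mono mult_mono) auto
    finally show "norm (f y * g y - f x * g x) \<le> (B + C) * norm ((f y, g y) - (f x, g x))"
      by (simp add: algebra_simps)
  qed
  show "AE x in M01. ((\<lambda>x. f x * g x) has_vector_derivative f x * g' x + f' x * g x) (at x)"
    using acdD(2)[OF f] acdD(2)[OF g] by eventually_elim (rule has_vector_derivative_mult)
qed

lemma acd_compose:
  fixes f :: "real \<Rightarrow> real" and \<phi> :: "real \<Rightarrow> real"
  assumes f: "acd f f'" and \<phi>: "\<And>y. y \<in> f ` {0..1} \<Longrightarrow> (\<phi> has_real_derivative \<phi>' y) (at y)"
    and cont: "continuous_on (f ` {0..1}) \<phi>'"
  shows "acd (\<lambda>x. \<phi> (f x)) (\<lambda>x. \<phi>' (f x) * f' x)"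
  unfolding acd_def
proof
  let ?S = "f ` {0..1}"
  have cf: "continuous_on {0..1} f" by (rule acd_continuous[OF f])
  \<comment> \<open>The range is an interval, hence convex, and the mean value bound makes \<phi>
    Lipschitz on it.\<close>
  have "compact ?S" "connected ?S" using compact_continuous_image[OF cf] connected_continuous_image[OF cf] by auto
  then have conv: "convex ?S" by (metis is_interval_connected_1 is_interval_convex_1)
  have "bounded (\<phi>' ` ?S)" by (rule compact_imp_bounded[OF compact_continuous_image[OF cont \<open>compact ?S\<close>]])
  then obtain B where B: "\<And>y. y \<in> ?S \<Longrightarrow> norm (\<phi>' y) \<le> B" unfolding bounded_iff by (metis imageI)
  show "absolutely_continuous_on {0..1} (\<lambda>x. \<phi> (f x))"
  proof (rule absolutely_continuous_onI_le[OF acdD(1)[OF f], of _ B])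
    fix x y :: real assume "x \<in> {0..1}" "y \<in> {0..1}"
    then show "norm (\<phi> (f y) - \<phi> (f x)) \<le> B * norm (f y - f x)"
      using B \<phi> by (intro field_differentiable_bound[OF conv, of \<phi> \<phi>'])
        (auto intro: has_field_derivative_at_within)
  qed
  show "AE x in M01. ((\<lambda>x. \<phi> (f x)) has_vector_derivative \<phi>' (f x) * f' x) (at x)"
    using acdD(2)[OF f] AE_M01_mem
  proof eventually_elim
    case (elim x)
    have "(f has_real_derivative f' x) (at x)"
      using elim by (simp add: has_real_derivative_iff_has_vector_derivative)
    moreover have "(\<phi> has_real_derivative \<phi>' (f x)) (at (f x))" using elim by (intro \<phi>) auto
    ultimately have "(\<phi> \<circ> f has_real_derivative \<phi>' (f x) * f' x) (at x)"
      by (intro DERIV_chain)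
    then show ?case by (simp add: has_real_derivative_iff_has_vector_derivative o_def)
  qed
qed

lemma acd_exp: "acd f f' \<Longrightarrow> acd (\<lambda>x. exp (f x)) (\<lambda>x. exp (f x) * f' x)" for f :: "real \<Rightarrow> real"
  by (rule acd_compose) (auto intro: DERIV_exp continuous_intros)

lemma acd_inverse:
  fixes f :: "real \<Rightarrow> real"
  assumes "acd f f'" "\<And>x. x \<in> {0..1} \<Longrightarrow> f x \<noteq> 0"
  shows "acd (\<lambda>x. inverse (f x)) (\<lambda>x. - (inverse (f x) ^ 2) * f' x)"
  by (rule acd_compose[OF assms(1)])
    (use assms(2) in \<open>auto intro!: DERIV_inverse[unfolded numeral_2_eq_2[symmetric], THEN DERIV_cong] continuous_intros simp: numeral_2_eq_2\<close>)

lemma acd_ln: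
  fixes f :: "real \<Rightarrow> real"
  assumes "acd f f'" "\<And>x. x \<in> {0..1} \<Longrightarrow> 0 < f x"
  shows "acd (\<lambda>x. ln (f x)) (\<lambda>x. inverse (f x) * f' x)"
  by (rule acd_compose[OF assms(1)])
    (use assms(2) in \<open>auto intro!: DERIV_ln continuous_intros simp: less_imp_neq[symmetric]\<close>)

text \<open>The function \<open>E * exp (- m)\<close> has nonpositive derivative almost everywhere,
  where \<open>m\<close> is an antiderivative of the merely integrable rate
  \<open>k\<close>.\<close>

lemma acd_Gronwall:
  fixes E :: "real \<Rightarrow> real"
  assumes E: "acd E E'" and k: "acd m k" and le: "AE x in M01. E' x \<le> k x * E x"
    and xy: "0 \<le> x" "x \<le> y" "y \<le> 1"
  shows "E y \<le> E x * exp (m y - m x)"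
proof -
  have d: "acd (\<lambda>x. - (E x * exp (- m x))) (\<lambda>x. - (E x * (exp (- m x) * - k x) + E' x * exp (- m x)))"
    by (intro acd_minus acd_mult acd_exp E k)
  have "AE x in M01. 0 \<le> - (E x * (exp (- m x) * - k x) + E' x * exp (- m x))"
    using le
  proof eventually_elim
    case (elim x)
    then have "E' x * exp (- m x) \<le> k x * E x * exp (- m x)" by (intro mult_right_mono) auto
    then show ?case by (simp add: algebra_simps)
  qed
  from acd_mono[OF d this xy] have "E y * exp (- m y) \<le> E x * exp (- m x)" by simp
  then have "E y * exp (- m y) * exp (m y) \<le> E x * exp (- m x) * exp (m y)" by (intro mult_right_mono) auto
  then show ?thesis by (simp add: mult.assoc exp_add[symmetric])
qed

text \<open>The forward estimate for \<open>- E\<close> and \<open>- m\<close>. It carries bounds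
  from the right end of an interval to its left end.\<close>

lemma acd_Gronwall_backward:
  fixes E :: "real \<Rightarrow> real"
  assumes E: "acd E E'" and k: "acd m k" and le: "AE x in M01. - k x * E x \<le> E' x"
    and xy: "0 \<le> x" "x \<le> y" "y \<le> 1"
  shows "E x * exp (m x - m y) \<le> E y"
proof -
  have "acd (\<lambda>x. - E x) (\<lambda>x. - E' x)" "acd (\<lambda>x. - m x) (\<lambda>x. - k x)" by (intro acd_minus E k)+
  moreover have "AE x in M01. - E' x \<le> - k x * - E x" using le by eventually_elim simp
  ultimately have "- E y \<le> - E x * exp (- m y - - m x)" by (rule acd_Gronwall) (use xy in auto)
  then show ?thesis by simp
qed

section \<open>Linear systems with integrable coefficients\<close>

text \<open>Because the right-hand side is \<open>l\<close> times a fixed matrix, the iterated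
  integrals \<open>A k\<close>, \<open>B k\<close> do not depend on \<open>l\<close> and are the
  Taylor coefficients of the solution in \<open>l\<close>. Holomorphy in the spectral parameter is
  then immediate.\<close>

locale linear_system =
  fixes n11 n12 n21 n22 :: "real \<Rightarrow> complex" and a0 b0 :: complex
  assumes int: "L1 n11" "L1 n12"
    "L1 n21" "L1 n22"
begin

primrec picard :: "nat \<Rightarrow> (real \<Rightarrow> complex) \<times> (real \<Rightarrow> complex)" where
  "picard 0 = (\<lambda>x. a0, \<lambda>x. b0)"
| "picard (Suc k) = (\<lambda>x. integral {0..x} (\<lambda>t. n11 t * fst (picard k) t + n12 t * snd (picard k) t),
    \<lambda>x. integral {0..x} (\<lambda>t. n21 t * fst (picard k) t + n22 t * snd (picard k) t))"

abbreviation "A k \<equiv> fst (picard k)"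
abbreviation "B k \<equiv> snd (picard k)"

definition "wt t = norm (n11 t) + norm (n12 t) + norm (n21 t) + norm (n22 t)"
definition "Wt x = integral {0..x} wt"
definition "K = norm a0 + norm b0"
definition "sol1 l x = (\<Sum>k. l ^ k * A k x)"
definition "sol2 l x = (\<Sum>k. l ^ k * B k x)"

lemma wt_int: "L1 wt"
  unfolding wt_def by (intro set_integral_add absolutely_integrable_norm[unfolded o_def] int)

lemma acd_Wt: "acd Wt wt"
  by (rule acd_integralI[OF wt_int, of _ 0]) (simp add: Wt_def)

lemma Wt_0: "Wt 0 = 0" by (simp add: Wt_def)

lemma wt_nonneg: "0 \<le> wt t" by (simp add: wt_def)

lemma row_int:
  fixes p q u w :: "real \<Rightarrow> complex"
  assumes "L1 p" "L1 q"
    "continuous_on {0..1} u" "continuous_on {0..1} w"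
  shows "L1 (\<lambda>t. p t * u t + q t * w t)"
  using set_integral_add(1)[OF absolutely_integrable_continuous_mult[OF assms(3,1)] absolutely_integrable_continuous_mult[OF assms(4,2)]]
  by (simp add: mult.commute)

lemma picard_continuous: "continuous_on {0..1} (A k)" "continuous_on {0..1} (B k)"
proof (induction k)
  case (Suc k)
  have "acd (A (Suc k)) (\<lambda>t. n11 t * A k t + n12 t * B k t)"
    by (rule acd_integralI[of _ _ 0]) (use Suc row_int int in auto)
  moreover have "acd (B (Suc k)) (\<lambda>t. n21 t * A k t + n22 t * B k t)"
    by (rule acd_integralI[of _ _ 0]) (use Suc row_int int in auto)
  ultimately show "continuous_on {0..1} (A (Suc k))" "continuous_on {0..1} (B (Suc k))"
    by (auto dest: acd_continuous)
qed auto

text \<open>The weight \<open>exp (c * Wt t)\<close> absorbs one integration exactly, since its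
  derivative is \<open>c * wt t\<close> times itself; each iteration gains a factor
  \<open>1 / c\<close>. As \<open>c\<close> is free, this takes the place of the factorial estimate
  for iterated integrals.\<close>

lemma row_bound:
  assumes pq: "L1 p" "L1 q" "\<And>t. norm (p t) + norm (q t) \<le> wt t"
    and c: "0 < c" and x: "x \<in> {0..1}"
    and IH: "\<And>t. t \<in> {0..1} \<Longrightarrow> norm (A k t) \<le> K * exp (c * Wt t) / c ^ k" "\<And>t. t \<in> {0..1} \<Longrightarrow> norm (B k t) \<le> K * exp (c * Wt t) / c ^ k"
  shows "norm (integral {0..x} (\<lambda>t. p t * A k t + q t * B k t)) \<le> K * exp (c * Wt x) / c ^ Suc k"
proof -
  let ?g = "\<lambda>t. K / c ^ Suc k * (exp (c * Wt t) * (c * wt t))"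
  have "acd (\<lambda>t. exp (c * Wt t)) (\<lambda>t. exp (c * Wt t) * (c * wt t))"
    by (intro acd_exp acd_cmult acd_Wt)
  from acd_has_integral(2)[OF this x]
  have g: "(?g has_integral K / c ^ Suc k * (exp (c * Wt x) - 1)) {0..x}"
    by (intro has_integral_mult_right) (simp add: Wt_0)
  have "norm (integral {0..x} (\<lambda>t. p t * A k t + q t * B k t)) \<le> integral {0..x} ?g"
  proof (rule integral_norm_bound_integral)
    have "(\<lambda>t. p t * A k t + q t * B k t) integrable_on {0..1}"
      using row_int[OF pq(1,2) picard_continuous] by (simp add: absolutely_integrable_on_def)
    then show "(\<lambda>t. p t * A k t + q t * B k t) integrable_on {0..x}"
      using x by (auto intro: integrable_on_subinterval)
    show "?g integrable_on {0..x}" using g by blast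
    fix t assume t: "t \<in> {0..x}"
    let ?\<beta> = "K * exp (c * Wt t) / c ^ k"
    have "norm (p t * A k t + q t * B k t) \<le> norm (p t) * norm (A k t) + norm (q t) * norm (B k t)"
      by (metis norm_mult norm_triangle_ineq)
    also have "\<dots> \<le> norm (p t) * ?\<beta> + norm (q t) * ?\<beta>"
      using t x IH by (intro add_mono mult_left_mono) auto
    also have "\<dots> \<le> wt t * ?\<beta>"
      unfolding distrib_right[symmetric] using pq(3) c by (intro mult_right_mono) (auto simp: K_def)
    also have "\<dots> = ?g t" using c by simp
    finally show "norm (p t * A k t + q t * B k t) \<le> ?g t" .
  qed
  also have "\<dots> = K / c ^ Suc k * (exp (c * Wt x) - 1)" by (rule integral_unique[OF g])
  also have "\<dots> \<le> K / c ^ Suc k * exp (c * Wt x)"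
    using c by (intro mult_left_mono) (auto simp: K_def)
  finally show ?thesis by simp
qed

lemma picard_bound:
  assumes c: "0 < c" and x: "x \<in> {0..1}"
  shows "norm (A k x) \<le> K * exp (c * Wt x) / c ^ k" "norm (B k x) \<le> K * exp (c * Wt x) / c ^ k"
proof -
  have "\<forall>x\<in>{0..1}. norm (A k x) \<le> K * exp (c * Wt x) / c ^ k \<and> norm (B k x) \<le> K * exp (c * Wt x) / c ^ k"
  proof (induction k)
    case 0
    show ?case
    proof
      fix x :: real assume x: "x \<in> {0..1}"
      have "0 \<le> Wt x" using acd_mono[OF acd_Wt, of 0 x] wt_nonneg x by (auto simp: Wt_0)
      then have "1 \<le> exp (c * Wt x)" using c by simp
      then have "K * 1 \<le> K * exp (c * Wt x)" by (intro mult_left_mono) (auto simp: K_def)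
      moreover have "norm a0 \<le> K" "norm b0 \<le> K" by (auto simp: K_def)
      ultimately show "norm (A 0 x) \<le> K * exp (c * Wt x) / c ^ 0 \<and> norm (B 0 x) \<le> K * exp (c * Wt x) / c ^ 0"
        by auto
    qed
  next
    case (Suc k)
    show ?case
    proof
      fix x :: real assume x: "x \<in> {0..1}"
      have "norm (n11 t) + norm (n12 t) \<le> wt t" "norm (n21 t) + norm (n22 t) \<le> wt t" for t
        by (auto simp: wt_def)
      then show "norm (A (Suc k) x) \<le> K * exp (c * Wt x) / c ^ Suc k \<and> norm (B (Suc k) x) \<le> K * exp (c * Wt x) / c ^ Suc k"
        using row_bound[OF int(1,2) _ c x, of k] row_bound[OF int(3,4) _ c x, of k] Suc by simp
    qed
  qed
  then show "norm (A k x) \<le> K * exp (c * Wt x) / c ^ k" "norm (B k x) \<le> K * exp (c * Wt x) / c ^ k"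
    using x by auto
qed

text \<open>With \<open>c = 2 * norm l + 1\<close> the ratio \<open>norm l / c\<close> is at most
  1/2, so the series is dominated by a geometric one uniformly in \<open>x\<close>; the summand 1
  keeps \<open>c\<close> positive at \<open>l = 0\<close>.\<close>

lemma term_bound:
  fixes l :: complex
  assumes x: "x \<in> {0..1}"
  defines "M \<equiv> K * exp ((2 * norm l + 1) * Wt 1)"
  shows "norm (l ^ k * A k x) \<le> M * (1/2) ^ k" "norm (l ^ k * B k x) \<le> M * (1/2) ^ k"
proof -
  let ?c = "2 * norm l + 1"
  have c: "0 < ?c" by (simp add: add_nonneg_pos)
  have "Wt x \<le> Wt 1" using acd_mono[OF acd_Wt, of x 1] wt_nonneg x by auto
  then have "?c * Wt x \<le> ?c * Wt 1" using c by (intro mult_left_mono) auto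
  then have "K * exp (?c * Wt x) \<le> M" unfolding M_def by (intro mult_left_mono) (auto simp: K_def)
  moreover have "norm l ^ k \<le> (?c * (1/2)) ^ k" by (intro power_mono) auto
  ultimately have *: "norm l ^ k * (K * exp (?c * Wt x) / ?c ^ k) \<le> M * (1/2) ^ k"
  proof -
    assume 1: "K * exp (?c * Wt x) \<le> M" and 2: "norm l ^ k \<le> (?c * (1/2)) ^ k"
    have "norm l ^ k * (K * exp (?c * Wt x) / ?c ^ k) \<le> (?c * (1/2)) ^ k * (M / ?c ^ k)"
      using 1 2 c by (intro mult_mono divide_right_mono) (auto simp: K_def)
    also have "\<dots> = M * (1/2) ^ k" using c by (simp add: power_mult_distrib power_divide field_simps)
    finally show ?thesis .
  qed
  show "norm (l ^ k * A k x) \<le> M * (1/2) ^ k" "norm (l ^ k * B k x) \<le> M * (1/2) ^ k"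
    using mult_left_mono[OF picard_bound(1)[OF c x, of k], of "norm l ^ k"]
      mult_left_mono[OF picard_bound(2)[OF c x, of k], of "norm l ^ k"] *
    by (auto simp: norm_mult norm_power)
qed

lemma sol_sums:
  assumes x: "x \<in> {0..1}"
  shows "(\<lambda>k. l ^ k * A k x) sums sol1 l x" "(\<lambda>k. l ^ k * B k x) sums sol2 l x"
proof -
  have s: "summable (\<lambda>k. C * (1/2) ^ k)" for C :: real by (intro summable_mult summable_geometric) auto
  show "(\<lambda>k. l ^ k * A k x) sums sol1 l x" "(\<lambda>k. l ^ k * B k x) sums sol2 l x"
    unfolding sol1_def sol2_def
    by (rule summable_sums, rule summable_comparison_test'[OF s, of 0], rule term_bound[OF x])+
qed

lemma power_series_entire:
  fixes a :: "nat \<Rightarrow> complex"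
  assumes "\<And>w. (\<lambda>n. w ^ n * a n) sums f w"
  shows "f holomorphic_on UNIV"
proof -
  have "f holomorphic_on ball 0 r" for r
    by (rule power_series_holomorphic[of 0 r a]) (use assms in \<open>simp add: mult.commute\<close>)
  then have "f field_differentiable at z" for z
    by (rule holomorphic_on_imp_differentiable_at[of _ "ball 0 (norm z + 1)"]) auto
  then show ?thesis by (simp add: holomorphic_on_def)
qed

lemma sol_holomorphic:
  assumes x: "x \<in> {0..1}"
  shows "(\<lambda>l. sol1 l x) holomorphic_on UNIV" "(\<lambda>l. sol2 l x) holomorphic_on UNIV"
  by (rule power_series_entire, rule sol_sums[OF x])+

text \<open>Dominated convergence of the partial sums, with \<open>S k\<close> standing for
  \<open>A k x\<close> or \<open>B k x\<close>. Integration raises the index and the power of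
  \<open>l\<close> by one, so the zeroth term, which is the initial value, is subtracted from the
  sum.\<close>

lemma row_has_integral:
  assumes pq: "L1 p" "L1 q" "\<And>t. norm (p t) + norm (q t) \<le> wt t"
    and x: "x \<in> {0..1}"
    and S: "\<And>k. S (Suc k) = integral {0..x} (\<lambda>t. p t * A k t + q t * B k t)"
    and s: "(\<lambda>k. l ^ k * S k) sums s"
  shows "((\<lambda>t. l * (p t * sol1 l t + q t * sol2 l t)) has_integral (s - S 0)) {0..x}"
proof (rule has_integral_dominated_convergence)
  let ?f = "\<lambda>N t. l * (p t * (\<Sum>k<N. l ^ k * A k t) + q t * (\<Sum>k<N. l ^ k * B k t))"
  let ?y = "\<lambda>N. \<Sum>k<N. l ^ Suc k * S (Suc k)"
  let ?M = "K * exp ((2 * norm l + 1) * Wt 1)"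
  show "(?f N has_integral ?y N) {0..x}" for N
  proof -
    have "((\<lambda>t. p t * A k t + q t * B k t) has_integral S (Suc k)) {0..x}" for k
    proof -
      have "(\<lambda>t. p t * A k t + q t * B k t) integrable_on {0..1}"
        using row_int[OF pq(1,2) picard_continuous] by (simp add: absolutely_integrable_on_def)
      then have "(\<lambda>t. p t * A k t + q t * B k t) integrable_on {0..x}"
        using x by (auto intro: integrable_on_subinterval)
      then show ?thesis unfolding S by (rule integrable_integral)
    qed
    then have "((\<lambda>t. \<Sum>k<N. l ^ Suc k * (p t * A k t + q t * B k t)) has_integral ?y N) {0..x}"
      by (intro has_integral_sum has_integral_mult_right) auto
    moreover have "(\<Sum>k<N. l ^ Suc k * (p t * A k t + q t * B k t)) = ?f N t" for t
      by (simp add: sum_distrib_left sum.distrib[symmetric] algebra_simps)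
    ultimately show ?thesis by simp
  qed
  have wi: "wt integrable_on {0..x}"
    using wt_int x by (auto simp: absolutely_integrable_on_def intro: integrable_on_subinterval)
  show "(\<lambda>t. norm l * (2 * ?M) * wt t) integrable_on {0..x}"
    using integrable_on_cmult_left[OF wi, of "norm l * (2 * ?M)"] by simp
  show "\<forall>t\<in>{0..x}. norm (?f N t) \<le> norm l * (2 * ?M) * wt t" for N
  proof
    fix t assume "t \<in> {0..x}"
    then have t: "t \<in> {0..1}" using x by auto
    have geo: "(\<Sum>k<N. ?M * (1/2) ^ k) \<le> 2 * ?M"
    proof -
      have "(\<Sum>k<N. (1/2) ^ k :: real) \<le> (\<Sum>k. (1/2) ^ k)"
        by (intro sum_le_suminf summable_geometric) auto
      also have "\<dots> = 2" using suminf_geometric[of "1/2::real"] by simp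
      finally have "?M * (\<Sum>k<N. (1/2) ^ k) \<le> ?M * 2" by (intro mult_left_mono) (auto simp: K_def)
      then show ?thesis unfolding sum_distrib_left[symmetric] by (simp only: mult.commute)
    qed
    have b: "norm (\<Sum>k<N. l ^ k * A k t) \<le> 2 * ?M" "norm (\<Sum>k<N. l ^ k * B k t) \<le> 2 * ?M"
      using order_trans[OF sum_norm_le[OF term_bound(1)[OF t]] geo] order_trans[OF sum_norm_le[OF term_bound(2)[OF t]] geo] by auto
    have "norm (?f N t) \<le> norm l * (norm (p t) * norm (\<Sum>k<N. l ^ k * A k t) + norm (q t) * norm (\<Sum>k<N. l ^ k * B k t))"
      unfolding norm_mult by (intro mult_left_mono order_trans[OF norm_triangle_ineq]) (auto simp: norm_mult)
    also have "\<dots> \<le> norm l * (norm (p t) * (2 * ?M) + norm (q t) * (2 * ?M))"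
      using b by (intro mult_left_mono add_mono) auto
    also have "\<dots> = norm l * (2 * ?M) * (norm (p t) + norm (q t))" by (simp add: algebra_simps)
    also have "\<dots> \<le> norm l * (2 * ?M) * wt t" using pq(3) by (intro mult_left_mono) (auto simp: K_def)
    finally show "norm (?f N t) \<le> norm l * (2 * ?M) * wt t" .
  qed
  show "\<forall>t\<in>{0..x}. (\<lambda>N. ?f N t) \<longlonglongrightarrow> l * (p t * sol1 l t + q t * sol2 l t)"
  proof
    fix t assume "t \<in> {0..x}"
    then have t: "t \<in> {0..1}" using x by auto
    show "(\<lambda>N. ?f N t) \<longlonglongrightarrow> l * (p t * sol1 l t + q t * sol2 l t)"
      by (intro tendsto_intros sol_sums[OF t, unfolded sums_def])
  qed
  have "(\<lambda>k. l ^ Suc k * S (Suc k)) sums (s - l ^ 0 * S 0)"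
    using s by (subst sums_Suc_iff) simp
  then show "?y \<longlonglongrightarrow> s - S 0" unfolding sums_def by simp
qed

lemma sol_at_0: "sol1 l 0 = a0" "sol2 l 0 = b0"
proof -
  have "A k 0 = (if k = 0 then a0 else 0)" "B k 0 = (if k = 0 then b0 else 0)" for k
    by (cases k; simp)+
  then have "(\<lambda>k. l ^ k * A k 0) = (\<lambda>k. if k = 0 then a0 else 0)" "(\<lambda>k. l ^ k * B k 0) = (\<lambda>k. if k = 0 then b0 else 0)"
    by auto
  then have "(\<lambda>k. if k = 0 then a0 else 0) sums sol1 l 0" "(\<lambda>k. if k = 0 then b0 else 0) sums sol2 l 0"
    using sol_sums[of 0 l] by simp_all
  then show "sol1 l 0 = a0" "sol2 l 0 = b0"
    using sums_single[of 0 "\<lambda>_. a0"] sums_single[of 0 "\<lambda>_. b0"] by (auto dest: sums_unique2)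
qed

lemma sol_acd:
  "acd (sol1 l) (\<lambda>t. l * (n11 t * sol1 l t + n12 t * sol2 l t))"
  "acd (sol2 l) (\<lambda>t. l * (n21 t * sol1 l t + n22 t * sol2 l t))"
proof -
  let ?f1 = "\<lambda>t. l * (n11 t * sol1 l t + n12 t * sol2 l t)" and ?f2 = "\<lambda>t. l * (n21 t * sol1 l t + n22 t * sol2 l t)"
  have hi: "(?f1 has_integral (sol1 l x - a0)) {0..x}" "(?f2 has_integral (sol2 l x - b0)) {0..x}" if x: "x \<in> {0..1}" for x
    using row_has_integral[OF int(1,2) _ x, of "\<lambda>k. A k x" l "sol1 l x"] row_has_integral[OF int(3,4) _ x, of "\<lambda>k. B k x" l "sol2 l x"]
      sol_sums[OF x] by (auto simp: wt_def)
  have eq: "sol1 l x = a0 + integral {0..x} ?f1" "sol2 l x = b0 + integral {0..x} ?f2" if x: "x \<in> {0..1}" for x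
    using integral_unique[OF hi(1)[OF x]] integral_unique[OF hi(2)[OF x]] by simp_all
  \<comment> \<open>So far the right-hand sides are only known to be integrable. Their indefinite
    integrals are continuous, hence so are the solutions, and this in turn makes the right-hand
    sides absolutely integrable.\<close>
  have i: "?f1 integrable_on {0..1}" "?f2 integrable_on {0..1}" using hi[of 1] by (auto intro: has_integral_integrable)
  have cc: "continuous_on {0..1} (\<lambda>x. a0 + integral {0..x} ?f1)" "continuous_on {0..1} (\<lambda>x. b0 + integral {0..x} ?f2)"
    by (rule continuous_on_add[OF continuous_on_const indefinite_integral_continuous_1], rule i)+
  have "continuous_on {0..1} (sol1 l)"
    by (rule continuous_on_eq[OF cc(1)], rule eq(1)[symmetric], assumption)
  moreover have "continuous_on {0..1} (sol2 l)"
    by (rule continuous_on_eq[OF cc(2)], rule eq(2)[symmetric], assumption)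
  ultimately have c: "continuous_on {0..1} (sol1 l)" "continuous_on {0..1} (sol2 l)" .
  have "L1 ?f1" "L1 ?f2"
    using row_int[OF int(1,2) c] row_int[OF int(3,4) c] by (auto intro: set_integrable_mult_right)
  then show "acd (sol1 l) ?f1" "acd (sol2 l) ?f2" using eq by (auto intro: acd_integralI)
qed

end

lemma exists_linear_system_solution:
  fixes n11 n12 n21 n22 :: "real \<Rightarrow> complex"
  assumes "L1 n11" "L1 n12"
    "L1 n21" "L1 n22"
  shows "\<exists>a b. (\<forall>l. acd (a l) (\<lambda>t. l * (n11 t * a l t + n12 t * b l t))) \<and>
    (\<forall>l. acd (b l) (\<lambda>t. l * (n21 t * a l t + n22 t * b l t))) \<and>
    (\<forall>l. a l 0 = a0) \<and> (\<forall>l. b l 0 = b0) \<and>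
    (\<forall>x\<in>{0..1}. (\<lambda>l. a l x) holomorphic_on UNIV) \<and> (\<forall>x\<in>{0..1}. (\<lambda>l. b l x) holomorphic_on UNIV)"
proof -
  interpret linear_system n11 n12 n21 n22 a0 b0 by unfold_locales (fact assms)+
  show ?thesis
    by (rule exI[of _ sol1], rule exI[of _ sol2]) (intro conjI allI ballI sol_acd sol_at_0 sol_holomorphic)
qed

section \<open>Quasi-derivatives\<close>

lemma borel_measurable_M01: "L1 f \<Longrightarrow> f \<in> borel_measurable M01"
  for f :: "real \<Rightarrow> 'a::euclidean_space"
  unfolding integrable_M01_iff[symmetric] by (rule borel_measurable_integrable)

lemma const_integrable_M01: "integrable M01 (\<lambda>x. c :: real)"
  unfolding integrable_M01_iff by (rule absolutely_integrable_continuous_real) auto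

lemma L2_iff:
  fixes f :: "real \<Rightarrow> 'a::euclidean_space"
  shows "f \<in> L2 \<longleftrightarrow> L1 f \<and> L1 (\<lambda>x. (norm (f x))\<^sup>2)"
proof
  assume f: "f \<in> L2"
  have fm: "f \<in> borel_measurable M01" and f2: "integrable M01 (\<lambda>x. (norm (f x))\<^sup>2)" using f by (auto simp: L2_def)
  have "integrable M01 f"
  proof (rule Bochner_Integration.integrable_bound[OF Bochner_Integration.integrable_add[OF const_integrable_M01[of 1] f2] fm])
    show "AE x in M01. norm (f x) \<le> norm (1 + (norm (f x))\<^sup>2)"
    proof (rule AE_I2)
      fix x
      have "0 \<le> (norm (f x) - 1)\<^sup>2" by simp
      then have "2 * norm (f x) \<le> 1 + (norm (f x))\<^sup>2" by (simp add: power2_diff)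
      then have "norm (f x) \<le> 1 + (norm (f x))\<^sup>2" using norm_ge_zero[of "f x"] by linarith
      then show "norm (f x) \<le> norm (1 + (norm (f x))\<^sup>2)" by simp
    qed
  qed
  then show "L1 f \<and> L1 (\<lambda>x. (norm (f x))\<^sup>2)"
    using f2 by (simp add: integrable_M01_iff)
next
  assume "L1 f \<and> L1 (\<lambda>x. (norm (f x))\<^sup>2)"
  then show "f \<in> L2"
    unfolding L2_def mem_Collect_eq integrable_M01_iff by (intro conjI borel_measurable_M01) blast+
qed

lemma L2_AE_cong:
  fixes f g :: "real \<Rightarrow> 'a::euclidean_space"
  assumes "f \<in> L2" "AE x in M01. f x = g x"
  shows "g \<in> L2"
proof -
  have "AE x in M01. (norm (f x))\<^sup>2 = (norm (g x))\<^sup>2" using assms(2) by eventually_elim simp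
  then show ?thesis using assms absolutely_integrable_AE_cong[of "\<lambda>x. (norm (f x))\<^sup>2"] absolutely_integrable_AE_cong[of f g] unfolding L2_iff by simp
qed

lemma L2_bound:
  fixes f :: "real \<Rightarrow> 'a::euclidean_space" and g :: "real \<Rightarrow> real"
  assumes f: "L1 f" and g: "g \<in> L2"
    and le: "\<And>x. x \<in> {0<..<1} \<Longrightarrow> norm (f x) \<le> C * (1 + \<bar>g x\<bar>)"
  shows "f \<in> L2"
proof -
  have g2: "integrable M01 (\<lambda>x. (norm (g x))\<^sup>2)" using g by (simp add: L2_def)
  have i: "integrable M01 (\<lambda>x. 2 * C\<^sup>2 * (1 + (norm (g x))\<^sup>2))"
    by (intro integrable_mult_right Bochner_Integration.integrable_add const_integrable_M01 g2)
  have "integrable M01 (\<lambda>x. (norm (f x))\<^sup>2)"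
  proof (rule Bochner_Integration.integrable_bound[OF i])
    show "(\<lambda>x. (norm (f x))\<^sup>2) \<in> borel_measurable M01" using borel_measurable_M01[OF f] by measurable
    show "AE x in M01. norm ((norm (f x))\<^sup>2) \<le> norm (2 * C\<^sup>2 * (1 + (norm (g x))\<^sup>2))"
    proof (rule AE_M01_I)
      fix x :: real assume "0 < x" "x < 1"
      then have "(norm (f x))\<^sup>2 \<le> (C * (1 + \<bar>g x\<bar>))\<^sup>2" using le by (intro power_mono) auto
      also have "\<dots> = C\<^sup>2 * (1 + \<bar>g x\<bar>)\<^sup>2" by (simp add: power_mult_distrib)
      also have "\<dots> \<le> C\<^sup>2 * (2 * (1 + (g x)\<^sup>2))"
      proof (rule mult_left_mono)
        show "(1 + \<bar>g x\<bar>)\<^sup>2 \<le> 2 * (1 + (g x)\<^sup>2)"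
          using zero_le_power2[of "1 - \<bar>g x\<bar>"] by (simp add: power2_eq_square algebra_simps)
      qed simp
      finally show "norm ((norm (f x))\<^sup>2) \<le> norm (2 * C\<^sup>2 * (1 + (norm (g x))\<^sup>2))"
        by (simp add: algebra_simps)
    qed
  qed
  then show ?thesis using f by (simp add: L2_iff integrable_M01_iff)
qed

lemma L2_realD:
  fixes r :: "real \<Rightarrow> real"
  assumes "r \<in> L2"
  shows "L1 r" "L1 (\<lambda>x. (r x)\<^sup>2)"
  using assms by (auto simp: L2_iff)

lemma absolutely_integrable_of_real:
  fixes f :: "real \<Rightarrow> real"
  assumes "L1 f"
  shows "L1 (\<lambda>x. complex_of_real (f x))"
  using integrable_of_real[where 'a = complex, of M01 f] assms by (simp add: integrable_M01_iff[symmetric])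

text \<open>The indefinite integral of \<open>f\<close> vanishes, hence so does its derivative, also
  at the end points. This turns a.e. identities for quasi-derivatives into values at 0 and
  1.\<close>

lemma continuous_AE_zero:
  fixes f :: "real \<Rightarrow> 'a::euclidean_space"
  assumes f: "continuous_on {0..1} f" and ae: "AE x in M01. f x = 0" and x: "x \<in> {0..1}"
  shows "f x = 0"
proof -
  have "AE x in M01. 0 = f x" using ae by eventually_elim simp
  then have "(f has_integral 0) {0..u}" if "u \<in> {0..1}" for u
    using has_integral_AE_cong[OF has_integral_0] that by auto
  then have eq: "integral {0..u} f = 0" if "u \<in> {0..1}" for u using that by blast
  have "((\<lambda>u. integral {0..u} f) has_vector_derivative f x) (at x within {0..1})"
    by (rule integral_has_vector_derivative[OF f x])
  moreover have "((\<lambda>u. integral {0..u} f) has_vector_derivative 0) (at x within {0..1})"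
    by (rule has_vector_derivative_transform[OF x _ has_vector_derivative_const[of 0]]) (use eq in auto)
  ultimately show ?thesis using x by (intro vector_derivative_unique_within_closed_interval[of 0 1 x]) auto
qed

lemma continuous_AE_eq:
  fixes f g :: "real \<Rightarrow> 'a::euclidean_space"
  assumes "continuous_on {0..1} f" "continuous_on {0..1} g" "AE x in M01. f x = g x" "x \<in> {0..1}"
  shows "f x = g x"
proof -
  have "AE x in M01. f x - g x = 0" using assms(3) by eventually_elim simp
  from continuous_AE_zero[OF continuous_on_diff[OF assms(1,2)] this assms(4)] show ?thesis by simp
qed

section \<open>The differential expression as a first-order system\<close>

lemma acd_vector_derivative:
  fixes f :: "real \<Rightarrow> 'a::euclidean_space"
  assumes "absolutely_continuous_on {0..1} f"
  shows "acd f (\<lambda>x. vector_derivative f (at x))"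
proof -
  obtain g where g: "acd f g" using absolutely_continuous_imp_acd[OF assms] by blast
  have "AE x in M01. g x = vector_derivative f (at x)"
    using acdD(2)[OF g] by eventually_elim (simp add: vector_derivative_at)
  then show ?thesis by (rule acd_cong[OF g refl])
qed

lemma is_quasi_deriv_imp_acd:
  assumes "absolutely_continuous_on {0..1} y" "is_quasi_deriv r y w"
  shows "acd y (\<lambda>x. of_real (r x) * y x + w x)"
proof (rule acd_cong[OF acd_vector_derivative[OF assms(1)] refl])
  show "AE x in M01. vector_derivative y (at x) = of_real (r x) * y x + w x"
    using assms(2) unfolding is_quasi_deriv_def by (auto elim: eventually_mono)
qed

lemma acd_imp_is_quasi_deriv:
  assumes "acd y (\<lambda>x. of_real (r x) * y x + w x)" "absolutely_continuous_on {0..1} w"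
  shows "is_quasi_deriv r y w"
  unfolding is_quasi_deriv_def
proof
  show "AE x in M01. w x = vector_derivative y (at x) - of_real (r x) * y x"
    using acdD(2)[OF assms(1)] by eventually_elim (simp add: vector_derivative_at)
qed fact

lemma is_quasi_deriv_unique:
  assumes "is_quasi_deriv r y w" "is_quasi_deriv r y w'" "x \<in> {0..1}"
  shows "w x = w' x"
proof (rule continuous_AE_eq[OF _ _ _ assms(3)])
  show "continuous_on {0..1} w" "continuous_on {0..1} w'"
    using assms absolutely_continuous_on_imp_continuous_on by (auto simp: is_quasi_deriv_def)
  show "AE x in M01. w x = w' x"
    using assms(1,2) unfolding is_quasi_deriv_def by (auto elim: eventually_elim2)
qed

text \<open>Together with its converse below this replaces \<ell> by the system
  \<open>y' = r y + w\<close>, \<open>w' = - r w - r^2 y - \<ell>(y)\<close>, whose coefficients are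
  integrable when \<open>r\<close> lies in \<open>L2\<close>.\<close>

lemma dom_ell_acd:
  assumes "y \<in> dom_ell r"
  shows "acd y (\<lambda>x. of_real (r x) * y x + quasi_deriv r y x)"
    "acd (quasi_deriv r y) (\<lambda>x. - of_real (r x) * quasi_deriv r y x - (of_real (r x))\<^sup>2 * y x - ell r y x)"
proof -
  have y: "absolutely_continuous_on {0..1} y" and ex: "\<exists>u. is_quasi_deriv r y u"
    using assms by (auto simp: dom_ell_def)
  have q: "is_quasi_deriv r y (quasi_deriv r y)" unfolding quasi_deriv_def by (rule someI_ex[OF ex])
  show "acd y (\<lambda>x. of_real (r x) * y x + quasi_deriv r y x)"
    by (rule is_quasi_deriv_imp_acd[OF y q])
  have "absolutely_continuous_on {0..1} (quasi_deriv r y)" using q by (simp add: is_quasi_deriv_def)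
  from acd_vector_derivative[OF this]
  show "acd (quasi_deriv r y) (\<lambda>x. - of_real (r x) * quasi_deriv r y x - (of_real (r x))\<^sup>2 * y x - ell r y x)"
    by (simp add: ell_def)
qed

text \<open>Although \<open>quasi_deriv\<close> is a choice, any two absolutely continuous
  representatives agree on \<open>{0..1}\<close>, so the given \<open>w\<close> identifies it there;
  \<open>e\<close> then identifies \<open>ell r y\<close> almost everywhere.\<close>

lemma acd_imp_dom_ell:
  assumes y: "acd y (\<lambda>x. of_real (r x) * y x + w x)"
    and w: "acd w (\<lambda>x. - of_real (r x) * w x - (of_real (r x))\<^sup>2 * y x - e x)"
    and e: "e \<in> L2"
  shows "y \<in> dom_ell r" "AE x in M01. ell r y x = e x" "\<And>x. x \<in> {0..1} \<Longrightarrow> quasi_deriv r y x = w x"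
proof -
  have q: "is_quasi_deriv r y w" by (rule acd_imp_is_quasi_deriv[OF y acdD(1)[OF w]])
  have q': "is_quasi_deriv r y (quasi_deriv r y)" unfolding quasi_deriv_def by (rule someI[of "is_quasi_deriv r y", OF q])
  show eq: "\<And>x. x \<in> {0..1} \<Longrightarrow> quasi_deriv r y x = w x" by (rule is_quasi_deriv_unique[OF q' q])
  have "acd (quasi_deriv r y) (\<lambda>x. - of_real (r x) * w x - (of_real (r x))\<^sup>2 * y x - e x)"
    by (rule acd_cong[OF w]) (use eq in auto)
  from acdD(2)[OF this] AE_M01_mem
  show ell: "AE x in M01. ell r y x = e x"
  proof eventually_elim
    case (elim x)
    then show ?case using eq[of x] by (simp add: ell_def vector_derivative_at)
  qed
  have "AE x in M01. e x = ell r y x" using ell by eventually_elim simp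
  then have "ell r y \<in> L2" by (rule L2_AE_cong[OF e])
  then show "y \<in> dom_ell r" using acdD(1)[OF y] q by (auto simp: dom_ell_def)
qed

text \<open>The homogeneous case of the system, solved by the power series at \<open>l = 1\<close>;
  real parts are again solutions because the coefficients are real.\<close>

lemma exists_real_solution:
  fixes r :: "real \<Rightarrow> real"
  assumes r: "r \<in> L2"
  obtains y w where "acd y (\<lambda>x. r x * y x + w x)" "acd w (\<lambda>x. - r x * w x - (r x)\<^sup>2 * y x)" "y 0 = a" "w 0 = b"
proof -
  note ri = L2_realD[OF r]
  have one: "L1 (\<lambda>x::real. 1 :: real)"
    using const_integrable_M01[of 1] by (simp add: integrable_M01_iff)
  have neg: "L1 (\<lambda>x. - r x)" "L1 (\<lambda>x. - (r x)\<^sup>2)"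
    using ri by (auto simp: integrable_M01_iff[symmetric])
  from exists_linear_system_solution[OF absolutely_integrable_of_real[OF ri(1)] absolutely_integrable_of_real[OF one]
      absolutely_integrable_of_real[OF neg(2)] absolutely_integrable_of_real[OF neg(1)], of "of_real a" "of_real b"]
  obtain Y W :: "complex \<Rightarrow> real \<Rightarrow> complex" where YW0:
    "\<forall>l. acd (Y l) (\<lambda>x. l * (of_real (r x) * Y l x + of_real 1 * W l x))"
    "\<forall>l. acd (W l) (\<lambda>x. l * (of_real (- (r x)\<^sup>2) * Y l x + of_real (- r x) * W l x))"
    "\<forall>l. Y l 0 = of_real a" "\<forall>l. W l 0 = of_real b"
    by (elim exE conjE)
  note YW = YW0[THEN spec, of 1]
  show ?thesis
  proof (rule that)
    have "acd (\<lambda>x. Re (Y 1 x)) (\<lambda>x. Re (1 * (of_real (r x) * Y 1 x + of_real 1 * W 1 x)))" by (rule acd_Re[OF YW(1)])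
    then show "acd (\<lambda>x. Re (Y 1 x)) (\<lambda>x. r x * Re (Y 1 x) + Re (W 1 x))" by simp
    have "acd (\<lambda>x. Re (W 1 x)) (\<lambda>x. Re (1 * (of_real (- (r x)\<^sup>2) * Y 1 x + of_real (- r x) * W 1 x)))" by (rule acd_Re[OF YW(2)])
    then show "acd (\<lambda>x. Re (W 1 x)) (\<lambda>x. - r x * Re (W 1 x) - (r x)\<^sup>2 * Re (Y 1 x))"
      by (rule acd_cong) (auto intro!: AE_M01_I)
    show "Re (Y 1 0) = a" "Re (W 1 0) = b" using YW(3,4) by auto
  qed
qed

lemma acd_local_strict_mono:
  fixes q :: "real \<Rightarrow> real"
  assumes q: "acd q q'" and cont: "continuous_on {0..1} q'" and x0: "x0 \<in> {0..1}" "0 < q' x0"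
  shows "\<exists>d>0. \<forall>x\<in>{0..1}. \<forall>y\<in>{0..1}. x0 - d < x \<longrightarrow> x < y \<longrightarrow> y < x0 + d \<longrightarrow> q x < q y"
proof -
  obtain d where d: "d > 0" "\<And>x. x \<in> {0..1} \<Longrightarrow> dist x x0 < d \<Longrightarrow> dist (q' x) (q' x0) < q' x0 / 2"
    using cont[unfolded continuous_on_iff, rule_format, OF x0(1), of "q' x0 / 2"] x0(2) by auto
  show ?thesis
  proof (intro exI[of _ d] conjI ballI impI d(1))
    fix x y assume xy: "x \<in> {0..1}" "y \<in> {0..1}" "x0 - d < x" "x < y" "y < x0 + d"
    have "(q' x0 / 2) * (y - x) \<le> q y - q x"
    proof (rule has_integral_le)
      show "((\<lambda>t. q' x0 / 2) has_integral (q' x0 / 2) * (y - x)) {x..y}"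
        using has_integral_const_real[of "q' x0 / 2" x y] xy by (simp add: mult.commute)
      show "(q' has_integral (q y - q x)) {x..y}" using xy by (intro acd_diff_eq[OF q]) auto
      fix t assume t: "t \<in> {x..y}"
      then have "dist (q' t) (q' x0) < q' x0 / 2" using xy by (intro d(2)) (auto simp: dist_real_def)
      then show "q' x0 / 2 \<le> q' t" by (auto simp: dist_real_def abs_if split: if_splits)
    qed
    moreover have "0 < (q' x0 / 2) * (y - x)" using x0 xy by simp
    ultimately show "q x < q y" by linarith
  qed
qed

section \<open>Factorization of positive operators\<close>

text \<open>
  $-y'' + r'y = -(\partial + v)(\partial - v)y$ with $v = r + h = \theta'$; the number $1/N$ becomes
  the norming constant of the Dirac system at its additional eigenvalue $0$.
\<close>

definition factorizes :: "(real \<Rightarrow> real) \<Rightarrow> real \<Rightarrow> (real \<Rightarrow> real) \<Rightarrow> (real \<Rightarrow> real) \<Rightarrow> bool" where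
  "factorizes r N h \<theta> \<longleftrightarrow> acd h (\<lambda>x. - (r x + h x)\<^sup>2) \<and> acd \<theta> (\<lambda>x. r x + h x) \<and> \<theta> 0 = 0 \<and>
    ((\<lambda>x. exp (- 2 * \<theta> x)) has_integral 1 / N) {0..1}"

text \<open>The functions \<open>s\<close> and \<open>c\<close> form the fundamental system of
  \<ell>y = 0, with quasi-derivatives \<open>sw\<close> and \<open>cw\<close>. As \<open>s\<close>
  satisfies the Dirichlet condition at 0, positivity of A is exploited through the zeros of
  \<open>s\<close>.\<close>

locale zero_energy =
  fixes r s sw c cw :: "real \<Rightarrow> real"
  assumes r: "r \<in> L2"
    and s: "acd s (\<lambda>x. r x * s x + sw x)" "acd sw (\<lambda>x. - r x * sw x - (r x)\<^sup>2 * s x)" "s 0 = 0" "sw 0 = 1"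
    and c: "acd c (\<lambda>x. r x * c x + cw x)" "acd cw (\<lambda>x. - r x * cw x - (r x)\<^sup>2 * c x)" "c 0 = 1" "cw 0 = 0"
    and pos: "A_positive r"
begin

lemma wronskian:
  assumes x: "x \<in> {0..1}"
  shows "sw x * c x - s x * cw x = 1"
proof -
  have "sw x * c x - s x * cw x = sw 0 * c 0 - s 0 * cw 0"
    by (rule acd_const_eq[OF acd_diff[OF acd_mult[OF s(2) c(1)] acd_mult[OF s(1) c(2)]] _ x])
      (auto intro!: AE_M01_I simp: algebra_simps power2_eq_square)
  then show ?thesis by (simp add: s c)
qed

lemma cont: "continuous_on {0..1} s" "continuous_on {0..1} sw" "continuous_on {0..1} c" "continuous_on {0..1} cw"
  using s c acd_continuous by blast+

lemma real_dom_A: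
  assumes y: "acd y (\<lambda>x. r x * y x + w x)" and w: "acd w (\<lambda>x. - r x * w x - (r x)\<^sup>2 * y x - e x)"
    and e: "L1 e" "\<And>x. \<bar>e x\<bar> \<le> C" and bc: "y 0 = 0" "y 1 = 0"
  shows "(\<lambda>x. complex_of_real (y x)) \<in> dom_A r" "AE x in M01. ell r (\<lambda>x. of_real (y x)) x = of_real (e x)"
proof -
  have "(\<lambda>x. complex_of_real (e x)) \<in> L2"
  proof (rule L2_bound[OF absolutely_integrable_of_real[OF e(1)] r])
    fix x
    have "0 \<le> C" using e(2)[of x] by simp
    then have "C * 1 \<le> C * (1 + \<bar>r x\<bar>)" by (intro mult_left_mono) auto
    then show "norm (complex_of_real (e x)) \<le> C * (1 + \<bar>r x\<bar>)" using e(2)[of x] by simp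
  qed
  moreover have "acd (\<lambda>x. complex_of_real (y x)) (\<lambda>x. of_real (r x) * of_real (y x) + of_real (w x))"
    using acd_linear[OF bounded_linear_of_real y] by simp
  moreover have "acd (\<lambda>x. complex_of_real (w x)) (\<lambda>x. - of_real (r x) * of_real (w x) - (of_real (r x))\<^sup>2 * of_real (y x) - of_real (e x))"
    using acd_linear[OF bounded_linear_of_real w] by simp
  ultimately show "(\<lambda>x. complex_of_real (y x)) \<in> dom_A r" "AE x in M01. ell r (\<lambda>x. of_real (y x)) x = of_real (e x)"
    using acd_imp_dom_ell[of "\<lambda>x. complex_of_real (y x)" r "\<lambda>x. of_real (w x)" "\<lambda>x. of_real (e x)"] bc
    by (auto simp: dom_A_def)
qed

lemma acd_zero:
  fixes y :: "real \<Rightarrow> real"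
  assumes y: "acd y (\<lambda>x. r x * y x + w x)" and w: "continuous_on {0..1} w" and z: "AE x in M01. y x = 0"
    and x: "x \<in> {0..1}"
  shows "y x = 0" "w x = 0"
proof -
  have y0: "y x = 0" if "x \<in> {0..1}" for x by (rule continuous_AE_zero[OF acd_continuous[OF y] z that])
  have "acd y (\<lambda>x. 0)" by (rule acd_cong[OF acd_const[of 0]]) (use y0 in auto)
  from acd_unique[OF y this] AE_M01_mem have "AE x in M01. w x = 0"
    by eventually_elim (use y0 in auto)
  from continuous_AE_zero[OF w this x] show "w x = 0" .
  show "y x = 0" by (rule y0[OF x])
qed

text \<open>A zero at 1 would put \<open>s\<close> into the domain of A with \<ell>s = 0, and the
  quadratic form would vanish at a nonzero element.\<close>

lemma s_1: "s 1 \<noteq> 0"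
proof
  assume 0: "s 1 = 0"
  have sw': "acd sw (\<lambda>x. - r x * sw x - (r x)\<^sup>2 * s x - 0)" using s(2) by simp
  have d: "(\<lambda>x. complex_of_real (s x)) \<in> dom_A r" "AE x in M01. ell r (\<lambda>x. of_real (s x)) x = of_real 0"
    by (rule real_dom_A[OF s(1) sw', of 0]; use s 0 in simp)+
  have nz: "\<not> (AE x in M01. complex_of_real (s x) = 0)"
  proof
    assume "AE x in M01. complex_of_real (s x) = 0"
    then have "AE x in M01. s x = 0" by simp
    from acd_zero(2)[OF s(1) cont(2) this, of 0] show False using s by simp
  qed
  have "L2_inner (ell r (\<lambda>x. of_real (s x))) (\<lambda>x. of_real (s x)) = 0"
    unfolding L2_inner_def by (rule integral_eq_zero_AE) (use d(2) in \<open>auto elim: eventually_mono\<close>)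
  then show False using pos[unfolded A_positive_def, rule_format, OF d(1) nz] by simp
qed

text \<open>
  Here $t = s(1) c - c(1) s$ vanishes at $1$, so up to a factor $s(1)t(x)s(y)$ with $y \le x$ is the Green
  function of $A$. If it were negative near a point of the diagonal, then $(Ay, y) < 0$ for the
  solution $y$ with an indicator function as right-hand side.
\<close>

lemma green_sign:
  assumes ab: "0 < a" "a < b" "b < 1" and \<sigma>: "\<sigma> = 1 \<or> \<sigma> = - 1"
    and sgn: "\<And>x. x \<in> {a..b} \<Longrightarrow> 0 < \<sigma> * s x" "\<And>x. x \<in> {a..b} \<Longrightarrow> \<sigma> * (s 1 * (s 1 * c x - c 1 * s x)) < 0"
  shows False
proof -
  define t where "t = (\<lambda>x. s 1 * c x - c 1 * s x)"
  define tw where "tw = (\<lambda>x. s 1 * cw x - c 1 * sw x)"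
  define f where "f = (\<lambda>x. indicat_real {a..b} x)"
  have t: "acd t (\<lambda>x. r x * t x + tw x)"
    by (rule acd_cong[OF acd_diff[OF acd_cmult[OF c(1), of "s 1"] acd_cmult[OF s(1), of "c 1"]]])
      (auto intro!: AE_M01_I simp: t_def tw_def algebra_simps)
  have tw: "acd tw (\<lambda>x. - r x * tw x - (r x)\<^sup>2 * t x)"
    by (rule acd_cong[OF acd_diff[OF acd_cmult[OF c(2), of "s 1"] acd_cmult[OF s(2), of "c 1"]]])
      (auto intro!: AE_M01_I simp: t_def tw_def algebra_simps)
  have t1: "t 1 = 0" by (simp add: t_def)
  have W: "sw x * t x - s x * tw x = s 1" if "x \<in> {0..1}" for x
  proof -
    have "sw x * t x - s x * tw x = s 1 * (sw x * c x - s x * cw x)" by (simp add: t_def tw_def algebra_simps)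
    then show ?thesis using wronskian[OF that] by simp
  qed
  have fi: "L1 f"
  proof -
    have "f integrable_on {0..1}"
      unfolding f_def using lmeasurable_cbox[of a b] ab by (simp add: integrable_on_indicator Int_absorb2)
    then show ?thesis by (rule nonnegative_absolutely_integrable_1) (simp add: f_def)
  qed
  have sfi: "L1 (\<lambda>x. s x * f x)" "L1 (\<lambda>x. t x * f x)"
    using absolutely_integrable_continuous_mult[OF _ fi] cont(1) acd_continuous[OF t] by auto
  \<comment> \<open>Variation of parameters: \<open>t * S + s * T\<close>, with \<open>S\<close>
    collecting the part left of \<open>x\<close> and \<open>T\<close> the part right of it, solves
    \<ell>y = s(1) f with both boundary conditions. The factor s(1) is the Wronskian of
    \<open>s\<close> and \<open>t\<close>; keeping it avoids a division.\<close>
  define S where "S = (\<lambda>x. integral {0..x} (\<lambda>x. s x * f x))"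
  define T where "T = (\<lambda>x. integral {0..1} (\<lambda>x. t x * f x) - integral {0..x} (\<lambda>x. t x * f x))"
  have S: "acd S (\<lambda>x. s x * f x)" by (rule acd_integralI[OF sfi(1), of _ 0]) (simp add: S_def)
  have T: "acd T (\<lambda>x. 0 - t x * f x)"
    unfolding T_def by (intro acd_diff acd_const acd_integralI[OF sfi(2), of _ 0]) simp
  define y where "y = (\<lambda>x. t x * S x + s x * T x)"
  define w where "w = (\<lambda>x. tw x * S x + sw x * T x)"
  have y: "acd y (\<lambda>x. r x * y x + w x)"
    unfolding y_def
    by (rule acd_cong[OF acd_add[OF acd_mult[OF t S] acd_mult[OF s(1) T]] refl])
      (auto intro!: AE_M01_I simp: w_def algebra_simps)
  have w: "acd w (\<lambda>x. - r x * w x - (r x)\<^sup>2 * y x - s 1 * f x)"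
    unfolding w_def
  proof (rule acd_cong[OF acd_add[OF acd_mult[OF tw S] acd_mult[OF s(2) T]] refl])
    show "AE x in M01. tw x * (s x * f x) + (- r x * tw x - (r x)\<^sup>2 * t x) * S x + (sw x * (0 - t x * f x) + (- r x * sw x - (r x)\<^sup>2 * s x) * T x) =
      - r x * (tw x * S x + sw x * T x) - (r x)\<^sup>2 * y x - s 1 * f x"
    proof (rule AE_M01_I)
      fix x :: real assume "0 < x" "x < 1"
      then have s1: "s 1 = sw x * t x - s x * tw x" using W by simp
      show "tw x * (s x * f x) + (- r x * tw x - (r x)\<^sup>2 * t x) * S x + (sw x * (0 - t x * f x) + (- r x * sw x - (r x)\<^sup>2 * s x) * T x) =
        - r x * (tw x * S x + sw x * T x) - (r x)\<^sup>2 * y x - s 1 * f x"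
        unfolding s1 by (simp add: y_def algebra_simps)
    qed
  qed
  have bc: "y 0 = 0" "y 1 = 0" by (simp_all add: y_def S_def T_def s t1)
  have ei: "L1 (\<lambda>x. s 1 * f x)" using fi by (rule set_integrable_mult_right)
  have "\<bar>s 1 * f x\<bar> \<le> \<bar>s 1\<bar>" for x by (auto simp: f_def indicator_def)
  note dom = real_dom_A[OF y w ei this bc]
  have nz: "\<not> (AE x in M01. complex_of_real (y x) = 0)"
  proof
    assume "AE x in M01. complex_of_real (y x) = 0"
    then have ae: "AE x in M01. y x = 0" by simp
    have yw0: "y x = 0" "w x = 0" if "x \<in> {0..1}" for x
      by (rule acd_zero[OF y acd_continuous[OF w] ae that])+
    have "acd w (\<lambda>x. 0)" by (rule acd_cong[OF acd_const[of 0]]) (use yw0 in auto)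
    from acd_unique[OF w this] AE_M01_mem have "AE x in M01. f x = 0"
      by eventually_elim (use yw0 s_1 in auto)
    then have "negligible {x \<in> {0<..<1}. f x \<noteq> 0}" by (simp add: AE_M01_iff)
    then have "negligible (cbox a b)" by (rule negligible_subset) (use ab in \<open>auto simp: f_def\<close>)
    then show False using ab negligible_interval(1)[of a b] by simp
  qed
  have inner: "L2_inner (ell r (\<lambda>x. of_real (y x))) (\<lambda>x. of_real (y x)) = of_real (s 1 * integral {0..1} (\<lambda>x. y x * f x))"
  proof -
    have yf: "L1 (\<lambda>x. y x * f x)"
      by (rule absolutely_integrable_continuous_mult[OF acd_continuous[OF y] fi])
    have i2: "L1 (\<lambda>x. complex_of_real (s 1 * (y x * f x)))"
      using yf by (intro absolutely_integrable_of_real set_integrable_mult_right)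
    have eq: "AE x in M01. of_real (s 1 * (y x * f x)) = ell r (\<lambda>x. of_real (y x)) x * cnj (of_real (y x))"
      using dom(2) by eventually_elim simp
    have i3: "L1 (\<lambda>x. ell r (\<lambda>x. of_real (y x)) x * cnj (of_real (y x)))"
      by (rule absolutely_integrable_AE_cong[OF i2 eq])
    have "L2_inner (ell r (\<lambda>x. of_real (y x))) (\<lambda>x. of_real (y x)) = (LINT x|M01. complex_of_real (s 1 * (y x * f x)))"
      unfolding L2_inner_def
      by (rule integral_cong_AE[OF borel_measurable_M01[OF i3] borel_measurable_M01[OF i2]])
        (use eq in \<open>auto elim: eventually_mono\<close>)
    also have "\<dots> = of_real (LINT x|M01. s 1 * (y x * f x))"
      using yf by (intro integral_of_real) (simp add: integrable_M01_iff[symmetric])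
    also have "(LINT x|M01. s 1 * (y x * f x)) = s 1 * integral {0..1} (\<lambda>x. y x * f x)"
      using LINT_M01[OF yf] by simp
    finally show ?thesis .
  qed
  have "s 1 * integral {0..1} (\<lambda>x. y x * f x) > 0"
    using pos[unfolded A_positive_def, rule_format, OF dom(1) nz] unfolding inner
    by (simp add: less_complex_def)
  moreover have le: "s 1 * y x * f x \<le> 0" if x: "x \<in> {0..1}" for x
  proof (cases "x \<in> {a..b}")
    case True
    have S0: "0 \<le> \<sigma> * S x"
    proof -
      have "0 \<le> integral {0..x} (\<lambda>x. \<sigma> * (s x * f x))"
      proof (rule integral_nonneg)
        have "(\<lambda>x. s x * f x) integrable_on {0..x}"
          using sfi(1) x by (auto simp: absolutely_integrable_on_def intro: integrable_on_subinterval)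
        then show "(\<lambda>x. \<sigma> * (s x * f x)) integrable_on {0..x}"
          using integrable_on_cmult_left[of "\<lambda>x. s x * f x" "{0..x}" \<sigma>] by simp
        show "0 \<le> \<sigma> * (s x * f x)" for x
          using sgn(1)[of x] by (cases "x \<in> {a..b}") (auto simp: f_def)
      qed
      then show ?thesis by (simp add: S_def)
    qed
    have T0: "\<sigma> * (s 1 * T x) \<le> 0"
    proof -
      have "\<sigma> * (s 1 * T x) \<le> \<sigma> * (s 1 * T 1)"
      proof (rule acd_mono[OF acd_cmult[OF acd_cmult[OF T]]])
        show "AE x in M01. 0 \<le> \<sigma> * (s 1 * (0 - t x * f x))"
        proof (rule AE_M01_I)
          fix x :: real
          have "\<sigma> * (s 1 * (0 - t x * f x)) = - (\<sigma> * (s 1 * t x)) * f x" by simp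
          moreover have "0 \<le> - (\<sigma> * (s 1 * t x)) * f x"
          proof (cases "x \<in> {a..b}")
            case True
            have "0 \<le> - (\<sigma> * (s 1 * t x))" using sgn(2)[OF True] unfolding t_def by linarith
            then show ?thesis by (rule mult_nonneg_nonneg) (simp add: f_def)
          qed (simp add: f_def)
          ultimately show "0 \<le> \<sigma> * (s 1 * (0 - t x * f x))" by simp
        qed
      qed (use x in auto)
      then show ?thesis by (simp add: T_def)
    qed
    \<comment> \<open>Inserting the square of \<sigma> splits \<open>s 1 * y x\<close> into two
      products, each of factors with known and opposite signs.\<close>
    have sq: "\<sigma> * \<sigma> = 1" using \<sigma> by auto
    have "s 1 * y x = (\<sigma> * \<sigma>) * (s 1 * y x)" using sq by simp
    also have "\<dots> = (\<sigma> * (s 1 * t x)) * (\<sigma> * S x) + (\<sigma> * s x) * (\<sigma> * (s 1 * T x))"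
      unfolding y_def by (simp add: algebra_simps)
    also have "\<dots> \<le> 0"
    proof -
      have t0: "\<sigma> * (s 1 * t x) \<le> 0" using sgn(2)[OF True] unfolding t_def by linarith
      have s0: "0 \<le> \<sigma> * s x" using sgn(1)[OF True] by linarith
      show ?thesis by (rule add_nonpos_nonpos[OF mult_nonpos_nonneg[OF t0 S0] mult_nonneg_nonpos[OF s0 T0]])
    qed
    finally show ?thesis using True by (simp add: f_def)
  qed (simp add: f_def)
  have "(\<lambda>x. s 1 * y x * f x) integrable_on {0..1}"
    using absolutely_integrable_continuous_mult[OF continuous_on_mult[OF continuous_on_const acd_continuous[OF y]] fi, of "s 1"]
    by (simp add: absolutely_integrable_on_def)
  then have "integral {0..1} (\<lambda>x. s 1 * y x * f x) \<le> integral {0..1} (\<lambda>x::real. 0)"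
    by (rule Henstock_Kurzweil_Integration.integral_le) (use le in auto)
  then have "s 1 * integral {0..1} (\<lambda>x. y x * f x) \<le> 0" by (simp add: mult.assoc)
  ultimately show False by simp
qed

text \<open>The derivative \<open>r s + sw\<close> need not be continuous, so its sign at one point
  gives no monotonicity. Multiplication by \<open>exp (- R)\<close> with \<open>R' = r\<close>
  changes it to \<open>sw * exp (- R)\<close>, which is continuous.\<close>

lemma s_increasing_near_zero:
  assumes x0: "x0 \<in> {0..1}" "s x0 = 0" and \<sigma>: "0 < \<sigma> * sw x0"
  shows "\<exists>d>0. (\<forall>x\<in>{0..1}. x0 - d < x \<longrightarrow> x < x0 \<longrightarrow> \<sigma> * s x < 0) \<and>
    (\<forall>x\<in>{0..1}. x0 < x \<longrightarrow> x < x0 + d \<longrightarrow> 0 < \<sigma> * s x)"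
proof -
  define R where "R = (\<lambda>x. integral {0..x} r)"
  have R: "acd R r" by (rule acd_integralI[OF L2_realD(1)[OF r], of _ 0]) (simp add: R_def)
  have q: "acd (\<lambda>x. \<sigma> * (s x * exp (- R x))) (\<lambda>x. \<sigma> * (sw x * exp (- R x)))"
    by (rule acd_cong[OF acd_cmult[OF acd_mult[OF s(1) acd_exp[OF acd_minus[OF R]]]] refl])
      (auto intro!: AE_M01_I simp: algebra_simps)
  have qc: "continuous_on {0..1} (\<lambda>x. \<sigma> * (sw x * exp (- R x)))"
    by (intro continuous_intros cont acd_continuous[OF R])
  have "0 < \<sigma> * (sw x0 * exp (- R x0))" using \<sigma> by (simp add: mult.assoc[symmetric])
  from acd_local_strict_mono[OF q qc x0(1) this] obtain d where d: "d > 0"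
    "\<forall>x\<in>{0..1}. \<forall>y\<in>{0..1}. x0 - d < x \<longrightarrow> x < y \<longrightarrow> y < x0 + d \<longrightarrow> \<sigma> * (s x * exp (- R x)) < \<sigma> * (s y * exp (- R y))"
    by (elim exE conjE)
  show ?thesis
  proof (intro exI[of _ d] conjI ballI impI d(1))
    fix x assume "x \<in> {0..1}" "x0 - d < x" "x < x0"
    then have "(\<sigma> * s x) * exp (- R x) < 0" using d(2)[rule_format, of x x0] x0 d(1) by (simp add: mult.assoc)
    then show "\<sigma> * s x < 0" by (simp add: mult_less_0_iff not_less[symmetric])
  next
    fix x assume "x \<in> {0..1}" "x0 < x" "x < x0 + d"
    then have "0 < (\<sigma> * s x) * exp (- R x)" using d(2)[rule_format, of x0 x] x0 d(1) by (simp add: mult.assoc)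
    then show "0 < \<sigma> * s x" by (simp add: zero_less_mult_iff not_less[symmetric])
  qed
qed

text \<open>At an interior zero the Wronskian forces \<open>sw x0\<close> and \<open>c x0\<close> to
  have the same sign. Just to the left of it \<open>s\<close> has the opposite sign, while s(1) t is
  close to s(1)^2 c(x0); so the Green function is negative on the diagonal there, which
  \<open>green_sign\<close> excludes.\<close>

lemma s_nonzero:
  assumes x0: "0 < x0" "x0 \<le> 1"
  shows "s x0 \<noteq> 0"
proof
  assume z: "s x0 = 0"
  have x01: "x0 \<in> {0..1}" "x0 < 1" using x0 z s_1 by (auto simp: less_le)
  have W: "sw x0 * c x0 = 1" using wronskian[OF x01(1)] z by simp
  define \<sigma> where "\<sigma> = sgn (sw x0)"
  have \<sigma>: "\<sigma> = 1 \<or> \<sigma> = - 1" "0 < \<sigma> * sw x0" "0 < \<sigma> * c x0"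
  proof -
    have "sw x0 \<noteq> 0" using W by auto
    then consider "0 < sw x0" | "sw x0 < 0" by linarith
    then have "(\<sigma> = 1 \<or> \<sigma> = - 1) \<and> 0 < \<sigma> * sw x0 \<and> 0 < \<sigma> * c x0"
    proof cases
      case 1
      then show ?thesis using W zero_less_mult_iff[of "sw x0" "c x0"] by (auto simp: \<sigma>_def)
    next
      case 2
      then show ?thesis using W zero_less_mult_iff[of "sw x0" "c x0"] by (auto simp: \<sigma>_def)
    qed
    then show "\<sigma> = 1 \<or> \<sigma> = - 1" "0 < \<sigma> * sw x0" "0 < \<sigma> * c x0" by auto
  qed
  obtain d where d: "d > 0" "\<And>x. x \<in> {0..1} \<Longrightarrow> x0 - d < x \<Longrightarrow> x < x0 \<Longrightarrow> \<sigma> * s x < 0"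
    using s_increasing_near_zero[OF x01(1) z \<sigma>(2)] by auto
  define G where "G = (\<lambda>x. \<sigma> * (s 1 * (s 1 * c x - c 1 * s x)))"
  have Gc: "continuous_on {0..1} G" unfolding G_def by (intro continuous_intros cont)
  have "G x0 = (s 1)\<^sup>2 * (\<sigma> * c x0)" by (simp add: G_def z power2_eq_square)
  then have G0: "0 < G x0" using \<sigma>(3) s_1 by simp
  obtain d' where d': "d' > 0" "\<And>x. x \<in> {0..1} \<Longrightarrow> dist x x0 < d' \<Longrightarrow> dist (G x) (G x0) < G x0"
    using Gc[unfolded continuous_on_iff, rule_format, OF x01(1) G0] by blast
  define \<delta> where "\<delta> = min (min d d') x0"
  have \<delta>: "0 < \<delta>" "\<delta> \<le> d" "\<delta> \<le> d'" "\<delta> \<le> x0" using d d' x0 by (auto simp: \<delta>_def)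
  show False
  proof (rule green_sign[of "x0 - 2 * \<delta> / 3" "x0 - \<delta> / 3" "- \<sigma>"])
    fix x assume x: "x \<in> {x0 - 2 * \<delta> / 3..x0 - \<delta> / 3}"
    then have x': "x \<in> {0..1}" "x0 - d < x" "x < x0" using \<delta> x01 by auto
    show "0 < - \<sigma> * s x" using d(2)[OF x'] by simp
    have "dist x x0 < d'" using x \<delta> by (auto simp: dist_real_def)
    then have "0 < G x" using d'(2)[OF x'(1)] by (auto simp: dist_real_def abs_if split: if_splits)
    then show "- \<sigma> * (s 1 * (s 1 * c x - c 1 * s x)) < 0" by (simp add: G_def)
  qed (use \<sigma>(1) \<delta> x01 in auto)
qed

lemma s_pos:
  assumes x: "0 < x" "x \<le> 1"
  shows "0 < s x"
proof (rule ccontr)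
  assume "\<not> 0 < s x"
  then have neg: "s x < 0" using s_nonzero[OF x] by simp
  obtain d where d: "d > 0" "\<And>x. x \<in> {0..1} \<Longrightarrow> 0 < x \<Longrightarrow> x < d \<Longrightarrow> 0 < s x"
    using s_increasing_near_zero[of 0 1] s by auto
  define u where "u = min x (d/2)"
  have u: "0 < u" "u \<le> x" "0 < s u" using d(2)[of u] d(1) x by (auto simp: u_def min_def)
  have "\<exists>v\<ge>u. v \<le> x \<and> s v = 0"
    by (rule IVT2'[of s x 0 u]) (use u neg x continuous_on_subset[OF cont(1)] in auto)
  then obtain v where "u \<le> v" "v \<le> x" "s v = 0" by blast
  then show False using s_nonzero[of v] u x by auto
qed

text \<open>Near 0 positivity comes from \<open>c 0 = 1\<close>; on \<open>{e..1}\<close> the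
  function \<open>s\<close> has a positive minimum and a large \<kappa> outweighs \<open>c\<close>.
  A whole half-line of \<kappa> is kept in order to prescribe the norming constant at 0.\<close>

lemma exists_positive_solution:
  "\<exists>\<kappa>0. \<forall>\<kappa>\<ge>\<kappa>0. \<forall>x\<in>{0..1}. 0 < c x + \<kappa> * s x"
proof -
  obtain d where d: "d > 0" "\<And>x. x \<in> {0..1} \<Longrightarrow> dist x 0 < d \<Longrightarrow> dist (c x) (c 0) < 1"
    using cont(3)[unfolded continuous_on_iff, rule_format, of 0 1] by auto
  define e where "e = min d 1 / 2"
  have e: "0 < e" "e \<le> 1" "e < d" using d by (auto simp: e_def min_def)
  have "bounded (c ` {0..1})" using cont(3) by (intro compact_imp_bounded compact_continuous_image) auto
  then obtain M where M: "\<And>x. x \<in> {0..1} \<Longrightarrow> \<bar>c x\<bar> \<le> M" unfolding bounded_iff by fastforce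
  obtain x1 where x1: "x1 \<in> {e..1}" "\<And>x. x \<in> {e..1} \<Longrightarrow> s x1 \<le> s x"
    using continuous_attains_inf[of "{e..1}" s] continuous_on_subset[OF cont(1), of "{e..1}"] e by auto
  have m: "0 < s x1" using x1(1) e by (intro s_pos) auto
  have "0 < c x + \<kappa> * s x" if \<kappa>: "M / s x1 + 1 \<le> \<kappa>" and x: "x \<in> {0..1}" for \<kappa> x
  proof (cases "x < e")
    case True
    have "0 < c x" using d(2)[OF x] True e x by (auto simp: dist_real_def c abs_if split: if_splits)
    moreover have "0 \<le> s x" using s_pos[of x] s(3) x by (cases "x = 0") (auto simp: less_imp_le)
    moreover have "0 \<le> \<kappa>" using \<kappa> M[OF x] m by (smt (verit) divide_nonneg_pos abs_ge_zero)
    ultimately show ?thesis by (simp add: add_pos_nonneg)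
  next
    case False
    have "0 \<le> M" using M[OF x] by linarith
    have "M < (M / s x1 + 1) * s x1" using m by (simp add: field_simps)
    also have "\<dots> \<le> \<kappa> * s x1" using \<kappa> m by (intro mult_right_mono) auto
    also have "\<dots> \<le> \<kappa> * s x"
    proof (rule mult_left_mono)
      show "s x1 \<le> s x" using x1(2) x False by simp
      show "0 \<le> \<kappa>" using \<kappa> \<open>0 \<le> M\<close> m by (smt (verit) divide_nonneg_pos)
    qed
    finally show ?thesis using M[OF x] by linarith
  qed
  then show ?thesis by blast
qed

text \<open>A positive solution \<phi> has logarithmic derivative \<open>r + h\<close>, where
  \<open>h\<close> is its quasi-derivative divided by \<phi>. The Riccati equation holds for
  \<open>h\<close> in the form \<open>h' = - (r + h)^2\<close>, so \<open>h\<close> is absolutely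
  continuous although \<open>v = r + h\<close> need not be.\<close>

lemma factorization:
  "\<exists>N0. \<forall>N\<ge>N0. 0 < N \<and> (\<exists>h \<theta>. factorizes r N h \<theta>)"
proof -
  obtain \<kappa>0 where \<kappa>0: "\<And>\<kappa> x. \<kappa>0 \<le> \<kappa> \<Longrightarrow> x \<in> {0..1} \<Longrightarrow> 0 < c x + \<kappa> * s x"
    using exists_positive_solution by blast
  have "0 < N \<and> (\<exists>h \<theta>. factorizes r N h \<theta>)" if N: "\<kappa>0 + c 1 / s 1 \<le> N" for N
  proof -
    \<comment> \<open>Chosen so that \<phi>(1) = N s(1). By the Wronskian the derivative of s/\<phi>
      is \<phi>^-2, so the integral of \<phi>^-2 is s(1)/\<phi>(1) = 1/N.\<close>
    define \<kappa> where "\<kappa> = N - c 1 / s 1"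
    define \<phi> where "\<phi> = (\<lambda>x. c x + \<kappa> * s x)"
    define w where "w = (\<lambda>x. cw x + \<kappa> * sw x)"
    have \<phi>pos: "0 < \<phi> x" if "x \<in> {0..1}" for x
      unfolding \<phi>_def by (rule \<kappa>0) (use N that in \<open>auto simp: \<kappa>_def\<close>)
    then have \<phi>nz: "\<phi> x \<noteq> 0" if "x \<in> {0..1}" for x using that by force
    have \<phi>0: "\<phi> 0 = 1" by (simp add: \<phi>_def s c)
    have \<phi>1: "\<phi> 1 = N * s 1" using s_1 by (simp add: \<phi>_def \<kappa>_def field_simps)
    have Npos: "0 < N" using \<phi>pos[of 1] \<phi>1 s_pos[of 1] by (simp add: zero_less_mult_iff)
    have \<phi>: "acd \<phi> (\<lambda>x. r x * \<phi> x + w x)" unfolding \<phi>_def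
      by (rule acd_cong[OF acd_add[OF c(1) acd_cmult[OF s(1)]] refl])
        (auto intro!: AE_M01_I simp: w_def algebra_simps)
    have w: "acd w (\<lambda>x. - r x * w x - (r x)\<^sup>2 * \<phi> x)" unfolding w_def
      by (rule acd_cong[OF acd_add[OF c(2) acd_cmult[OF s(2)]] refl])
        (auto intro!: AE_M01_I simp: \<phi>_def algebra_simps)
    define h where "h = (\<lambda>x. w x * inverse (\<phi> x))"
    have wh: "w x = h x * \<phi> x" if "x \<in> {0..1}" for x using \<phi>nz[OF that] by (simp add: h_def)
    have h: "acd h (\<lambda>x. - (r x + h x)\<^sup>2)" unfolding h_def
    proof (rule acd_cong[OF acd_mult[OF w acd_inverse[OF \<phi> \<phi>nz]] refl])
      show "AE x in M01. w x * (- (inverse (\<phi> x))\<^sup>2 * (r x * \<phi> x + w x)) + (- r x * w x - (r x)\<^sup>2 * \<phi> x) * inverse (\<phi> x) =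
        - (r x + w x * inverse (\<phi> x))\<^sup>2"
      proof (rule AE_M01_I)
        fix x :: real assume "0 < x" "x < 1"
        then have "\<phi> x \<noteq> 0" using \<phi>nz by simp
        then show "w x * (- (inverse (\<phi> x))\<^sup>2 * (r x * \<phi> x + w x)) + (- r x * w x - (r x)\<^sup>2 * \<phi> x) * inverse (\<phi> x) =
          - (r x + w x * inverse (\<phi> x))\<^sup>2"
          by (simp add: field_simps power2_eq_square)
      qed
    qed
    have \<theta>: "acd (\<lambda>x. ln (\<phi> x)) (\<lambda>x. r x + h x)"
    proof (rule acd_cong[OF acd_ln[OF \<phi> \<phi>pos] refl])
      show "AE x in M01. inverse (\<phi> x) * (r x * \<phi> x + w x) = r x + h x"
      proof (rule AE_M01_I)
        fix x :: real assume "0 < x" "x < 1"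
        then have "\<phi> x \<noteq> 0" using \<phi>nz by simp
        then show "inverse (\<phi> x) * (r x * \<phi> x + w x) = r x + h x" by (simp add: h_def field_simps)
      qed
    qed
    have "acd (\<lambda>x. s x * inverse (\<phi> x)) (\<lambda>x. exp (- 2 * ln (\<phi> x)))"
    proof (rule acd_cong[OF acd_mult[OF s(1) acd_inverse[OF \<phi> \<phi>nz]] refl])
      show "AE x in M01. s x * (- (inverse (\<phi> x))\<^sup>2 * (r x * \<phi> x + w x)) + (r x * s x + sw x) * inverse (\<phi> x) = exp (- 2 * ln (\<phi> x))"
      proof (rule AE_M01_I)
        fix x :: real assume x: "0 < x" "x < 1"
        then have nz: "\<phi> x \<noteq> 0" and p: "0 < \<phi> x" using \<phi>nz \<phi>pos by simp_all
        have W: "sw x * \<phi> x - s x * w x = 1"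
          using wronskian[of x] x by (simp add: \<phi>_def w_def algebra_simps)
        have "exp (- 2 * ln (\<phi> x)) = inverse (\<phi> x) ^ 2"
          using p by (simp add: exp_minus exp_double power_inverse)
        moreover have "s x * (- (inverse (\<phi> x))\<^sup>2 * (r x * \<phi> x + w x)) + (r x * s x + sw x) * inverse (\<phi> x) =
            (sw x * \<phi> x - s x * w x) * (inverse (\<phi> x))\<^sup>2"
          using nz by (simp add: field_simps power2_eq_square)
        ultimately show "s x * (- (inverse (\<phi> x))\<^sup>2 * (r x * \<phi> x + w x)) + (r x * s x + sw x) * inverse (\<phi> x) = exp (- 2 * ln (\<phi> x))"
          using W by simp
      qed
    qed
    from acd_has_integral(2)[OF this, of 1]
    have "((\<lambda>x. exp (- 2 * ln (\<phi> x))) has_integral 1 / N) {0..1}"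
      using \<phi>1 s_1 by (simp add: s field_simps)
    then show ?thesis unfolding factorizes_def using Npos h \<theta> \<phi>0 by (intro conjI exI[of _ h] exI[of _ "\<lambda>x. ln (\<phi> x)"]) auto
  qed
  then show ?thesis by blast
qed

end

lemma A_positive_factorization:
  fixes r :: "real \<Rightarrow> real"
  assumes r: "r \<in> L2" and pos: "A_positive r"
  shows "\<exists>N0. \<forall>N\<ge>N0. 0 < N \<and> (\<exists>h \<theta>. factorizes r N h \<theta>)"
proof -
  obtain s sw where s: "acd s (\<lambda>x. r x * s x + sw x)" "acd sw (\<lambda>x. - r x * sw x - (r x)\<^sup>2 * s x)" "s 0 = 0" "sw 0 = 1"
    using exists_real_solution[OF r] by blast
  obtain c cw where c: "acd c (\<lambda>x. r x * c x + cw x)" "acd cw (\<lambda>x. - r x * cw x - (r x)\<^sup>2 * c x)" "c 0 = 1" "cw 0 = 0"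
    using exists_real_solution[OF r] by blast
  interpret zero_energy r s sw c cw by unfold_locales (fact r s c pos)+
  show ?thesis by (rule factorization)
qed

section \<open>The Dirac system\<close>

definition dirac_eq :: "(real \<Rightarrow> real) \<Rightarrow> (real \<Rightarrow> real) \<Rightarrow> complex \<Rightarrow> (real \<Rightarrow> complex) \<Rightarrow> (real \<Rightarrow> complex) \<Rightarrow> bool" where
  "dirac_eq p v l y1 y2 \<longleftrightarrow>
     acd y1 (\<lambda>x. - of_real (v x) * y1 x + (2 * of_real (p x) - l) * y2 x) \<and>
     acd y2 (\<lambda>x. l * y1 x + of_real (v x) * y2 x)"

lemma dirac_eqD:
  assumes "dirac_eq p v l y1 y2"
  shows "acd y1 (\<lambda>x. - of_real (v x) * y1 x + (2 * of_real (p x) - l) * y2 x)"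
    "acd y2 (\<lambda>x. l * y1 x + of_real (v x) * y2 x)" "continuous_on {0..1} y1" "continuous_on {0..1} y2"
  using assms acd_continuous by (auto simp: dirac_eq_def)

text \<open>Lagrange's identity. It yields constancy of the Wronskian for \<open>m = l\<close>, the
  energy identity for conjugate parameters, and the difference quotient of the characteristic
  function as \<open>m\<close> tends to \<open>l\<close>.\<close>

lemma dirac_eq_cross:
  assumes "dirac_eq p v l y1 y2" "dirac_eq p v m u1 u2"
  shows "acd (\<lambda>x. y1 x * u2 x - y2 x * u1 x) (\<lambda>x. (m - l) * (y1 x * u1 x + y2 x * u2 x))"
  by (rule acd_cong[OF acd_diff[OF acd_mult[OF dirac_eqD(1)[OF assms(1)] dirac_eqD(2)[OF assms(2)]]
    acd_mult[OF dirac_eqD(2)[OF assms(1)] dirac_eqD(1)[OF assms(2)]]] refl])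
    (auto intro!: AE_M01_I simp: algebra_simps)

lemma dirac_eq_combination:
  assumes "dirac_eq p v l y1 y2" "dirac_eq p v l u1 u2"
  shows "dirac_eq p v l (\<lambda>x. a * y1 x + b * u1 x) (\<lambda>x. a * y2 x + b * u2 x)"
  unfolding dirac_eq_def
proof
  show "acd (\<lambda>x. a * y1 x + b * u1 x) (\<lambda>x. - of_real (v x) * (a * y1 x + b * u1 x) + (2 * of_real (p x) - l) * (a * y2 x + b * u2 x))"
    by (rule acd_cong[OF acd_add[OF acd_cmult[OF dirac_eqD(1)[OF assms(1)]] acd_cmult[OF dirac_eqD(1)[OF assms(2)]]] refl])
      (auto intro!: AE_M01_I simp: algebra_simps)
  show "acd (\<lambda>x. a * y2 x + b * u2 x) (\<lambda>x. l * (a * y1 x + b * u1 x) + of_real (v x) * (a * y2 x + b * u2 x))"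
    by (rule acd_cong[OF acd_add[OF acd_cmult[OF dirac_eqD(2)[OF assms(1)]] acd_cmult[OF dirac_eqD(2)[OF assms(2)]]] refl])
      (auto intro!: AE_M01_I simp: algebra_simps)
qed

lemma dirac_eq_cnj:
  assumes "dirac_eq p v l y1 y2"
  shows "dirac_eq p v (cnj l) (\<lambda>x. cnj (y1 x)) (\<lambda>x. cnj (y2 x))"
  using acd_cnj[OF dirac_eqD(1)[OF assms]] acd_cnj[OF dirac_eqD(2)[OF assms]] by (simp add: dirac_eq_def)

section \<open>Growth estimates and the energy identity\<close>

definition nsq :: "(real \<Rightarrow> complex) \<Rightarrow> (real \<Rightarrow> complex) \<Rightarrow> real \<Rightarrow> real" where
  "nsq y1 y2 x = (norm (y1 x))\<^sup>2 + (norm (y2 x))\<^sup>2"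

lemma nsq_nonneg: "0 \<le> nsq y1 y2 x" by (simp add: nsq_def)

lemma norm_le_nsq: "(norm (y1 x))\<^sup>2 \<le> nsq y1 y2 x" "(norm (y2 x))\<^sup>2 \<le> nsq y1 y2 x"
  by (auto simp: nsq_def)

lemma two_norm_mult_le: "2 * (norm a * norm b) \<le> (norm a)\<^sup>2 + (norm b)\<^sup>2" for a b :: complex
  using zero_le_power2[of "norm a - norm b"] by (simp add: power2_diff)

text \<open>The real part of \<open>l\<close> cancels: the terms with \<open>l\<close> combine to
  \<open>l * (y1 * cnj y2 - y2 * cnj y1)\<close>, whose second factor is purely imaginary. Hence the
  growth bounds are uniform along horizontal lines.\<close>

lemma dirac_eq_nsq:
  assumes y: "dirac_eq p v l y1 y2"
  obtains S' where "acd (nsq y1 y2) S'" "\<And>x. \<bar>S' x\<bar> \<le> 2 * (\<bar>Im l\<bar> + (\<bar>v x\<bar> + \<bar>p x\<bar>)) * nsq y1 y2 x"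
proof -
  define D1 where "D1 = (\<lambda>x. - of_real (v x) * y1 x + (2 * of_real (p x) - l) * y2 x)"
  define D2 where "D2 = (\<lambda>x. l * y1 x + of_real (v x) * y2 x)"
  define S' where "S' = (\<lambda>x. 2 * Re (D1 x * cnj (y1 x) + D2 x * cnj (y2 x)))"
  have d: "acd y1 D1" "acd y2 D2" using dirac_eqD[OF y] by (simp_all add: D1_def D2_def)
  have "acd (\<lambda>x. Re (y1 x * cnj (y1 x) + y2 x * cnj (y2 x)))
     (\<lambda>x. Re ((y1 x * cnj (D1 x) + D1 x * cnj (y1 x)) + (y2 x * cnj (D2 x) + D2 x * cnj (y2 x))))"
    by (intro acd_Re acd_add acd_mult acd_cnj d)
  then have "acd (nsq y1 y2) S'"
    by (rule acd_cong) (auto intro!: AE_M01_I simp: nsq_def S'_def complex_mult_cnj cmod_power2)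
  moreover have "\<bar>S' x\<bar> \<le> 2 * (\<bar>Im l\<bar> + (\<bar>v x\<bar> + \<bar>p x\<bar>)) * nsq y1 y2 x" for x
  proof -
    let ?a = "y1 x" and ?b = "y2 x"
    have eq: "Re (D1 x * cnj ?a + D2 x * cnj ?b) =
       v x * ((norm ?b)\<^sup>2 - (norm ?a)\<^sup>2) + p x * (2 * Re (?b * cnj ?a)) + Im l * (2 * Im (?b * cnj ?a))"
      unfolding D1_def D2_def cmod_power2 by (simp add: power2_eq_square algebra_simps)
    have bRe: "\<bar>2 * Re (?b * cnj ?a)\<bar> \<le> nsq y1 y2 x" and bIm: "\<bar>2 * Im (?b * cnj ?a)\<bar> \<le> nsq y1 y2 x"
      using abs_Re_le_cmod[of "?b * cnj ?a"] abs_Im_le_cmod[of "?b * cnj ?a"] two_norm_mult_le[of ?a ?b]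
      unfolding nsq_def norm_mult complex_mod_cnj abs_mult by (auto simp: mult.commute)
    have b3: "\<bar>(norm ?b)\<^sup>2 - (norm ?a)\<^sup>2\<bar> \<le> nsq y1 y2 x" by (auto simp: nsq_def abs_if)
    have h: "\<bar>t * D\<bar> \<le> \<bar>t\<bar> * nsq y1 y2 x" if "\<bar>D\<bar> \<le> nsq y1 y2 x" for t D
      using mult_left_mono[OF that, of "\<bar>t\<bar>"] by (simp add: abs_mult)
    note h[OF b3, of "v x"] h[OF bRe, of "p x"] h[OF bIm, of "Im l"]
    then have "\<bar>Re (D1 x * cnj ?a + D2 x * cnj ?b)\<bar> \<le> (\<bar>Im l\<bar> + (\<bar>v x\<bar> + \<bar>p x\<bar>)) * nsq y1 y2 x"
      unfolding eq distrib_right by linarith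
    then have "2 * \<bar>Re (D1 x * cnj ?a + D2 x * cnj ?b)\<bar> \<le> 2 * ((\<bar>Im l\<bar> + (\<bar>v x\<bar> + \<bar>p x\<bar>)) * nsq y1 y2 x)"
      by (intro mult_left_mono) auto
    then show ?thesis by (simp only: S'_def abs_mult abs_numeral mult.assoc)
  qed
  ultimately show ?thesis by (rule that)
qed

definition pot_norm :: "(real \<Rightarrow> real) \<Rightarrow> (real \<Rightarrow> real) \<Rightarrow> real" where
  "pot_norm p v = integral {0..1} (\<lambda>x. \<bar>v x\<bar> + \<bar>p x\<bar>)"

text \<open>Gronwall's inequality in both directions; the second estimate also carries data from the
  right end point to the left, as the Weyl solution requires.\<close>

lemma dirac_eq_growth:
  assumes y: "dirac_eq p v l y1 y2" and p: "L1 p" and v: "L1 v"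
    and x: "0 \<le> a" "a \<le> b" "b \<le> 1"
  shows "nsq y1 y2 b \<le> nsq y1 y2 a * exp (2 * \<bar>Im l\<bar> * (b - a) + 2 * pot_norm p v)"
    "nsq y1 y2 a \<le> nsq y1 y2 b * exp (2 * \<bar>Im l\<bar> * (b - a) + 2 * pot_norm p v)"
proof -
  define k where "k = (\<lambda>x. \<bar>v x\<bar> + \<bar>p x\<bar>)"
  have ki: "L1 k"
    unfolding k_def using absolutely_integrable_norm[OF v] absolutely_integrable_norm[OF p]
    by (intro set_integral_add) (simp_all add: o_def)
  define m where "m = (\<lambda>x. integral {0..x} k)"
  have m: "acd m k" by (rule acd_integralI[OF ki, of _ 0]) (simp add: m_def)
  define M where "M = (\<lambda>x. 2 * (\<bar>Im l\<bar> * x + m x))"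
  have M: "acd M (\<lambda>x. 2 * (\<bar>Im l\<bar> * 1 + k x))" unfolding M_def by (intro acd_cmult acd_add acd_id m)
  obtain S' where S': "acd (nsq y1 y2) S'" and le: "\<And>x. \<bar>S' x\<bar> \<le> 2 * (\<bar>Im l\<bar> + k x) * nsq y1 y2 x"
    unfolding k_def using dirac_eq_nsq[OF y] by blast
  have le': "S' x \<le> 2 * (\<bar>Im l\<bar> * 1 + k x) * nsq y1 y2 x" "- (2 * (\<bar>Im l\<bar> * 1 + k x)) * nsq y1 y2 x \<le> S' x" for x
    using le[of x] unfolding mult_minus_left mult_1_right by linarith+
  have "0 \<le> k x" for x by (simp add: k_def)
  then have "m b \<le> m 1" "m 0 \<le> m a" using acd_mono[OF m] x by auto
  moreover have "m 0 = 0" "m 1 = pot_norm p v" by (simp_all add: m_def k_def pot_norm_def)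
  ultimately have Mle: "M b - M a \<le> 2 * \<bar>Im l\<bar> * (b - a) + 2 * pot_norm p v"
    by (simp add: M_def algebra_simps)
  have "nsq y1 y2 b \<le> nsq y1 y2 a * exp (M b - M a)"
    by (rule acd_Gronwall[OF S' M _ x]) (use le' in auto)
  also have "\<dots> \<le> nsq y1 y2 a * exp (2 * \<bar>Im l\<bar> * (b - a) + 2 * pot_norm p v)"
    using Mle by (intro mult_left_mono nsq_nonneg) simp
  finally show "nsq y1 y2 b \<le> nsq y1 y2 a * exp (2 * \<bar>Im l\<bar> * (b - a) + 2 * pot_norm p v)" .
  have "nsq y1 y2 a * exp (M a - M b) \<le> nsq y1 y2 b"
    by (rule acd_Gronwall_backward[OF S' M _ x]) (use le' in auto)
  then have "nsq y1 y2 a * exp (M a - M b) * exp (M b - M a) \<le> nsq y1 y2 b * exp (M b - M a)"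
    by (intro mult_right_mono) auto
  then have "nsq y1 y2 a \<le> nsq y1 y2 b * exp (M b - M a)" by (simp add: mult.assoc exp_add[symmetric])
  also have "\<dots> \<le> nsq y1 y2 b * exp (2 * \<bar>Im l\<bar> * (b - a) + 2 * pot_norm p v)"
    using Mle by (intro mult_left_mono nsq_nonneg) simp
  finally show "nsq y1 y2 a \<le> nsq y1 y2 b * exp (2 * \<bar>Im l\<bar> * (b - a) + 2 * pot_norm p v)" .
qed

lemma dirac_eq_unique:
  assumes y: "dirac_eq p v l y1 y2" and u: "dirac_eq p v l u1 u2"
    and p: "L1 p" and v: "L1 v"
    and 0: "y1 0 = u1 0" "y2 0 = u2 0" and x: "x \<in> {0..1}"
  shows "y1 x = u1 x" "y2 x = u2 x"
proof -
  let ?d1 = "\<lambda>x. 1 * y1 x + (-1) * u1 x" and ?d2 = "\<lambda>x. 1 * y2 x + (-1) * u2 x"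
  have d: "dirac_eq p v l ?d1 ?d2" by (rule dirac_eq_combination[OF y u])
  have "nsq ?d1 ?d2 x \<le> nsq ?d1 ?d2 0 * exp (2 * \<bar>Im l\<bar> * (x - 0) + 2 * pot_norm p v)"
    by (rule dirac_eq_growth(1)[OF d p v]) (use x in auto)
  also have "nsq ?d1 ?d2 0 = 0" using 0 by (simp add: nsq_def)
  finally have "nsq ?d1 ?d2 x = 0" using nsq_nonneg[of ?d1 ?d2 x] by (simp only: mult_zero_left order_antisym)
  then show "y1 x = u1 x" "y2 x = u2 x" by (auto simp: nsq_def add_nonneg_eq_0_iff)
qed

text \<open>Lagrange's identity with the conjugate solution, which belongs to the parameter
  \<open>cnj l\<close>; the boundary term at 0 drops out because \<open>y2 0 = 0\<close>.\<close>

lemma dirac_eq_energy: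
  assumes y: "dirac_eq p v l y1 y2" and 0: "y2 0 = 0"
    and x: "x \<in> {0..1}"
  shows "Im (cnj (y1 x) * y2 x) = Im l * integral {0..x} (nsq y1 y2)"
proof -
  have E: "acd (\<lambda>x. Im (y1 x * cnj (y2 x) - y2 x * cnj (y1 x)))
     (\<lambda>x. Im ((cnj l - l) * (y1 x * cnj (y1 x) + y2 x * cnj (y2 x))))"
    by (intro acd_Im dirac_eq_cross[OF y dirac_eq_cnj[OF y]])
  have h1: "Im (y1 t * cnj (y2 t) - y2 t * cnj (y1 t)) = -2 * Im (cnj (y1 t) * y2 t)" for t
    by (simp add: algebra_simps)
  have h2: "Im ((cnj l - l) * (y1 t * cnj (y1 t) + y2 t * cnj (y2 t))) = -2 * Im l * nsq y1 y2 t" for t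
    unfolding nsq_def cmod_power2 by (simp add: power2_eq_square algebra_simps)
  have "acd (\<lambda>x. -2 * Im (cnj (y1 x) * y2 x)) (\<lambda>x. -2 * Im l * nsq y1 y2 x)"
    by (rule acd_cong[OF E h1 AE_M01_I[OF h2]])
  from acd_has_integral(2)[OF this x] 0
  have "((\<lambda>x. -2 * Im l * nsq y1 y2 x) has_integral -2 * Im (cnj (y1 x) * y2 x)) {0..x}" by simp
  then have "integral {0..x} (\<lambda>x. -2 * Im l * nsq y1 y2 x) = -2 * Im (cnj (y1 x) * y2 x)" by (rule integral_unique)
  then show ?thesis by simp
qed

text \<open>
  With $G(x) = \int_0^x |y|^2$ the energy identity gives $G' \ge 2\tau G$ for $\tau = \mathrm{Im}\, l$,
  which turns the trivial lower bound for $G$ near $1/(1+\tau)$ into exponential growth up to $1$.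
\<close>

lemma dirac_eq_lower_bound:
  assumes y: "dirac_eq p v l y1 y2" and p: "L1 p" and v: "L1 v"
    and 0: "y1 0 = 1" "y2 0 = 0" and \<tau>: "0 < Im l"
  shows "Im l / (1 + Im l) * exp (Im l - 4 - 3 * pot_norm p v) \<le> norm (y2 1)"
proof -
  define \<tau> where "\<tau> = Im l"
  define C where "C = pot_norm p v"
  define S where "S = nsq y1 y2"
  define G where "G = (\<lambda>x. integral {0..x} S)"
  have \<tau>0: "0 < \<tau>" using \<tau> by (simp add: \<tau>_def)
  have S0: "S 0 = 1" using 0 by (simp add: S_def nsq_def)
  have up: "S 1 \<le> exp (2 * \<tau> + 2 * C)"
    using dirac_eq_growth(1)[OF y p v, of 0 1] S0 \<tau>0 by (simp add: S_def \<tau>_def C_def)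
  have low: "exp (- (2 * \<tau> * x + 2 * C)) \<le> S x" if "0 \<le> x" "x \<le> 1" for x
  proof -
    have "1 \<le> S x * exp (2 * \<tau> * x + 2 * C)"
      using dirac_eq_growth(2)[OF y p v, of 0 x] that S0 \<tau>0 by (simp add: S_def \<tau>_def C_def)
    then have "1 * exp (- (2 * \<tau> * x + 2 * C)) \<le> S x * exp (2 * \<tau> * x + 2 * C) * exp (- (2 * \<tau> * x + 2 * C))"
      by (intro mult_right_mono) auto
    then show ?thesis by (simp add: mult.assoc exp_add[symmetric])
  qed
  have Sc: "continuous_on {0..1} S" unfolding S_def nsq_def
    by (intro continuous_intros dirac_eqD(3,4)[OF y])
  have Si: "L1 S" by (rule absolutely_integrable_continuous_real[OF Sc])
  have G: "acd G S" by (rule acd_integralI[OF Si, of _ 0]) (simp add: G_def)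
  have en: "2 * \<tau> * G x \<le> 2 * (norm (y1 x) * norm (y2 x))" if "x \<in> {0..1}" for x
    using dirac_eq_energy[OF y 0(2) that] abs_Im_le_cmod[of "cnj (y1 x) * y2 x"]
    by (simp add: G_def S_def \<tau>_def norm_mult)
  have GS: "2 * \<tau> * G x \<le> S x" if "x \<in> {0..1}" for x
    using en[OF that] two_norm_mult_le[of "y1 x" "y2 x"] by (simp add: S_def nsq_def)
  \<comment> \<open>Small enough that \<tau> x0 \<le> 1, so the two losses exp(-2 \<tau> x0) cost
    only the constant exp(-4), and large enough that the remaining factor \<tau> x0 stays away from
    0 as \<tau> grows.\<close>
  define x0 where "x0 = 1 / (1 + \<tau>)"
  have x0: "0 < x0" "x0 \<le> 1" "\<tau> * x0 \<le> 1" using \<tau>0 by (auto simp: x0_def field_simps)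
  have m: "acd (\<lambda>x. - (2 * \<tau> * x)) (\<lambda>x. - (2 * \<tau> * 1))" by (intro acd_minus acd_cmult acd_id)
  have "G x0 * exp (- (2 * \<tau> * x0) - - (2 * \<tau> * 1)) \<le> G 1"
  proof (rule acd_Gronwall_backward[OF G m])
    show "AE x in M01. - (- (2 * \<tau> * 1)) * G x \<le> S x" by (rule AE_M01_I) (use GS in auto)
  qed (use x0 in auto)
  moreover have "x0 * exp (- (2 * \<tau> * x0 + 2 * C)) \<le> G x0"
  proof -
    have "exp (- (2 * \<tau> * x0 + 2 * C)) * (x0 - 0) \<le> G x0 - G 0"
    proof (rule has_integral_le)
      show "((\<lambda>t. exp (- (2 * \<tau> * x0 + 2 * C))) has_integral exp (- (2 * \<tau> * x0 + 2 * C)) * (x0 - 0)) {0..x0}"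
        using has_integral_const_real[of "exp (- (2 * \<tau> * x0 + 2 * C))" 0 x0] x0 by (simp add: mult.commute)
      show "(S has_integral (G x0 - G 0)) {0..x0}" by (rule acd_has_integral(2)[OF G]) (use x0 in auto)
      fix t assume t: "t \<in> {0..x0}"
      then have "\<tau> * t \<le> \<tau> * x0" using \<tau>0 by simp
      then have "exp (- (2 * \<tau> * x0 + 2 * C)) \<le> exp (- (2 * \<tau> * t + 2 * C))" by simp
      also have "\<dots> \<le> S t" using t x0 by (intro low) auto
      finally show "exp (- (2 * \<tau> * x0 + 2 * C)) \<le> S t" .
    qed
    then show ?thesis by (simp add: G_def mult.commute)
  qed
  then have "x0 * exp (- (2 * \<tau> * x0 + 2 * C)) * exp (- (2 * \<tau> * x0) - - (2 * \<tau> * 1)) \<le> G x0 * exp (- (2 * \<tau> * x0) - - (2 * \<tau> * 1))"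
    by (intro mult_right_mono) auto
  ultimately have "x0 * (exp (- (2 * \<tau> * x0 + 2 * C)) * exp (- (2 * \<tau> * x0) - - (2 * \<tau> * 1))) \<le> G 1"
    by (simp only: mult.assoc)
  then have "x0 * exp (2 * \<tau> - 4 * (\<tau> * x0) - 2 * C) \<le> G 1"
    by (simp only: exp_add[symmetric]) (simp add: algebra_simps)
  moreover have "x0 * exp (2 * \<tau> - 4 - 2 * C) \<le> x0 * exp (2 * \<tau> - 4 * (\<tau> * x0) - 2 * C)"
    using x0 by (intro mult_left_mono) auto
  ultimately have G1: "x0 * exp (2 * \<tau> - 4 - 2 * C) \<le> G 1" by linarith
  \<comment> \<open>The lower bound for \<open>G 1\<close> concerns the product of
    \<open>y1 1\<close> and \<open>y2 1\<close>. Dividing by the upper bound exp(\<tau> + C) for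
    \<open>y1 1\<close> isolates \<open>y2 1\<close> and turns 2\<tau> - 2C into \<tau> - 3C in the
    exponent.\<close>
  have "(norm (y1 1))\<^sup>2 \<le> (exp (\<tau> + C))\<^sup>2"
    using up norm_le_nsq(1)[of y1 1 y2] by (simp add: S_def exp_double[symmetric] algebra_simps)
  then have y1: "norm (y1 1) \<le> exp (\<tau> + C)" by (rule power2_le_imp_le) simp
  have "\<tau> * (x0 * exp (2 * \<tau> - 4 - 2 * C)) \<le> \<tau> * G 1" using G1 \<tau>0 by (intro mult_left_mono) auto
  also have "\<dots> \<le> norm (y1 1) * norm (y2 1)" using en[of 1] by simp
  also have "\<dots> \<le> exp (\<tau> + C) * norm (y2 1)" using y1 by (intro mult_right_mono) auto
  finally have "\<tau> * (x0 * exp (2 * \<tau> - 4 - 2 * C)) * exp (- (\<tau> + C)) \<le> exp (\<tau> + C) * norm (y2 1) * exp (- (\<tau> + C))"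
    by (intro mult_right_mono) auto
  also have "\<dots> = norm (y2 1) * (exp (\<tau> + C) * exp (- (\<tau> + C)))" by (simp only: mult_ac)
  also have "exp (\<tau> + C) * exp (- (\<tau> + C)) = 1" by (simp only: exp_add[symmetric] add.right_inverse exp_zero)
  also have "norm (y2 1) * 1 = norm (y2 1)" by simp
  finally have "\<tau> * x0 * (exp (2 * \<tau> - 4 - 2 * C) * exp (- (\<tau> + C))) \<le> norm (y2 1)" by (simp only: mult.assoc)
  moreover have "exp (2 * \<tau> - 4 - 2 * C) * exp (- (\<tau> + C)) = exp (\<tau> - 4 - 3 * C)"
    by (simp add: exp_add[symmetric])
  ultimately show ?thesis by (simp add: \<tau>_def C_def x0_def)
qed

text \<open>The columns \<open>u\<close> and \<open>o\<close> form the fundamental matrix that is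
  the identity at 0. Since \<open>u2\<close> vanishes at 0, the zeros of \<open>u2 l 1\<close> are
  the Dirichlet eigenvalues.\<close>

locale dirac =
  fixes p v :: "real \<Rightarrow> real" and u1 u2 o1 o2 :: "complex \<Rightarrow> real \<Rightarrow> complex"
  assumes p: "L1 p" and v: "L1 v"
    and u: "\<And>l. dirac_eq p v l (u1 l) (u2 l)" "\<And>l. u1 l 0 = 1" "\<And>l. u2 l 0 = 0"
    and o: "\<And>l. dirac_eq p v l (o1 l) (o2 l)" "\<And>l. o1 l 0 = 0" "\<And>l. o2 l 0 = 1"
    and hol: "\<And>x. x \<in> {0..1} \<Longrightarrow> (\<lambda>l. u1 l x) holomorphic_on UNIV" "\<And>x. x \<in> {0..1} \<Longrightarrow> (\<lambda>l. u2 l x) holomorphic_on UNIV"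
      "\<And>x. x \<in> {0..1} \<Longrightarrow> (\<lambda>l. o1 l x) holomorphic_on UNIV" "\<And>x. x \<in> {0..1} \<Longrightarrow> (\<lambda>l. o2 l x) holomorphic_on UNIV"

text \<open>
  In the variables $z_1 = e^{\theta} u_1 - F z_2$, $z_2 = e^{-\theta} u_2$ with $\theta = \int v$ and
  $F = \int 2 p e^{2\theta}$, which trivialise the system at $\lambda = 0$, the right-hand side
  becomes proportional to $\lambda$.
\<close>

lemma exists_dirac_solution:
  fixes p v :: "real \<Rightarrow> real" and a0 b0 :: complex
  assumes p: "L1 p" and v: "L1 v"
  shows "\<exists>u1 u2. (\<forall>l. dirac_eq p v l (u1 l) (u2 l)) \<and> (\<forall>l. u1 l 0 = a0) \<and> (\<forall>l. u2 l 0 = b0) \<and>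
    (\<forall>x\<in>{0..1}. (\<lambda>l. u1 l x) holomorphic_on UNIV) \<and> (\<forall>x\<in>{0..1}. (\<lambda>l. u2 l x) holomorphic_on UNIV)"
proof -
  define \<theta> where "\<theta> = (\<lambda>x. integral {0..x} v)"
  have \<theta>: "acd \<theta> v" by (rule acd_integralI[OF v, of _ 0]) (simp add: \<theta>_def)
  define E where "E = (\<lambda>x. exp (\<theta> x))"
  have E: "acd E (\<lambda>x. E x * v x)" unfolding E_def by (rule acd_exp[OF \<theta>])
  have Enz: "E x \<noteq> 0" for x by (simp add: E_def)
  define I where "I = (\<lambda>x. inverse (E x))"
  have I: "acd I (\<lambda>x. - v x * I x)" unfolding I_def
    by (rule acd_cong[OF acd_inverse[OF E Enz] refl])
      (use Enz in \<open>auto intro!: AE_M01_I simp: power2_eq_square\<close>)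
  have EI: "E x * I x = 1" for x using Enz by (simp add: I_def)
  have Ec: "continuous_on {0..1} E" and Ic: "continuous_on {0..1} I" using acd_continuous E I by auto
  define f where "f = (\<lambda>x. 2 * (E x)\<^sup>2 * p x)"
  have fi: "L1 f" unfolding f_def
    by (rule absolutely_integrable_continuous_mult[OF _ p]) (intro continuous_intros Ec)
  define F where "F = (\<lambda>x. integral {0..x} f)"
  have F: "acd F f" by (rule acd_integralI[OF fi, of _ 0]) (simp add: F_def)
  have Fc: "continuous_on {0..1} F" using acd_continuous F by auto
  define n11 where "n11 = (\<lambda>x. complex_of_real (- (F x * (I x)\<^sup>2)))"
  define n12 where "n12 = (\<lambda>x. complex_of_real (- ((E x)\<^sup>2 + (F x)\<^sup>2 * (I x)\<^sup>2)))"
  define n21 where "n21 = (\<lambda>x. complex_of_real ((I x)\<^sup>2))"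
  define n22 where "n22 = (\<lambda>x. complex_of_real ((I x)\<^sup>2 * F x))"
  have ni: "L1 n11" "L1 n12" "L1 n21" "L1 n22"
    unfolding n11_def n12_def n21_def n22_def
    by (intro absolutely_integrable_of_real absolutely_integrable_continuous_real continuous_intros Ec Ic Fc)+
  obtain a b :: "complex \<Rightarrow> real \<Rightarrow> complex" where
    a: "\<forall>l. acd (a l) (\<lambda>t. l * (n11 t * a l t + n12 t * b l t))" and
    b: "\<forall>l. acd (b l) (\<lambda>t. l * (n21 t * a l t + n22 t * b l t))" and
    ab: "\<forall>l. a l 0 = a0" "\<forall>l. b l 0 = b0"
    "\<forall>x\<in>{0..1}. (\<lambda>l. a l x) holomorphic_on UNIV" "\<forall>x\<in>{0..1}. (\<lambda>l. b l x) holomorphic_on UNIV"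
    using exists_linear_system_solution[OF ni, of a0 b0] by (elim exE conjE)
  show ?thesis
  proof (intro exI conjI allI ballI)
    fix l
    let ?u1 = "\<lambda>x. of_real (I x) * (a l x + of_real (F x) * b l x)" and ?u2 = "\<lambda>x. of_real (E x) * b l x"
    have EIc: "complex_of_real (E x) * of_real (I x) = 1" for x by (simp only: of_real_mult[symmetric] EI of_real_1)
    show "dirac_eq p v l ?u1 ?u2"
      unfolding dirac_eq_def
    proof
      show "acd ?u1 (\<lambda>x. - of_real (v x) * ?u1 x + (2 * of_real (p x) - l) * ?u2 x)"
      proof (rule acd_cong[OF acd_mult[OF acd_linear[OF bounded_linear_of_real I] acd_add[OF a[rule_format] acd_mult[OF acd_linear[OF bounded_linear_of_real F] b[rule_format]]]] refl], rule AE_M01_I)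
        fix x :: real
        let ?E = "complex_of_real (E x)" and ?I = "complex_of_real (I x)" and ?F = "complex_of_real (F x)"
        have 1: "?E * (?I * w) = w" for w using EIc[of x] by (metis mult.assoc mult_1)
        show "?I * (l * (n11 x * a l x + n12 x * b l x) + (?F * (l * (n21 x * a l x + n22 x * b l x)) + of_real (f x) * b l x)) +
          of_real (- v x * I x) * (a l x + ?F * b l x) =
          - of_real (v x) * (?I * (a l x + ?F * b l x)) + (2 * of_real (p x) - l) * (?E * b l x)"
          by (simp add: n11_def n12_def n21_def n22_def f_def power2_eq_square algebra_simps 1)
      qed
      show "acd ?u2 (\<lambda>x. l * ?u1 x + of_real (v x) * ?u2 x)"
      proof (rule acd_cong[OF acd_mult[OF acd_linear[OF bounded_linear_of_real E] b[rule_format]] refl], rule AE_M01_I)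
        fix x :: real
        let ?E = "complex_of_real (E x)" and ?I = "complex_of_real (I x)" and ?F = "complex_of_real (F x)"
        have 1: "?E * (?I * w) = w" "?E * (?F * (?I * w)) = ?F * w" for w
          using EIc[of x] by (metis mult.assoc mult_1, metis mult.assoc mult.commute mult_1)
        show "?E * (l * (n21 x * a l x + n22 x * b l x)) + of_real (E x * v x) * b l x =
          l * (?I * (a l x + ?F * b l x)) + of_real (v x) * (?E * b l x)"
          by (simp add: n21_def n22_def power2_eq_square algebra_simps 1)
      qed
    qed
    show "?u1 0 = a0" "?u2 0 = b0" using ab(1,2) by (simp_all add: E_def I_def \<theta>_def F_def)
  next
    fix x :: real assume "x \<in> {0..1}"
    then show "(\<lambda>l. of_real (I x) * (a l x + of_real (F x) * b l x)) holomorphic_on UNIV" "(\<lambda>l. of_real (E x) * b l x) holomorphic_on UNIV"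
      using ab(3,4) by (auto intro!: holomorphic_intros)
  qed
qed

lemma exists_dirac:
  assumes p: "L1 p" and v: "L1 v"
  obtains u1 u2 o1 o2 where "dirac p v u1 u2 o1 o2"
proof -
  obtain u1 u2 :: "complex \<Rightarrow> real \<Rightarrow> complex" where u: "\<forall>l. dirac_eq p v l (u1 l) (u2 l)" "\<forall>l. u1 l 0 = 1" "\<forall>l. u2 l 0 = 0"
    "\<forall>x\<in>{0..1}. (\<lambda>l. u1 l x) holomorphic_on UNIV" "\<forall>x\<in>{0..1}. (\<lambda>l. u2 l x) holomorphic_on UNIV"
    using exists_dirac_solution[OF p v, of 1 0] by (elim exE conjE)
  obtain o1 o2 :: "complex \<Rightarrow> real \<Rightarrow> complex" where o: "\<forall>l. dirac_eq p v l (o1 l) (o2 l)" "\<forall>l. o1 l 0 = 0" "\<forall>l. o2 l 0 = 1"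
    "\<forall>x\<in>{0..1}. (\<lambda>l. o1 l x) holomorphic_on UNIV" "\<forall>x\<in>{0..1}. (\<lambda>l. o2 l x) holomorphic_on UNIV"
    using exists_dirac_solution[OF p v, of 0 1] by (elim exE conjE)
  have "dirac p v u1 u2 o1 o2"
    by unfold_locales (use p v u o in blast)+
  then show ?thesis by (rule that)
qed

section \<open>Uniqueness for the Dirac system\<close>

text \<open>
  On the circle $|w - a| = 2$ about a real $a$ one has $|(w - a)^2 - 4| = 4\, |\mathrm{Im}\, w|$, so this factor
  removes the singularity of the bound.
\<close>

lemma entire_bound_off_real_axis_constant:
  fixes f :: "complex \<Rightarrow> complex"
  assumes hol: "f holomorphic_on UNIV"
    and bound: "\<And>z. Im z \<noteq> 0 \<Longrightarrow> norm (f z) \<le> K * (1 + 1 / \<bar>Im z\<bar>)"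
  shows "f z = f w"
proof -
  have K: "0 \<le> K" using bound[of \<i>] order_trans[OF norm_ge_zero, of "f \<i>" "K * 2"] by simp
  have "norm (f z) \<le> 3 * K" for z
  proof (cases "\<bar>Im z\<bar> \<le> 1")
    case True
    define a where "a = complex_of_real (Re z)"
    define h where "h = (\<lambda>w. ((w - a)\<^sup>2 - 4) * f w)"
    have holh: "h holomorphic_on UNIV" unfolding h_def by (intro holomorphic_intros hol)
    \<comment> \<open>On the circle \<open>\<bar>Im w\<bar> \<le> 2\<close>, so the bound for
      \<open>f\<close> times 4 |Im w| is at most 12 K; at \<open>z\<close>, straight above or below
      the centre, the factor has modulus at least 4, which leaves 3 K.\<close>
    have "norm (h z) \<le> 12 * K"
    proof (rule maximum_modulus_frontier[of h "cball a 2"])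
      show "h holomorphic_on interior (cball a 2)" using holh by (rule holomorphic_on_subset) auto
      show "continuous_on (closure (cball a 2)) h"
        using holomorphic_on_imp_continuous_on[OF holh] by (rule continuous_on_subset) auto
      show "z \<in> cball a 2"
      proof -
        have "z - a = \<i> * of_real (Im z)" by (simp add: a_def complex_eq_iff)
        then have "norm (z - a) = \<bar>Im z\<bar>" by (simp only: norm_mult norm_ii norm_of_real mult_1)
        then have "dist a z = \<bar>Im z\<bar>" by (simp only: dist_norm norm_minus_commute[of a z])
        then show ?thesis using True by simp
      qed
      fix w assume "w \<in> frontier (cball a 2)"
      then have w: "norm (w - a) = 2" by (simp add: dist_norm norm_minus_commute)
      have "(Re (w - a))\<^sup>2 + (Im (w - a))\<^sup>2 = 4" using w cmod_power2[of "w - a"] by simp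
      then have re: "(Re w - Re z) * (Re w - Re z) = 4 - Im w * Im w" by (simp add: a_def power2_eq_square)
      have "(w - a)\<^sup>2 - 4 = 2 * \<i> * of_real (Im w) * (w - a)"
        unfolding complex_eq_iff using re by (auto simp: a_def power2_eq_square algebra_simps)
      then have n: "norm ((w - a)\<^sup>2 - 4) = 4 * \<bar>Im w\<bar>" using w by (simp add: norm_mult)
      have imw: "\<bar>Im w\<bar> \<le> 2" using abs_Im_le_cmod[of "w - a"] w by (simp add: a_def)
      show "norm (h w) \<le> 12 * K"
      proof (cases "Im w = 0")
        case True
        then show ?thesis using n K by (simp add: h_def norm_mult)
      next
        case False
        have "norm (h w) = 4 * \<bar>Im w\<bar> * norm (f w)" by (simp add: h_def norm_mult n)
        also have "\<dots> \<le> 4 * \<bar>Im w\<bar> * (K * (1 + 1 / \<bar>Im w\<bar>))" using bound[OF False] by (intro mult_left_mono) auto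
        also have "\<dots> = 4 * K * (\<bar>Im w\<bar> + 1)" using False by (simp add: field_simps)
        also have "\<dots> \<le> 4 * K * 3" using imw K by (intro mult_left_mono) auto
        finally show ?thesis by simp
      qed
    qed auto
    moreover have "norm (h z) = ((Im z)\<^sup>2 + 4) * norm (f z)"
    proof -
      have "(z - a)\<^sup>2 - 4 = - of_real ((Im z)\<^sup>2 + 4)"
        unfolding complex_eq_iff by (simp add: a_def power2_eq_square)
      then show ?thesis by (simp only: h_def norm_mult norm_minus_cancel norm_of_real) simp
    qed
    moreover have "4 * norm (f z) \<le> ((Im z)\<^sup>2 + 4) * norm (f z)" by (intro mult_right_mono) auto
    ultimately show ?thesis by simp
  next
    case False
    then have "K * (1 + 1 / \<bar>Im z\<bar>) \<le> K * 3" using K by (intro mult_left_mono) (auto simp: field_simps)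
    moreover have "Im z \<noteq> 0" using False by auto
    ultimately show ?thesis using bound[of z] by (simp add: mult.commute)
  qed
  then have "bounded (range f)" by (auto simp: bounded_iff)
  from Liouville_theorem[OF hol this] show ?thesis by (auto simp: constant_on_def)
qed

section \<open>The Weyl function of one system\<close>

context dirac
begin

abbreviation "C \<equiv> pot_norm p v"

lemma det: "x \<in> {0..1} \<Longrightarrow> u1 l x * o2 l x - u2 l x * o1 l x = 1"
  using acd_const_eq[OF dirac_eq_cross[OF u(1)[of l] o(1)[of l]], of x] by (simp add: u o)

lemma u_cnj:
  assumes "x \<in> {0..1}"
  shows "u1 (cnj l) x = cnj (u1 l x)" "u2 (cnj l) x = cnj (u2 l x)"
  using dirac_eq_unique[OF u(1)[of "cnj l"] dirac_eq_cnj[OF u(1)[of l]] p v _ _ assms] by (auto simp: u)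

lemma u_upper:
  assumes x: "x \<in> {0..1}"
  shows "norm (u1 l x) \<le> exp (\<bar>Im l\<bar> * x + C)" "norm (u2 l x) \<le> exp (\<bar>Im l\<bar> * x + C)"
proof -
  have "nsq (u1 l) (u2 l) x \<le> nsq (u1 l) (u2 l) 0 * exp (2 * \<bar>Im l\<bar> * (x - 0) + 2 * C)"
    by (rule dirac_eq_growth(1)[OF u(1) p v]) (use x in auto)
  also have "\<dots> = (exp (\<bar>Im l\<bar> * x + C))\<^sup>2" by (simp add: nsq_def u exp_double[symmetric] algebra_simps)
  finally have "(norm (u1 l x))\<^sup>2 \<le> (exp (\<bar>Im l\<bar> * x + C))\<^sup>2" "(norm (u2 l x))\<^sup>2 \<le> (exp (\<bar>Im l\<bar> * x + C))\<^sup>2"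
    using norm_le_nsq(1)[of "u1 l" x "u2 l"] norm_le_nsq(2)[of "u2 l" x "u1 l"] by linarith+
  then show "norm (u1 l x) \<le> exp (\<bar>Im l\<bar> * x + C)" "norm (u2 l x) \<le> exp (\<bar>Im l\<bar> * x + C)"
    by (auto intro: power2_le_imp_le)
qed

lemma nsq_integral_pos:
  assumes x: "0 < x" "x \<le> 1"
  shows "0 < integral {0..x} (nsq (u1 l) (u2 l))"
proof -
  let ?S = "nsq (u1 l) (u2 l)" and ?c = "exp (- (2 * \<bar>Im l\<bar> + 2 * C))"
  have c: "continuous_on {0..1} ?S" unfolding nsq_def
    by (intro continuous_intros dirac_eqD(3,4)[OF u(1)])
  have "?c * x \<le> integral {0..x} ?S"
  proof (rule has_integral_le)
    show "((\<lambda>t. ?c) has_integral ?c * x) {0..x}"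
      using has_integral_const_real[of ?c 0 x] x by (simp add: mult.commute)
    have "?S integrable_on {0..x}"
      by (rule integrable_continuous_real, rule continuous_on_subset[OF c]) (use x in auto)
    then show "(?S has_integral integral {0..x} ?S) {0..x}" by (rule integrable_integral)
    fix t assume t: "t \<in> {0..x}"
    have "?S 0 \<le> ?S t * exp (2 * \<bar>Im l\<bar> * (t - 0) + 2 * C)"
      by (rule dirac_eq_growth(2)[OF u(1) p v]) (use t x in auto)
    also have "\<dots> \<le> ?S t * exp (2 * \<bar>Im l\<bar> + 2 * C)"
      using t x mult_left_mono[of t 1 "\<bar>Im l\<bar>"] by (intro mult_left_mono nsq_nonneg) auto
    finally have "1 * ?c \<le> ?S t * exp (2 * \<bar>Im l\<bar> + 2 * C) * ?c"
      by (intro mult_right_mono) (auto simp: nsq_def u)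
    also have "\<dots> = ?S t * (exp (2 * \<bar>Im l\<bar> + 2 * C) * ?c)" by (simp only: mult.assoc)
    also have "exp (2 * \<bar>Im l\<bar> + 2 * C) * ?c = 1" by (simp only: exp_add[symmetric] add.right_inverse exp_zero)
    finally show "?c \<le> ?S t" by simp
  qed
  moreover have "0 < ?c * x" using x by simp
  ultimately show ?thesis by linarith
qed

text \<open>By the energy identity a zero at \<open>x\<close> would make the integral of |u|^2 over
  \<open>{0..x}\<close> vanish. The point 1 gives reality of the eigenvalues; general
  \<open>x\<close> later allows division by \<open>u2 \<i> x\<close> when \<open>p\<close> is
  recovered.\<close>

lemma u2_nonzero:
  assumes l: "Im l \<noteq> 0" and x: "0 < x" "x \<le> 1"
  shows "u2 l x \<noteq> 0"
proof
  assume "u2 l x = 0"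
  then have "Im l * integral {0..x} (nsq (u1 l) (u2 l)) = 0"
    using dirac_eq_energy[OF u(1)[of l] u(3), of x] x by simp
  then show False using l nsq_integral_pos[OF x, of l] by simp
qed

lemma delta_lower:
  assumes l: "Im l \<noteq> 0"
  shows "\<bar>Im l\<bar> / (1 + \<bar>Im l\<bar>) * exp (\<bar>Im l\<bar> - 4 - 3 * C) \<le> norm (u2 l 1)"
proof (cases "0 < Im l")
  case True
  then show ?thesis using dirac_eq_lower_bound[OF u(1) p v u(2,3), of l] by simp
next
  case False
  have "norm (u2 (cnj l) 1) = norm (u2 l 1)" by (simp add: u_cnj)
  then show ?thesis using False l dirac_eq_lower_bound[OF u(1) p v u(2,3), of "cnj l"] by simp
qed

text \<open>Normalized so that the second component of \<open>weyl l * u - o\<close> vanishes at 1;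
  this combination is the Weyl solution up to sign.\<close>

definition "weyl l = o2 l 1 / u2 l 1"

text \<open>By \<open>det\<close> the numerator of the Weyl solution has the value (1, 0) at 1, so
  it is at most exp(|Im l| (1 - x) + C); the lower bound for \<open>u2 l 1\<close> divides out the
  growth over the whole interval. The decay that remains matches the growth of \<open>u\<close> at
  every \<open>x\<close>.\<close>

lemma weyl_solution_bound:
  assumes l: "Im l \<noteq> 0" and x: "x \<in> {0..1}"
  shows "norm (weyl l * u1 l x - o1 l x) \<le> (1 + 1 / \<bar>Im l\<bar>) * exp (4 + 4 * C - \<bar>Im l\<bar> * x)"
    "norm (weyl l * u2 l x - o2 l x) \<le> (1 + 1 / \<bar>Im l\<bar>) * exp (4 + 4 * C - \<bar>Im l\<bar> * x)"
proof -
  define \<tau> where "\<tau> = \<bar>Im l\<bar>"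
  have \<tau>: "0 < \<tau>" using l by (simp add: \<tau>_def)
  define y1 where "y1 = (\<lambda>x. o2 l 1 * u1 l x + (- u2 l 1) * o1 l x)"
  define y2 where "y2 = (\<lambda>x. o2 l 1 * u2 l x + (- u2 l 1) * o2 l x)"
  have y: "dirac_eq p v l y1 y2" unfolding y1_def y2_def by (rule dirac_eq_combination[OF u(1) o(1)])
  have nz: "u2 l 1 \<noteq> 0" using u2_nonzero[OF l, of 1] by simp
  have "y1 1 = 1" "y2 1 = 0" using det[of 1 l] by (simp_all add: y1_def y2_def algebra_simps)
  then have S1: "nsq y1 y2 1 = 1" by (simp add: nsq_def)
  have "nsq y1 y2 x \<le> nsq y1 y2 1 * exp (2 * \<bar>Im l\<bar> * (1 - x) + 2 * C)"
    by (rule dirac_eq_growth(2)[OF y p v]) (use x in auto)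
  also have "\<dots> = (exp (\<tau> * (1 - x) + C))\<^sup>2" by (simp add: S1 \<tau>_def exp_double[symmetric] algebra_simps)
  finally have "(norm (y1 x))\<^sup>2 \<le> (exp (\<tau> * (1 - x) + C))\<^sup>2" "(norm (y2 x))\<^sup>2 \<le> (exp (\<tau> * (1 - x) + C))\<^sup>2"
    using norm_le_nsq(1)[of y1 x y2] norm_le_nsq(2)[of y2 x y1] by linarith+
  then have yb: "norm (y1 x) \<le> exp (\<tau> * (1 - x) + C)" "norm (y2 x) \<le> exp (\<tau> * (1 - x) + C)"
    by (auto intro: power2_le_imp_le)
  have W: "weyl l * u1 l x - o1 l x = y1 x / u2 l 1" "weyl l * u2 l x - o2 l x = y2 x / u2 l 1"
    using nz by (simp_all add: weyl_def y1_def y2_def field_simps)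
  have dl: "\<tau> / (1 + \<tau>) * exp (\<tau> - 4 - 3 * C) \<le> norm (u2 l 1)" using delta_lower[OF l] by (simp add: \<tau>_def)
  have pos: "0 < \<tau> / (1 + \<tau>) * exp (\<tau> - 4 - 3 * C)" using \<tau> by simp
  have "norm (z / u2 l 1) \<le> (1 + 1 / \<tau>) * exp (4 + 4 * C - \<tau> * x)" if "norm z \<le> exp (\<tau> * (1 - x) + C)" for z
  proof -
    have "norm (z / u2 l 1) \<le> exp (\<tau> * (1 - x) + C) / (\<tau> / (1 + \<tau>) * exp (\<tau> - 4 - 3 * C))"
      unfolding norm_divide by (rule frac_le[OF _ that pos dl]) simp
    also have "\<dots> = (1 + \<tau>) / \<tau> * (exp (\<tau> * (1 - x) + C) / exp (\<tau> - 4 - 3 * C))" using \<tau> by simp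
    also have "exp (\<tau> * (1 - x) + C) / exp (\<tau> - 4 - 3 * C) = exp (4 + 4 * C - \<tau> * x)"
      by (simp add: exp_diff[symmetric] algebra_simps)
    also have "(1 + \<tau>) / \<tau> = 1 + 1 / \<tau>" using \<tau> by (simp add: field_simps)
    finally show ?thesis .
  qed
  then show "norm (weyl l * u1 l x - o1 l x) \<le> (1 + 1 / \<bar>Im l\<bar>) * exp (4 + 4 * C - \<bar>Im l\<bar> * x)"
    "norm (weyl l * u2 l x - o2 l x) \<le> (1 + 1 / \<bar>Im l\<bar>) * exp (4 + 4 * C - \<bar>Im l\<bar> * x)"
    unfolding W using yb by (simp_all add: \<tau>_def)
qed

text \<open>Squares instead of squared moduli, since this is what the difference quotient below
  converges to; both agree at the zeros of \<open>u2 l 1\<close>, which are real.\<close>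

definition "norming l = integral {0..1} (\<lambda>x. (u1 l x)\<^sup>2 + (u2 l x)\<^sup>2)"

lemma zero_real: "u2 l 1 = 0 \<Longrightarrow> Im l = 0"
  using u2_nonzero[of l 1] by auto

lemma norming_nonzero:
  assumes "u2 l 1 = 0"
  shows "norming l \<noteq> 0"
proof -
  have l: "cnj l = l" using zero_real[OF assms] by (simp add: complex_eq_iff)
  have "(u1 l x)\<^sup>2 + (u2 l x)\<^sup>2 = of_real (nsq (u1 l) (u2 l) x)" if "x \<in> {0..1}" for x
  proof -
    have sq: "(w::complex)\<^sup>2 = of_real ((norm w)\<^sup>2)" if "cnj w = w" for w
      using complex_norm_square[of w] unfolding that by (simp add: power2_eq_square)
    have "cnj (u1 l x) = u1 l x" "cnj (u2 l x) = u2 l x"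
      using u_cnj[OF that, of l, symmetric] unfolding l by auto
    from this[THEN sq] show ?thesis by (simp only: nsq_def of_real_add)
  qed
  then have "norming l = integral {0..1} (\<lambda>x. complex_of_real (nsq (u1 l) (u2 l) x))"
    unfolding norming_def by (intro Henstock_Kurzweil_Integration.integral_cong) auto
  also have "\<dots> = of_real (integral {0..1} (nsq (u1 l) (u2 l)))"
  proof -
    have "nsq (u1 l) (u2 l) integrable_on {0..1}" unfolding nsq_def
      by (intro integrable_continuous_real continuous_intros dirac_eqD(3,4)[OF u(1)])
    from integral_linear[OF this bounded_linear_of_real] show ?thesis by (simp add: o_def)
  qed
  finally show ?thesis using nsq_integral_pos[of 1 l] by simp
qed

lemma isCont_solutions:
  assumes "x \<in> {0..1}"
  shows "isCont (\<lambda>l. u1 l x) z" "isCont (\<lambda>l. u2 l x) z" "isCont (\<lambda>l. o2 l x) z"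
  using hol(1,2,4)[OF assms]
  by (auto simp: continuous_on_eq_continuous_at dest!: holomorphic_on_imp_continuous_on)

text \<open>Lagrange's identity for \<open>l\<close> and \<mu> expresses the quotient as an integral
  of products of the two solutions, and dominated convergence gives the limit. The derivative of the
  characteristic function is thus found without differentiating solutions in the parameter.\<close>

lemma delta_quotient_tendsto:
  assumes l: "u2 l 1 = 0"
  shows "(\<lambda>\<mu>. u1 l 1 * u2 \<mu> 1 / (\<mu> - l)) \<midarrow>l\<rightarrow> norming l"
proof -
  define H where "H = (\<lambda>\<mu>. integral {0..1} (\<lambda>x. u1 l x * u1 \<mu> x + u2 l x * u2 \<mu> x))"
  have eq: "u1 l 1 * u2 \<mu> 1 = (\<mu> - l) * H \<mu>" for \<mu>
  proof -
    have "((\<lambda>x. (\<mu> - l) * (u1 l x * u1 \<mu> x + u2 l x * u2 \<mu> x)) has_integral u1 l 1 * u2 \<mu> 1) {0..1}"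
      using acd_has_integral(2)[OF dirac_eq_cross[OF u(1)[of l] u(1)[of \<mu>]], of 1] by (simp add: u l)
    from integral_unique[OF this] show ?thesis by (simp add: H_def)
  qed
  have "(H \<longlongrightarrow> H l) (at l)"
    unfolding tendsto_at_iff_sequentially
  proof (intro allI impI)
    fix X :: "nat \<Rightarrow> complex" assume X: "X \<longlonglongrightarrow> l"
    then have "bounded (range X)" by (rule convergent_imp_bounded)
    then obtain R where R: "\<And>n. norm (X n) \<le> R" by (auto simp: bounded_iff)
    have cont: "continuous_on {0..1} (\<lambda>x. u1 l x * u1 \<mu> x + u2 l x * u2 \<mu> x)" for \<mu>
      by (intro continuous_intros dirac_eqD(3,4)[OF u(1)])
    have "(\<lambda>n. integral {0..1} (\<lambda>x. u1 l x * u1 (X n) x + u2 l x * u2 (X n) x)) \<longlonglongrightarrow> H l"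
      unfolding H_def
    proof (rule dominated_convergence(2))
      show "(\<lambda>x. u1 l x * u1 (X n) x + u2 l x * u2 (X n) x) integrable_on {0..1}" for n
        by (rule integrable_continuous_real[OF cont])
      show "(\<lambda>x. 2 * (exp (\<bar>Im l\<bar> + C) * exp (R + C))) integrable_on {0..1::real}"
        by (rule integrable_const_ivl)
      fix x :: real assume x: "x \<in> {0..1}"
      have b: "norm (u1 \<mu> x) \<le> exp (r + C)" "norm (u2 \<mu> x) \<le> exp (r + C)" if "\<bar>Im \<mu>\<bar> \<le> r" for \<mu> r
      proof -
        have "\<bar>Im \<mu>\<bar> * x \<le> r * 1" using x that by (intro mult_mono) auto
        then have "exp (\<bar>Im \<mu>\<bar> * x + C) \<le> exp (r + C)" by simp
        then show "norm (u1 \<mu> x) \<le> exp (r + C)" "norm (u2 \<mu> x) \<le> exp (r + C)"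
          using u_upper[OF x, of \<mu>] by linarith+
      qed
      show "norm (u1 l x * u1 (X n) x + u2 l x * u2 (X n) x) \<le> 2 * (exp (\<bar>Im l\<bar> + C) * exp (R + C))" for n
      proof -
        have "\<bar>Im (X n)\<bar> \<le> R" using R[of n] abs_Im_le_cmod[of "X n"] by linarith
        note b1 = b[OF this] and b2 = b[of l "\<bar>Im l\<bar>"]
        have "norm (u1 l x * u1 (X n) x + u2 l x * u2 (X n) x) \<le> norm (u1 l x) * norm (u1 (X n) x) + norm (u2 l x) * norm (u2 (X n) x)"
          by (metis norm_mult norm_triangle_ineq)
        also have "\<dots> \<le> exp (\<bar>Im l\<bar> + C) * exp (R + C) + exp (\<bar>Im l\<bar> + C) * exp (R + C)"
          using b1 b2 by (intro add_mono mult_mono) auto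
        finally show ?thesis by (simp only: mult_2)
      qed
      have "(\<lambda>n. u1 (X n) x) \<longlonglongrightarrow> u1 l x" "(\<lambda>n. u2 (X n) x) \<longlonglongrightarrow> u2 l x"
        using isCont_solutions[OF x] X by (auto intro: isCont_tendsto_compose[of l])
      then show "(\<lambda>n. u1 l x * u1 (X n) x + u2 l x * u2 (X n) x) \<longlonglongrightarrow> u1 l x * u1 l x + u2 l x * u2 l x"
        by (intro tendsto_intros)
    qed
    then show "(H \<circ> X) \<longlonglongrightarrow> H l" by (simp add: H_def o_def)
  qed
  moreover have "H l = norming l" by (simp add: H_def norming_def power2_eq_square)
  moreover have "\<forall>\<^sub>F \<mu> in at l. H \<mu> = u1 l 1 * u2 \<mu> 1 / (\<mu> - l)"
    unfolding eventually_at by (intro exI[of _ 1]) (auto simp: eq)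
  ultimately show ?thesis using tendsto_cong by force
qed

text \<open>At an eigenvalue the Wronskian reads \<open>u1 l 1 * o2 l 1 = 1\<close>, so the factor
  \<open>u1 l 1\<close> in the preceding limit cancels against \<open>o2 l 1\<close>.\<close>

lemma weyl_residue:
  assumes l: "u2 l 1 = 0"
  shows "(\<lambda>\<mu>. (\<mu> - l) * weyl \<mu>) \<midarrow>l\<rightarrow> 1 / norming l"
proof -
  have d: "u1 l 1 * o2 l 1 = 1" using det[of 1 l] l by simp
  have "(\<lambda>\<mu>. o2 \<mu> 1) \<midarrow>l\<rightarrow> o2 l 1" using isCont_solutions(3)[of 1 l] by (simp add: isCont_def)
  then have "(\<lambda>\<mu>. u1 l 1 * o2 \<mu> 1 / (u1 l 1 * u2 \<mu> 1 / (\<mu> - l))) \<midarrow>l\<rightarrow> u1 l 1 * o2 l 1 / norming l"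
    by (intro tendsto_intros delta_quotient_tendsto[OF l] norming_nonzero[OF l])
  moreover have "u1 l 1 \<noteq> 0" using d by auto
  ultimately show ?thesis using d by (simp add: weyl_def mult.commute)
qed

lemma delta_isolated:
  "\<exists>r>0. \<forall>w\<in>ball z r - {z}. u2 w 1 \<noteq> 0"
proof (cases "u2 z 1 = 0")
  case True
  \<comment> \<open>The entire function is not identically zero because it does not vanish at
    \<i>.\<close>
  obtain r where "r > 0" "\<And>w. w \<in> ball z r - {z} \<Longrightarrow> u2 w 1 \<noteq> 0"
    using isolated_zeros[of "\<lambda>l. u2 l 1" UNIV z \<i>] hol(2)[of 1] True u2_nonzero[of \<i> 1] by (auto simp: connected_UNIV)
  then show ?thesis by blast
next
  case False
  have "isCont (\<lambda>\<mu>. u2 \<mu> 1) z" by (rule isCont_solutions) simp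
  then obtain e where "e > 0" "\<And>y. dist z y < e \<Longrightarrow> u2 y 1 \<noteq> 0"
    using continuous_at_avoid[of z "\<lambda>\<mu>. u2 \<mu> 1" 0] False by auto
  then show ?thesis by (intro exI[of _ e]) auto
qed

definition "theta x = integral {0..x} v"

lemma theta: "acd theta v"
  by (rule acd_integralI[OF v, of _ 0]) (simp add: theta_def)

text \<open>For \<open>l = 0\<close> the second equation decouples: \<open>u2\<close> stays 0 and
  \<open>u1\<close> solves a scalar equation. Hence 0 is always a zero of \<open>u2 l 1\<close>, and
  constants in \<open>l\<close> can be evaluated there.\<close>

lemma at_zero_energy:
  assumes x: "x \<in> {0..1}"
  shows "u1 0 x = of_real (exp (- theta x))" "u2 0 x = 0" "o2 0 x = of_real (exp (theta x))"
proof -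
  have t0: "theta 0 = 0" by (simp add: theta_def)
  have e: "acd (\<lambda>x. complex_of_real (exp (- theta x))) (\<lambda>x. of_real (exp (- theta x) * - v x))"
    by (rule acd_linear[OF bounded_linear_of_real]) (intro acd_exp acd_minus theta)
  have "dirac_eq p v 0 (\<lambda>x. of_real (exp (- theta x))) (\<lambda>x. 0)"
    unfolding dirac_eq_def using e by (auto simp: mult.commute)
  from dirac_eq_unique[OF u(1) this p v _ _ x]
  show "u1 0 x = of_real (exp (- theta x))" "u2 0 x = 0" by (auto simp: u t0)
  have "o2 0 x * of_real (exp (- theta x)) = o2 0 0 * of_real (exp (- theta 0))"
    by (rule acd_const_eq[OF acd_mult[OF dirac_eqD(2)[OF o(1)] e] _ x]) (auto intro!: AE_M01_I simp: algebra_simps)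
  then have "o2 0 x * of_real (exp (- theta x)) = 1" by (simp add: o t0)
  moreover have "complex_of_real (exp (theta x)) * of_real (exp (- theta x)) = 1"
    by (simp only: of_real_mult[symmetric] exp_add[symmetric] add.right_inverse exp_zero of_real_1)
  ultimately show "o2 0 x = of_real (exp (theta x))"
    by (metis mult.assoc mult.commute mult.right_neutral)
qed

end

section \<open>Two systems with equal eigenvalues and norming constants\<close>

locale dirac_pair = D: dirac p v u1 u2 o1 o2 + D': dirac p' v' u1' u2' o1' o2'
  for p v u1 u2 o1 o2 p' v' u1' u2' o1' o2' +
  assumes zeros: "\<And>l. u2 l 1 = 0 \<longleftrightarrow> u2' l 1 = 0"
    and norming: "\<And>l. u2 l 1 = 0 \<Longrightarrow> D.norming l = D'.norming l"
begin

text \<open>Equal norming constants mean equal residues at the common simple poles, so all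
  singularities of the difference are removable.\<close>

lemma weyl_difference_entire:
  "\<exists>d. d holomorphic_on UNIV \<and> (\<forall>l. u2 l 1 \<noteq> 0 \<longrightarrow> d l = D'.weyl l - D.weyl l)"
proof -
  define q where "q = (\<lambda>l. D'.weyl l - D.weyl l)"
  \<comment> \<open>At the zeros of \<open>u2 l 1\<close> both Weyl functions are divisions by 0
    with the value 0, so the extension takes the limit there instead.\<close>
  define d where "d = (\<lambda>l. if u2 l 1 = 0 then Lim (at l) q else q l)"
  have "d field_differentiable at z" for z
  proof -
    obtain r where r: "r > 0" "\<And>w. w \<in> ball z r - {z} \<Longrightarrow> u2 w 1 \<noteq> 0"
      using D.delta_isolated[of z] by auto
    have hq: "q holomorphic_on ball z r - {z}"
      unfolding q_def D.weyl_def D'.weyl_def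
      by (intro holomorphic_intros) (use r zeros D.hol[of 1] D'.hol[of 1] in \<open>auto intro: holomorphic_on_subset\<close>)
    have "(\<lambda>w. (w - z) * q w) \<midarrow>z\<rightarrow> 0"
    proof (cases "u2 z 1 = 0")
      case True
      have "(\<lambda>w. (w - z) * D'.weyl w - (w - z) * D.weyl w) \<midarrow>z\<rightarrow> 1 / D'.norming z - 1 / D.norming z"
        by (intro tendsto_diff D.weyl_residue D'.weyl_residue) (use True zeros in auto)
      then show ?thesis using norming[OF True] by (simp add: q_def algebra_simps)
    next
      case False
      have "isCont (\<lambda>w. (w - z) * q w) z"
        unfolding q_def D.weyl_def D'.weyl_def using False zeros D.isCont_solutions(2,3)[of 1 z] D'.isCont_solutions(2,3)[of 1 z]
        by (intro continuous_intros) auto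
      then show ?thesis by (simp add: isCont_def)
    qed
    then obtain g where g: "g holomorphic_on ball z r" "\<And>w. w \<in> ball z r - {z} \<Longrightarrow> g w = q w"
      using holomorphic_on_extend_lim[OF hq] r(1) by auto
    have "isCont g z" using holomorphic_on_imp_continuous_on[OF g(1)] r(1) by (simp add: continuous_on_eq_continuous_at)
    then have "g \<midarrow>z\<rightarrow> g z" by (simp add: isCont_def)
    then have lim: "q \<midarrow>z\<rightarrow> g z"
      by (rule Lim_transform_eventually) (use r(1) g(2) in \<open>auto simp: eventually_at dist_commute intro!: exI[of _ r]\<close>)
    have dz: "d z = g z"
    proof (cases "u2 z 1 = 0")
      case True
      then show ?thesis using tendsto_Lim[OF _ lim] by (simp add: d_def)
    next
      case False
      have "isCont q z"
        unfolding q_def D.weyl_def D'.weyl_def using False zeros D.isCont_solutions(2,3)[of 1 z] D'.isCont_solutions(2,3)[of 1 z]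
        by (intro continuous_intros) auto
      then have "q \<midarrow>z\<rightarrow> q z" by (simp add: isCont_def)
      then have "q z = g z" using lim by (rule tendsto_unique[OF trivial_limit_at])
      then show ?thesis using False by (simp add: d_def)
    qed
    have "g w = d w" if "w \<in> ball z r" for w
    proof (cases "w = z")
      case True
      then show ?thesis using dz by simp
    next
      case False
      then have w: "w \<in> ball z r - {z}" using that by simp
      have "d w = q w" unfolding d_def using r(2)[OF w] by (rule if_not_P)
      then show ?thesis using g(2)[OF w] by simp
    qed
    then have "d holomorphic_on ball z r" by (rule holomorphic_transform[OF g(1)])
    then show ?thesis by (rule holomorphic_on_imp_differentiable_at) (use r in auto)
  qed
  then have "d holomorphic_on UNIV" by (simp add: holomorphic_on_def)
  then show ?thesis by (intro exI[of _ d]) (simp add: d_def q_def)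
qed

text \<open>
  The functions \<open>f1\<close> and \<open>f2\<close> are the entries of the second row of $\Phi \hat\Phi^{-1}$ (up to order and
  sign), where the columns of $\Phi$ are $u$ and the Weyl solution.
\<close>

lemma u2_proportional:
  assumes x: "x \<in> {0..1}"
  shows "u2 l x = of_real (exp (D.theta x - D'.theta x)) * u2' l x"
proof -
  obtain d where d: "d holomorphic_on UNIV" "\<And>l. u2 l 1 \<noteq> 0 \<Longrightarrow> d l = D'.weyl l - D.weyl l"
    using weyl_difference_entire by blast
  define f1 where "f1 = (\<lambda>l. d l * u2 l x * u1' l x - u2 l x * o1' l x + o2 l x * u1' l x)"
  define f2 where "f2 = (\<lambda>l. d l * u2 l x * u2' l x - u2 l x * o2' l x + o2 l x * u2' l x)"
  let ?K = "exp (D.C + 4 + 4 * D'.C) + exp (D'.C + 4 + 4 * D.C)"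
  have hol: "f1 holomorphic_on UNIV" "f2 holomorphic_on UNIV"
    unfolding f1_def f2_def using d(1) D.hol[OF x] D'.hol[OF x] by (auto intro!: holomorphic_intros)
  \<comment> \<open>One factor of each product grows at most like exp(|Im l| x) and the other decays
    at that rate; the exponentials cancel and only \<open>1 + 1 / \<bar>Im l\<bar>\<close>
    survives.\<close>
  have bd: "norm (a * b' - b * a') \<le> ?K * (1 + 1 / \<bar>Im l\<bar>)"
    if "norm a \<le> exp (\<bar>Im l\<bar> * x + D.C)" "norm a' \<le> exp (\<bar>Im l\<bar> * x + D'.C)"
      "norm b \<le> (1 + 1 / \<bar>Im l\<bar>) * exp (4 + 4 * D.C - \<bar>Im l\<bar> * x)"
      "norm b' \<le> (1 + 1 / \<bar>Im l\<bar>) * exp (4 + 4 * D'.C - \<bar>Im l\<bar> * x)" for a b a' b' :: complex and l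
  proof -
    have "norm (a * b' - b * a') \<le> norm a * norm b' + norm b * norm a'"
      by (metis norm_mult norm_triangle_ineq4)
    also have "\<dots> \<le> exp (\<bar>Im l\<bar> * x + D.C) * ((1 + 1 / \<bar>Im l\<bar>) * exp (4 + 4 * D'.C - \<bar>Im l\<bar> * x)) +
        (1 + 1 / \<bar>Im l\<bar>) * exp (4 + 4 * D.C - \<bar>Im l\<bar> * x) * exp (\<bar>Im l\<bar> * x + D'.C)"
      using that by (intro add_mono mult_mono) auto
    also have "\<dots> = (1 + 1 / \<bar>Im l\<bar>) * (exp (\<bar>Im l\<bar> * x + D.C) * exp (4 + 4 * D'.C - \<bar>Im l\<bar> * x) +
        exp (4 + 4 * D.C - \<bar>Im l\<bar> * x) * exp (\<bar>Im l\<bar> * x + D'.C))"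
      by (simp only: distrib_left mult_ac)
    also have "exp (\<bar>Im l\<bar> * x + D.C) * exp (4 + 4 * D'.C - \<bar>Im l\<bar> * x) = exp (D.C + 4 + 4 * D'.C)"
      by (simp add: exp_add[symmetric])
    also have "exp (4 + 4 * D.C - \<bar>Im l\<bar> * x) * exp (\<bar>Im l\<bar> * x + D'.C) = exp (D'.C + 4 + 4 * D.C)"
      by (simp add: exp_add[symmetric])
    finally show ?thesis by (simp only: mult.commute)
  qed
  have b1: "norm (f1 l) \<le> ?K * (1 + 1 / \<bar>Im l\<bar>)" if l: "Im l \<noteq> 0" for l
  proof -
    have "u2 l 1 \<noteq> 0" using D.u2_nonzero[OF l, of 1] by simp
    then have "f1 l = u2 l x * (D'.weyl l * u1' l x - o1' l x) - (D.weyl l * u2 l x - o2 l x) * u1' l x"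
      by (simp add: f1_def d(2) algebra_simps)
    then show ?thesis
      using bd[OF D.u_upper(2)[OF x] D'.u_upper(1)[OF x] D.weyl_solution_bound(2)[OF l x] D'.weyl_solution_bound(1)[OF l x]] by simp
  qed
  have b2: "norm (f2 l) \<le> ?K * (1 + 1 / \<bar>Im l\<bar>)" if l: "Im l \<noteq> 0" for l
  proof -
    have "u2 l 1 \<noteq> 0" using D.u2_nonzero[OF l, of 1] by simp
    then have "f2 l = u2 l x * (D'.weyl l * u2' l x - o2' l x) - (D.weyl l * u2 l x - o2 l x) * u2' l x"
      by (simp add: f2_def d(2) algebra_simps)
    then show ?thesis
      using bd[OF D.u_upper(2)[OF x] D'.u_upper(2)[OF x] D.weyl_solution_bound(2)[OF l x] D'.weyl_solution_bound(2)[OF l x]] by simp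
  qed
  \<comment> \<open>At \<open>l = 0\<close> both \<open>u2\<close> and \<open>u2'\<close> vanish, so
    the unknown value \<open>d 0\<close> drops out of the two constants.\<close>
  have f2: "f2 l = 0"
    using entire_bound_off_real_axis_constant[OF hol(2) b2, of l 0] D.at_zero_energy[OF x] D'.at_zero_energy[OF x]
    by (simp add: f2_def)
  have f1: "f1 l = of_real (exp (D.theta x)) * of_real (exp (- D'.theta x))"
    using entire_bound_off_real_axis_constant[OF hol(1) b1, of l 0] D.at_zero_energy[OF x] D'.at_zero_energy[OF x]
    by (simp add: f1_def)
  have "u2 l x = u2 l x * (u1' l x * o2' l x - u2' l x * o1' l x)" by (simp add: D'.det[OF x])
  also have "\<dots> = f1 l * u2' l x - f2 l * u1' l x" by (simp add: f1_def f2_def algebra_simps)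
  also have "\<dots> = of_real (exp (D.theta x - D'.theta x)) * u2' l x"
    unfolding f1 f2 by (simp only: of_real_mult[symmetric] exp_add[symmetric]) simp
  finally show ?thesis .
qed

text \<open>When the relation between \<open>u2\<close> and \<open>u2'\<close> is differentiated and
  compared with the second equations, the terms with \<open>v\<close> and \<open>v'\<close> cancel
  and \<open>l\<close> times the claim remains; \<open>l = 0\<close> follows by continuity in
  \<open>l\<close>.\<close>

lemma u1_proportional:
  assumes x: "x \<in> {0..1}"
  shows "u1 l x = of_real (exp (D.theta x - D'.theta x)) * u1' l x"
proof -
  define e where "e = (\<lambda>x. complex_of_real (exp (D.theta x - D'.theta x)))"
  have e: "acd e (\<lambda>x. of_real (exp (D.theta x - D'.theta x) * (v x - v' x)))"
    unfolding e_def by (rule acd_linear[OF bounded_linear_of_real]) (intro acd_exp acd_diff D.theta D'.theta)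
  have nz: "u1 l x = e x * u1' l x" if l: "l \<noteq> 0" and x: "x \<in> {0..1}" for l x
  proof (rule continuous_AE_eq[OF _ _ _ x])
    show "continuous_on {0..1} (u1 l)" by (rule dirac_eqD(3)[OF D.u(1)])
    show "continuous_on {0..1} (\<lambda>x. e x * u1' l x)"
      by (intro continuous_intros acd_continuous[OF e] dirac_eqD(3)[OF D'.u(1)])
    have "acd (u2 l) (\<lambda>x. e x * (l * u1' l x + of_real (v' x) * u2' l x) + of_real (exp (D.theta x - D'.theta x) * (v x - v' x)) * u2' l x)"
      by (rule acd_cong[OF acd_mult[OF e dirac_eqD(2)[OF D'.u(1)]]]) (auto simp: e_def u2_proportional)
    from acd_unique[OF dirac_eqD(2)[OF D.u(1)] this] AE_M01_mem
    show "AE x in M01. u1 l x = e x * u1' l x"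
    proof eventually_elim
      case (elim x)
      then have u2: "u2 l x = e x * u2' l x" by (simp add: e_def u2_proportional)
      have "l * u1 l x = l * (e x * u1' l x)" using elim(1) unfolding u2 by (simp add: e_def algebra_simps)
      then show ?case using l by simp
    qed
  qed
  show ?thesis
  proof (cases "l = 0")
    case True
    let ?g = "\<lambda>l. u1 l x - e x * u1' l x"
    have "isCont ?g 0"
      by (intro continuous_intros D.isCont_solutions[OF x] D'.isCont_solutions[OF x])
    then have "?g \<midarrow>0\<rightarrow> ?g 0" by (simp add: isCont_def)
    moreover have "?g \<midarrow>0\<rightarrow> 0"
      by (rule tendsto_eventually) (use nz[OF _ x] in \<open>auto simp: eventually_at intro!: exI[of _ 1]\<close>)
    ultimately have "?g 0 = 0" by (rule tendsto_unique[OF trivial_limit_at])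
    then show ?thesis using True by (simp add: e_def)
  next
    case False
    then show ?thesis using nz[OF False x] by (simp add: e_def)
  qed
qed

text \<open>At \<open>l = 0\<close> the explicit values turn the proportionality of
  \<open>u1\<close> and \<open>u1'\<close> into exp(-\<theta>) = exp(\<theta> - 2\<theta>'), where
  \<theta> and \<theta>' belong to the two systems.\<close>

lemma theta_eq:
  assumes x: "x \<in> {0..1}"
  shows "D.theta x = D'.theta x"
proof -
  have "complex_of_real (exp (- D.theta x)) = of_real (exp (D.theta x - D'.theta x) * exp (- D'.theta x))"
    using u1_proportional[OF x, of 0] D.at_zero_energy[OF x] D'.at_zero_energy[OF x] by simp
  then have "exp (- D.theta x) = exp (D.theta x - D'.theta x) * exp (- D'.theta x)"
    by (simp only: of_real_eq_iff)
  then have "- D.theta x = D.theta x - D'.theta x + - D'.theta x"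
    unfolding exp_add[symmetric] by (simp only: exp_inj_iff)
  then show ?thesis by simp
qed

lemma potentials_eq: "AE x in M01. v x = v' x" "AE x in M01. p x = p' x"
proof -
  have "acd D.theta v'" by (rule acd_cong[OF D'.theta]) (auto simp: theta_eq)
  from acd_unique[OF D.theta this] show v: "AE x in M01. v x = v' x" .
  \<comment> \<open>The nonreal parameter \<i> guarantees that \<open>u2\<close> has no zero in (0,
    1], so that the first equation determines \<open>p\<close>.\<close>
  have eq: "u1' \<i> x = u1 \<i> x" "u2' \<i> x = u2 \<i> x" if "x \<in> {0..1}" for x
    using u1_proportional[OF that] u2_proportional[OF that] theta_eq[OF that] by auto
  have "acd (u1 \<i>) (\<lambda>x. - of_real (v' x) * u1' \<i> x + (2 * of_real (p' x) - \<i>) * u2' \<i> x)"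
    by (rule acd_cong[OF dirac_eqD(1)[OF D'.u(1)]]) (auto simp: eq)
  from acd_unique[OF dirac_eqD(1)[OF D.u(1)] this] v AE_M01_mem
  show "AE x in M01. p x = p' x"
  proof eventually_elim
    case (elim x)
    have x: "x \<in> {0..1}" "0 < x" "x \<le> 1" using elim by auto
    have "(2 * of_real (p x) - \<i>) * u2 \<i> x = (2 * of_real (p' x) - \<i>) * u2 \<i> x"
      using elim(1,2) by (simp add: eq[OF x(1)])
    moreover have "u2 \<i> x \<noteq> 0" using D.u2_nonzero[of \<i> x] x by simp
    ultimately have "complex_of_real (p x) = of_real (p' x)" by simp
    then show ?case by simp
  qed
qed

end

section \<open>Spectral data of the pencil\<close>

locale pencil_dirac = dirac p v u1 u2 o1 o2 for p v u1 u2 o1 o2 +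
  fixes r h :: "real \<Rightarrow> real"
  assumes p_L2: "p \<in> L2" and r_L2: "r \<in> L2"
    and v_eq: "\<And>x. v x = r x + h x" and h: "acd h (\<lambda>x. - (v x)\<^sup>2)"
begin

lemma h_complex: "acd (\<lambda>x. complex_of_real (h x)) (\<lambda>x. - (of_real (v x))\<^sup>2)"
  using acd_linear[OF bounded_linear_of_real h] by simp

text \<open>Since \<open>v = r + h\<close>, the quasi-derivative of \<open>y2\<close> is
  \<open>l * y1 + h * y2\<close>. In its derivative the Riccati equation contributes
  \<open>h * v - v^2 = - r * v\<close>, which is what \<ell> requires.\<close>

lemma dirac_eq_dom_ell:
  assumes y: "dirac_eq p v l y1 y2"
  shows "y2 \<in> dom_ell r" "AE x in M01. ell r y2 x = l\<^sup>2 * y2 x - 2 * l * (of_real (p x) * y2 x)"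
    "\<And>x. x \<in> {0..1} \<Longrightarrow> quasi_deriv r y2 x = l * y1 x + of_real (h x) * y2 x"
proof -
  define e where "e = (\<lambda>x. l\<^sup>2 * y2 x - 2 * l * (of_real (p x) * y2 x))"
  define w where "w = (\<lambda>x. l * y1 x + of_real (h x) * y2 x)"
  note c = dirac_eqD(3,4)[OF y]
  have 1: "acd y2 (\<lambda>x. of_real (r x) * y2 x + w x)"
    by (rule acd_cong[OF dirac_eqD(2)[OF y] refl]) (auto intro!: AE_M01_I simp: w_def v_eq algebra_simps)
  have 2: "acd w (\<lambda>x. - of_real (r x) * w x - (of_real (r x))\<^sup>2 * y2 x - e x)"
    unfolding w_def
    by (rule acd_cong[OF acd_add[OF acd_cmult[OF dirac_eqD(1)[OF y], of l] acd_mult[OF h_complex dirac_eqD(2)[OF y]]] refl])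
      (auto intro!: AE_M01_I simp: e_def v_eq power2_eq_square algebra_simps)
  have ei: "L1 e"
  proof -
    have "L1 (\<lambda>x. (l\<^sup>2 * y2 x))"
      by (intro absolutely_integrable_continuous_real continuous_intros c)
    moreover have "L1 (\<lambda>x. (2 * l * y2 x) * of_real (p x))"
      by (rule absolutely_integrable_continuous_mult[OF _ absolutely_integrable_of_real[OF p]]) (intro continuous_intros c)
    ultimately have "L1 (\<lambda>x. l\<^sup>2 * y2 x - (2 * l * y2 x) * of_real (p x))"
      by (rule set_integral_diff(1))
    then show ?thesis by (simp add: e_def mult_ac)
  qed
  have "bounded (y2 ` {0..1})" using c(2) by (intro compact_imp_bounded compact_continuous_image) auto
  then obtain M where M: "\<And>x. x \<in> {0..1} \<Longrightarrow> norm (y2 x) \<le> M" unfolding bounded_iff by fastforce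
  have eL: "e \<in> L2"
  proof (rule L2_bound[OF ei p_L2])
    fix x :: real assume x: "x \<in> {0<..<1}"
    have M0: "norm (y2 x) \<le> M" "0 \<le> M" using M[of x] x order_trans[OF norm_ge_zero M[of x]] by auto
    have "e x = (l\<^sup>2 - 2 * l * of_real (p x)) * y2 x" by (simp add: e_def algebra_simps)
    then have "norm (e x) = norm (l\<^sup>2 - 2 * l * of_real (p x)) * norm (y2 x)" by (simp only: norm_mult)
    also have "\<dots> \<le> ((norm l)\<^sup>2 + 2 * norm l * \<bar>p x\<bar>) * M"
      using M0 norm_triangle_ineq4[of "l\<^sup>2" "2 * l * of_real (p x)"]
      by (intro mult_mono) (auto simp: norm_mult norm_power)
    also have "\<dots> \<le> (((norm l)\<^sup>2 + 2 * norm l) * (1 + \<bar>p x\<bar>)) * M"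
      using M0 by (intro mult_right_mono) (auto simp: algebra_simps)
    finally show "norm (e x) \<le> (((norm l)\<^sup>2 + 2 * norm l) * M) * (1 + \<bar>p x\<bar>)" by (simp only: mult_ac)
  qed
  from acd_imp_dom_ell[OF 1 2 eL]
  show "y2 \<in> dom_ell r" "AE x in M01. ell r y2 x = l\<^sup>2 * y2 x - 2 * l * (of_real (p x) * y2 x)"
    "\<And>x. x \<in> {0..1} \<Longrightarrow> quasi_deriv r y2 x = l * y1 x + of_real (h x) * y2 x"
    by (simp_all add: e_def w_def)
qed

text \<open>The product of \<open>u1\<close> and \<open>u2\<close> vanishes at both ends, and
  integrating its derivative trades the integral of \<open>u1^2\<close> for those of
  \<open>u2^2\<close> and \<open>p * u2^2\<close>.\<close>

lemma norming_constant_eq: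
  assumes l: "l \<noteq> 0" "u2 l 1 = 0"
  shows "norming_constant p l (u2 l) = norming l"
proof -
  note c = dirac_eqD(3,4)[OF u(1)[of l]]
  have sq: "L1 (\<lambda>x. (u1 l x)\<^sup>2)" "L1 (\<lambda>x. (u2 l x)\<^sup>2)"
    by (intro absolutely_integrable_continuous_real continuous_intros c)+
  have pu: "L1 (\<lambda>x. of_real (p x) * (u2 l x)\<^sup>2)"
    using absolutely_integrable_continuous_mult[OF continuous_on_power[OF c(2), of 2] absolutely_integrable_of_real[OF p]]
    by (simp add: mult.commute)
  define I1 where "I1 = integral {0..1} (\<lambda>x. (u1 l x)\<^sup>2)"
  define I2 where "I2 = integral {0..1} (\<lambda>x. (u2 l x)\<^sup>2)"
  define Ip where "Ip = integral {0..1} (\<lambda>x. of_real (p x) * (u2 l x)\<^sup>2)"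
  have int: "((\<lambda>x. (u1 l x)\<^sup>2) has_integral I1) {0..1}" "((\<lambda>x. (u2 l x)\<^sup>2) has_integral I2) {0..1}"
    "((\<lambda>x. of_real (p x) * (u2 l x)\<^sup>2) has_integral Ip) {0..1}"
    using sq pu by (auto simp: I1_def I2_def Ip_def absolutely_integrable_on_def)
  have "acd (\<lambda>x. u1 l x * u2 l x) (\<lambda>x. l * (u1 l x)\<^sup>2 - l * (u2 l x)\<^sup>2 + 2 * (of_real (p x) * (u2 l x)\<^sup>2))"
    by (rule acd_cong[OF acd_mult[OF dirac_eqD(1,2)[OF u(1)[of l]]] refl])
      (auto intro!: AE_M01_I simp: power2_eq_square algebra_simps)
  from acd_has_integral(2)[OF this, of 1]
  have "((\<lambda>x. l * (u1 l x)\<^sup>2 - l * (u2 l x)\<^sup>2 + 2 * (of_real (p x) * (u2 l x)\<^sup>2)) has_integral 0) {0..1}"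
    using l by (simp add: u)
  moreover have "((\<lambda>x. l * (u1 l x)\<^sup>2 - l * (u2 l x)\<^sup>2 + 2 * (of_real (p x) * (u2 l x)\<^sup>2)) has_integral l * I1 - l * I2 + 2 * Ip) {0..1}"
    by (intro has_integral_add has_integral_diff has_integral_mult_right int)
  ultimately have 0: "0 = l * I1 - l * I2 + 2 * Ip" by (rule has_integral_unique)
  have "l * I1 = (l * I1 - l * I2 + 2 * Ip) + (l * I2 - 2 * Ip)" by simp
  then have "l * I1 = l * I2 - 2 * Ip" unfolding 0[symmetric] by simp
  then have "l * I1 = l * (I2 - 2 / l * Ip)" using l(1) by (simp add: right_diff_distrib)
  then have "I1 = I2 - 2 / l * Ip" using l(1) by simp
  moreover have "norming l = I1 + I2"
    unfolding norming_def by (rule integral_unique) (intro has_integral_add int)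
  moreover have "norming_constant p l (u2 l) = 2 * I2 - 2 / l * Ip"
    unfolding norming_constant_def LINT_M01[OF sq(2)] LINT_M01[OF pu] I2_def Ip_def ..
  ultimately show ?thesis by simp
qed

lemma spectral_dataI:
  assumes l: "l \<noteq> 0" "u2 l 1 = 0"
  shows "(l, norming l) \<in> spectral_data p r"
proof -
  note d = dirac_eq_dom_ell[OF u(1)[of l]]
  have dom: "u2 l \<in> dom_A r" using d(1) l by (simp add: dom_A_def u)
  have nz: "\<not> (AE x in M01. u2 l x = 0)"
  proof
    assume ae: "AE x in M01. u2 l x = 0"
    have z: "u2 l x = 0" if "x \<in> {0..1}" for x
      by (rule continuous_AE_zero[OF dirac_eqD(4)[OF u(1)] ae that])
    have "acd (u2 l) (\<lambda>x. 0)" by (rule acd_cong[OF acd_const[of 0]]) (use z in auto)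
    from acd_unique[OF dirac_eqD(2)[OF u(1)] this] ae
    have "AE x in M01. u1 l x = 0" by eventually_elim (use l in auto)
    from continuous_AE_zero[OF dirac_eqD(3)[OF u(1)] this, of 0] show False by (simp add: u)
  qed
  have pen: "AE x in M01. pencil p r l (u2 l) x = 0"
    using d(2) by eventually_elim (simp add: pencil_def)
  have "l \<in> pencil_spectrum p r"
    unfolding pencil_spectrum_def op_spectrum_def boundedly_invertible_def mem_Collect_eq
    using dom nz pen by (auto simp: mult_zero_left)
  moreover have "eigenfunction p r l (u2 l)" using dom nz pen by (simp add: eigenfunction_def)
  moreover have "quasi_deriv r (u2 l) 0 = l" using d(3)[of 0] by (simp add: u)
  ultimately show ?thesis
    unfolding spectral_data_def using norming_constant_eq[OF l] by auto
qed

text \<open>The factorization run backwards: \<open>a = y' - v y\<close> satisfies the first Dirac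
  equation up to a factor \<open>l\<close>, so \<open>a / l\<close> and \<open>y\<close> form a
  Dirac solution. The normalization gives \<open>a 0 = l\<close>, and uniqueness identifies the
  solution with \<open>u\<close>.\<close>

lemma spectral_dataD:
  assumes "(l, \<alpha>) \<in> spectral_data p r"
  shows "l \<noteq> 0" "u2 l 1 = 0" "\<alpha> = norming l"
proof -
  obtain y where y: "eigenfunction p r l y" "quasi_deriv r y 0 = l" "\<alpha> = norming_constant p l y"
    using assms by (auto simp: spectral_data_def)
  then have dom: "y \<in> dom_ell r" "y 0 = 0" "y 1 = 0" and nz: "\<not> (AE x in M01. y x = 0)"
    and pen: "AE x in M01. pencil p r l y x = 0"
    by (auto simp: eigenfunction_def dom_A_def)
  define w where "w = quasi_deriv r y"
  have y': "acd y (\<lambda>x. of_real (r x) * y x + w x)" unfolding w_def by (rule dom_ell_acd(1)[OF dom(1)])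
  have w': "acd w (\<lambda>x. - of_real (r x) * w x - (of_real (r x))\<^sup>2 * y x - (l\<^sup>2 * y x - 2 * l * (of_real (p x) * y x)))"
    unfolding w_def
  proof (rule acd_cong[OF dom_ell_acd(2)[OF dom(1)] refl])
    show "AE x in M01. - of_real (r x) * quasi_deriv r y x - (of_real (r x))\<^sup>2 * y x - ell r y x =
      - of_real (r x) * quasi_deriv r y x - (of_real (r x))\<^sup>2 * y x - (l\<^sup>2 * y x - 2 * l * (of_real (p x) * y x))"
      using pen by eventually_elim (simp add: pencil_def)
  qed
  define a where "a = (\<lambda>x. w x - of_real (h x) * y x)"
  have ya: "acd y (\<lambda>x. a x + of_real (v x) * y x)"
    by (rule acd_cong[OF y' refl]) (auto intro!: AE_M01_I simp: a_def v_eq algebra_simps)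
  have aa: "acd a (\<lambda>x. - of_real (v x) * a x + l * ((2 * of_real (p x) - l) * y x))"
    unfolding a_def
    by (rule acd_cong[OF acd_diff[OF w' acd_mult[OF h_complex y']] refl])
      (auto intro!: AE_M01_I simp: v_eq power2_eq_square algebra_simps)
  have a0: "a 0 = l" using y(2) dom(2) by (simp add: a_def w_def)
  \<comment> \<open>For \<open>l = 0\<close> first \<open>a\<close> and then \<open>y\<close> solve
    scalar homogeneous equations with initial value 0, so no eigenfunction is left. Thus 0 belongs
    to the Dirac problem but not to the pencil. The scalar equations are treated as Dirac systems
    with \<open>p = 0\<close>.\<close>
  show l: "l \<noteq> 0"
  proof
    assume l0: "l = 0"
    have zero: "L1 (\<lambda>x::real. 0::real)" by simp
    have triv: "dirac_eq (\<lambda>x. 0) v 0 (\<lambda>x. 0) (\<lambda>x. 0)" by (simp add: dirac_eq_def)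
    have "dirac_eq (\<lambda>x. 0) v 0 a (\<lambda>x. 0)" using aa by (simp add: dirac_eq_def l0)
    from dirac_eq_unique(1)[OF this triv zero v] have az: "a x = 0" if "x \<in> {0..1}" for x
      using that a0 l0 by simp
    have "acd y (\<lambda>x. of_real (v x) * y x)"
      by (rule acd_cong[OF ya refl]) (use az in \<open>auto intro!: AE_M01_I\<close>)
    then have "dirac_eq (\<lambda>x. 0) v 0 (\<lambda>x. 0) y" by (simp add: dirac_eq_def)
    from dirac_eq_unique(2)[OF this triv zero v] have "y x = 0" if "x \<in> {0..1}" for x
      using that dom(2) by simp
    then have "AE x in M01. y x = 0" by (intro AE_M01_I) simp
    then show False using nz by simp
  qed
  have "dirac_eq p v l (\<lambda>x. inverse l * a x) y"
    unfolding dirac_eq_def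
  proof
    show "acd (\<lambda>x. inverse l * a x) (\<lambda>x. - of_real (v x) * (inverse l * a x) + (2 * of_real (p x) - l) * y x)"
      by (rule acd_cong[OF acd_cmult[OF aa] refl]) (use l in \<open>auto intro!: AE_M01_I simp: field_simps\<close>)
    show "acd y (\<lambda>x. l * (inverse l * a x) + of_real (v x) * y x)"
      by (rule acd_cong[OF ya refl]) (use l in \<open>auto intro!: AE_M01_I simp: mult.assoc[symmetric]\<close>)
  qed
  from dirac_eq_unique(2)[OF this u(1) p v] have eq: "y x = u2 l x" if "x \<in> {0..1}" for x
    using that a0 l dom(2) by (simp add: u)
  show u2: "u2 l 1 = 0" using eq[of 1] dom(3) by simp
  have "(LINT x|M01. (y x)\<^sup>2) = (LINT x|M01. (u2 l x)\<^sup>2)"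
    "(LINT x|M01. of_real (p x) * (y x)\<^sup>2) = (LINT x|M01. of_real (p x) * (u2 l x)\<^sup>2)"
    using eq by (auto intro!: Bochner_Integration.integral_cong)
  then have "norming_constant p l y = norming_constant p l (u2 l)" by (simp add: norming_constant_def)
  then show "\<alpha> = norming l" using y(3) norming_constant_eq[OF l u2] by simp
qed

text \<open>This is the integral that \<open>factorizes\<close> fixes as \<open>1 / N\<close>, so a
  common \<open>N\<close> gives both systems the same norming constant at 0.\<close>

lemma norming_at_zero: "norming 0 = of_real (integral {0..1} (\<lambda>x. exp (- 2 * theta x)))"
proof -
  have "continuous_on {0..1} (\<lambda>x. exp (- 2 * theta x))"
    by (intro continuous_intros acd_continuous[OF theta])
  then have "(\<lambda>x. exp (- 2 * theta x)) integrable_on {0..1}" by (rule integrable_continuous_real)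
  from integral_linear[OF this bounded_linear_of_real[where 'a = complex]]
  have "of_real (integral {0..1} (\<lambda>x. exp (- 2 * theta x))) = integral {0..1} (\<lambda>x. complex_of_real (exp (- 2 * theta x)))"
    by (simp add: o_def)
  also have "\<dots> = norming 0"
    unfolding norming_def
  proof (rule Henstock_Kurzweil_Integration.integral_cong)
    fix x :: real assume x: "x \<in> {0..1}"
    have "exp (- 2 * theta x) = (exp (- theta x))\<^sup>2" by (simp add: exp_double[symmetric])
    then show "complex_of_real (exp (- 2 * theta x)) = (u1 0 x)\<^sup>2 + (u2 0 x)\<^sup>2"
      by (simp add: at_zero_energy[OF x])
  qed
  finally show ?thesis by simp
qed

end

section \<open>Transfer from the Dirac systems to the pencils\<close>

lemma exists_pencil_dirac:
  fixes p r h \<theta> :: "real \<Rightarrow> real"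
  assumes p: "p \<in> L2" and r: "r \<in> L2" and h: "acd h (\<lambda>x. - (r x + h x)\<^sup>2)"
    and \<theta>: "acd \<theta> (\<lambda>x. r x + h x)" "\<theta> 0 = 0"
  shows "\<exists>u1 u2 o1 o2. pencil_dirac p (\<lambda>x. r x + h x) u1 u2 o1 o2 r h"
    and "x \<in> {0..1} \<Longrightarrow> integral {0..x} (\<lambda>x. r x + h x) = \<theta> x"
proof -
  have v: "L1 (\<lambda>x. r x + h x)" by (rule acd_has_integral(1)[OF \<theta>(1)])
  obtain u1 u2 o1 o2 where "dirac p (\<lambda>x. r x + h x) u1 u2 o1 o2"
    by (rule exists_dirac[OF L2_realD(1)[OF p] v])
  then have "pencil_dirac p (\<lambda>x. r x + h x) u1 u2 o1 o2 r h"
    by (intro pencil_dirac.intro pencil_dirac_axioms.intro p r h) auto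
  then show "\<exists>u1 u2 o1 o2. pencil_dirac p (\<lambda>x. r x + h x) u1 u2 o1 o2 r h" by blast
  show "x \<in> {0..1} \<Longrightarrow> integral {0..x} (\<lambda>x. r x + h x) = \<theta> x"
    using integral_unique[OF acd_has_integral(2)[OF \<theta>(1)]] \<theta>(2) by simp
qed

text \<open>Test functions vanish at 0 and 1, so an additive constant in \<open>r\<close> is
  invisible to the distribution \<open>r'\<close>.\<close>

lemma test_function_integral:
  assumes \<phi>: "\<phi> \<in> test_functions"
  shows "continuous_on {0..1} (deriv \<phi>)" "(deriv \<phi> has_integral 0) {0..1}"
proof -
  have d: "(deriv ^^ n) \<phi> field_differentiable at x" for n x using \<phi> by (auto simp: test_functions_def)
  have d0: "\<phi> field_differentiable at x" and d1: "deriv \<phi> field_differentiable at x" for x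
    using d[of 0 x] d[of 1 x] by simp_all
  show "continuous_on {0..1} (deriv \<phi>)"
    using d1 by (intro continuous_at_imp_continuous_on ballI field_differentiable_imp_continuous_at)
  obtain K where "K \<subseteq> {0<..<1}" "\<And>x. x \<notin> K \<Longrightarrow> \<phi> x = 0" using \<phi> by (auto simp: test_functions_def)
  then have "\<phi> 0 = 0 \<and> \<phi> 1 = 0" by force
  moreover have "(deriv \<phi> has_integral (\<phi> 1 - \<phi> 0)) {0..1}"
  proof (rule fundamental_theorem_of_calculus)
    fix x :: real
    have "(\<phi> has_field_derivative deriv \<phi> x) (at x)" using d0 by (simp add: DERIV_deriv_iff_field_differentiable)
    then show "(\<phi> has_vector_derivative deriv \<phi> x) (at x within {0..1})"
      using has_field_derivative_at_within has_real_derivative_iff_has_vector_derivative by blast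
  qed simp
  ultimately show "(deriv \<phi> has_integral 0) {0..1}" by simp
qed

theorem theorem2p5:
  fixes p p' r r' :: "real \<Rightarrow> real"
    and q q' :: "(real \<Rightarrow> real) \<Rightarrow> real"
  assumes "p \<in> L2" and "p' \<in> L2"
    and "primitive_of r q" and "primitive_of r' q'"
    and "A_positive r" and "A_positive r'"
    and "spectral_data p r = spectral_data p' r'"
  shows "(AE x in M01. p x = p' x) \<and> (\<forall>\<phi>\<in>test_functions. q \<phi> = q' \<phi>)"
proof -
  have r: "r \<in> L2" "r' \<in> L2" using assms(3,4) by (auto simp: primitive_of_def)
  obtain N1 where N1: "\<forall>N\<ge>N1. 0 < N \<and> (\<exists>h \<theta>. factorizes r N h \<theta>)"
    using A_positive_factorization[OF r(1) assms(5)] by (elim exE)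
  obtain N2 where N2: "\<forall>N\<ge>N2. 0 < N \<and> (\<exists>h \<theta>. factorizes r' N h \<theta>)"
    using A_positive_factorization[OF r(2) assms(6)] by (elim exE)
  \<comment> \<open>Beyond both thresholds, so that both operators have a factorization with the
    same norming constant \<open>1 / N\<close> at 0.\<close>
  define N where "N = max N1 N2"
  obtain h \<theta> where f: "factorizes r N h \<theta>" using N1[rule_format, of N] by (auto simp: N_def)
  obtain h' \<theta>' where f': "factorizes r' N h' \<theta>'" using N2[rule_format, of N] by (auto simp: N_def)
  note h = f[unfolded factorizes_def, THEN conjunct1]
    f[unfolded factorizes_def, THEN conjunct2, THEN conjunct1]
    f[unfolded factorizes_def, THEN conjunct2, THEN conjunct2, THEN conjunct1]
  note h' = f'[unfolded factorizes_def, THEN conjunct1]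
    f'[unfolded factorizes_def, THEN conjunct2, THEN conjunct1]
    f'[unfolded factorizes_def, THEN conjunct2, THEN conjunct2, THEN conjunct1]
  have hN: "((\<lambda>x. exp (- 2 * \<theta> x)) has_integral 1 / N) {0..1}"
    and hN': "((\<lambda>x. exp (- 2 * \<theta>' x)) has_integral 1 / N) {0..1}"
    using f f' by (simp_all add: factorizes_def)
  obtain u1 u2 o1 o2 where D: "pencil_dirac p (\<lambda>x. r x + h x) u1 u2 o1 o2 r h"
    using exists_pencil_dirac(1)[OF assms(1) r(1) h] by blast
  obtain u1' u2' o1' o2' where D': "pencil_dirac p' (\<lambda>x. r' x + h' x) u1' u2' o1' o2' r' h'"
    using exists_pencil_dirac(1)[OF assms(2) r(2) h'] by blast
  interpret D: pencil_dirac p "\<lambda>x. r x + h x" u1 u2 o1 o2 r h by (rule D)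
  interpret D': pencil_dirac p' "\<lambda>x. r' x + h' x" u1' u2' o1' o2' r' h' by (rule D')
  have "D.theta x = \<theta> x" "D'.theta x = \<theta>' x" if "x \<in> {0..1}" for x
    unfolding D.theta_def D'.theta_def
    using exists_pencil_dirac(2)[OF assms(1) r(1) h that] exists_pencil_dirac(2)[OF assms(2) r(2) h' that] by auto
  then have "integral {0..1} (\<lambda>x. exp (- 2 * D.theta x)) = integral {0..1} (\<lambda>x. exp (- 2 * \<theta> x))"
    "integral {0..1} (\<lambda>x. exp (- 2 * D'.theta x)) = integral {0..1} (\<lambda>x. exp (- 2 * \<theta>' x))"
    by (auto intro!: Henstock_Kurzweil_Integration.integral_cong)
  then have n0: "D.norming 0 = D'.norming 0"
    unfolding D.norming_at_zero D'.norming_at_zero using integral_unique[OF hN] integral_unique[OF hN'] by simp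
  have z0: "u2 0 1 = 0" "u2' 0 1 = 0" using D.at_zero_energy(2) D'.at_zero_energy(2) by auto
  \<comment> \<open>Nonzero eigenvalues are transported by the spectral data; the point 0, which is
    absent from them, is covered by the common \<open>N\<close>.\<close>
  have to: "u2' l 1 = 0 \<and> D.norming l = D'.norming l" if "u2 l 1 = 0" for l
  proof (cases "l = 0")
    case False
    from D.spectral_dataI[OF False that] have "(l, D.norming l) \<in> spectral_data p' r'" using assms(7) by simp
    from D'.spectral_dataD[OF this] show ?thesis by simp
  qed (use z0 n0 in simp)
  have from': "u2 l 1 = 0" if "u2' l 1 = 0" for l
  proof (cases "l = 0")
    case False
    from D'.spectral_dataI[OF False that] have "(l, D'.norming l) \<in> spectral_data p r" using assms(7) by simp
    from D.spectral_dataD[OF this] show ?thesis by simp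
  qed (use z0 in simp)
  interpret dirac_pair p "\<lambda>x. r x + h x" u1 u2 o1 o2 p' "\<lambda>x. r' x + h' x" u1' u2' o1' o2'
    by unfold_locales (use to from' in auto)
  have v: "AE x in M01. r x + h x = r' x + h' x" by (rule potentials_eq(1))
  \<comment> \<open>Both \<open>h\<close> and \<open>h'\<close> have derivative \<open>- v^2\<close>
    with the same \<open>v\<close>, so they differ by a constant, and therefore so do
    \<open>r\<close> and \<open>r'\<close>. More cannot be expected, as \<open>q\<close> determines
    its primitive only up to a constant.\<close>
  have const: "h x - h' x = h 0 - h' 0" if "x \<in> {0..1}" for x
    by (rule acd_const_eq[OF acd_diff[OF h(1) h'(1)] _ that]) (use v in \<open>auto elim: eventually_mono\<close>)
  have req: "AE x in M01. r x = r' x - (h 0 - h' 0)"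
    using v AE_M01_mem
  proof eventually_elim
    case (elim x)
    then show ?case using const[of x] by simp
  qed
  have "q \<phi> = q' \<phi>" if \<phi>: "\<phi> \<in> test_functions" for \<phi>
  proof -
    note t = test_function_integral[OF \<phi>]
    have ri: "L1 (\<lambda>x. r x * deriv \<phi> x)" "L1 (\<lambda>x. r' x * deriv \<phi> x)"
      using absolutely_integrable_continuous_mult[OF t(1)] L2_realD(1)[OF r(1)] L2_realD(1)[OF r(2)]
      by (simp_all add: mult.commute)
    have "((\<lambda>x. r' x * deriv \<phi> x - (h 0 - h' 0) * deriv \<phi> x) has_integral
        integral {0..1} (\<lambda>x. r' x * deriv \<phi> x) - (h 0 - h' 0) * 0) {0..1}"
      by (intro has_integral_diff has_integral_mult_right t(2) integrable_integral)
        (use ri(2) in \<open>simp add: absolutely_integrable_on_def\<close>)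
    moreover have "AE x in M01. r' x * deriv \<phi> x - (h 0 - h' 0) * deriv \<phi> x = r x * deriv \<phi> x"
      using req by eventually_elim (simp only: left_diff_distrib)
    ultimately have "((\<lambda>x. r x * deriv \<phi> x) has_integral integral {0..1} (\<lambda>x. r' x * deriv \<phi> x) - (h 0 - h' 0) * 0) {0..1}"
      by (rule has_integral_AE_cong) simp
    then have "integral {0..1} (\<lambda>x. r x * deriv \<phi> x) = integral {0..1} (\<lambda>x. r' x * deriv \<phi> x)"
      by (simp add: integral_unique)
    then show ?thesis
      using assms(3,4) \<phi> LINT_M01[OF ri(1)] LINT_M01[OF ri(2)] by (simp add: primitive_of_def)
  qed
  then show ?thesis using potentials_eq(2) by blast
qed

end
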